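(* Let $0<\alpha<1$, let $t$ be a positive integer, let $U\subseteq\mathbb{C}$ be a bounded open set, and suppose that $x\in\partial U$ admits a bounded point derivation on $A_\alpha(U)$ of order $t$. Then for every $\epsilon>0$ there exists a set $E$ with full area density at $x$ such that if $y\in E$ then for every $f\in A_\alpha(U)$ $$|R_x^t f(y)|\le \epsilon\,|y-x|^t\,\|f\|_{\mathrm{Lip}_\alpha(U)},$$ where $$R_x^t f(y)=f(y)-\sum_{j=0}^t\frac{f^{(j)}(x)}{j!}(y-x)^j .$$
   Context: For $0<\alpha<1$ and a bounded non-empty open set $U\subset\mathbb{C}$, the Lipschitz seminorm $\|f\|'_{\mathrm{Lip}_\alpha(U)}$ of a function $f$ is the smallest $k$ with $|f(z)-f(w)|\le k|z-w|^\alpha$ for all $z,w\in U$, and $\|f\|_{\mathrm{Lip}_\alpha(U)}=\|f\|'_{\mathrm{Lip}_\alpha(U)}+\sup_U|f|$. $\mathrm{Lip}_\alpha(U)$ is the space of functions with finite norm, and $\mathrm{lip}_\alpha(U)$ is the subspace of those $f$ with $\lim_{\delta\to0^+}\sup_{0<|z-w|<\delta}|f(z)-f(w)|/|z-w|^\alpha=0$. $A_\alpha(U)$ is the space of functions in $\mathrm{lip}_\alpha(U)$ that are analytic on $U$. $A_\alpha(U)$ admits a bounded point derivation of order $t$ at $x\in\partial U$ (equivalently, $x$ admits a bounded point derivation on $A_\alpha(U)$ of order $t$) if there is a constant $C$ such that $|f^{(t)}(x)|\le C\|f\|_{\mathrm{Lip}_\alpha(U)}$ whenever $f\in\mathrm{lip}_\alpha(U)$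 is analytic in a neighborhood of $U\cup\{x\}$. The existence of a bounded point derivation of order $t$ at $x$ implies the existence of those of all lower orders at $x$. For a general $f\in A_\alpha(U)$ and $1\le j\le t$, $f^{(j)}(x)$ denotes the value at $f$ of the $j$-th order bounded point derivation, i.e. $f^{(j)}(x)=\lim_k f_k^{(j)}(x)$ for functions $f_k\in\mathrm{lip}_\alpha(U)$ analytic in a neighborhood of $U\cup\{x\}$ with $\|f_k-f\|_{\mathrm{Lip}_\alpha(U)}\to0$; and $f^{(0)}(x)=f(x)$. A set $E$ has full area density at $x$ if $\lim_{r\to0}m(B_r(x)\cap E)/m(B_r(x))=1$, where $B_r(x)$ is the ball with center $x$ and radius $r$ and $m$ is $2$-dimensional Lebesgue measure. *)

theory Defs
  imports "HOL-Complex_Analysis.Complex_Analysis"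
begin

text \<open>Functions on \<open>U\<close> are represented by total functions of type \<open>complex \<Rightarrow> complex\<close>, whose
  values off \<open>U\<close> are irrelevant, except where analyticity near a boundary point is required.\<close>

definition lip_seminorm :: "real \<Rightarrow> complex set \<Rightarrow> (complex \<Rightarrow> complex) \<Rightarrow> real" where
  "lip_seminorm \<alpha> U f =
     Inf {k. \<forall>z\<in>U. \<forall>w\<in>U. cmod (f z - f w) \<le> k * cmod (z - w) powr \<alpha>}"

definition lip_norm :: "real \<Rightarrow> complex set \<Rightarrow> (complex \<Rightarrow> complex) \<Rightarrow> real" where
  "lip_norm \<alpha> U f = lip_seminorm \<alpha> U f + (SUP z\<in>U. cmod (f z))"

text \<open>Finiteness of the two parts of the norm is stated explicitly, since the real-valued
  \<open>Inf\<close> and \<open>SUP\<close> above are meaningless when the norm is infinite.\<close>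

definition big_lip_space :: "real \<Rightarrow> complex set \<Rightarrow> (complex \<Rightarrow> complex) set" where
  "big_lip_space \<alpha> U =
     {f. (\<exists>k. \<forall>z\<in>U. \<forall>w\<in>U. cmod (f z - f w) \<le> k * cmod (z - w) powr \<alpha>) \<and> bounded (f ` U)}"

definition little_lip_space :: "real \<Rightarrow> complex set \<Rightarrow> (complex \<Rightarrow> complex) set" where
  "little_lip_space \<alpha> U =
     {f \<in> big_lip_space \<alpha> U.
        ((\<lambda>\<delta>. SUP (z, w) \<in> {(z, w). z \<in> U \<and> w \<in> U \<and> 0 < cmod (z - w) \<and> cmod (z - w) < \<delta>}.
                cmod (f z - f w) / cmod (z - w) powr \<alpha>) \<longlongrightarrow> 0) (at_right 0)}"

definition analytic_lip_space :: "real \<Rightarrow> complex set \<Rightarrow> (complex \<Rightarrow> complex) set" where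
  "analytic_lip_space \<alpha> U = {f \<in> little_lip_space \<alpha> U. f analytic_on U}"

definition analytic_near_space :: "real \<Rightarrow> complex set \<Rightarrow> complex \<Rightarrow> (complex \<Rightarrow> complex) set" where
  "analytic_near_space \<alpha> U x = {f \<in> little_lip_space \<alpha> U. f analytic_on (U \<union> {x})}"

definition admits_bounded_point_derivation ::
    "real \<Rightarrow> complex set \<Rightarrow> nat \<Rightarrow> complex \<Rightarrow> bool" where
  "admits_bounded_point_derivation \<alpha> U t x \<longleftrightarrow>
     (\<exists>C. \<forall>f\<in>analytic_near_space \<alpha> U x. cmod ((deriv ^^ t) f x) \<le> C * lip_norm \<alpha> U f)"

text \<open>\<open>bpd_value \<alpha> U x j f\<close> is \<open>f\<^sup>(\<^sup>j\<^sup>)(x)\<close>. For \<open>x\<close> on the boundary of \<open>U\<close>, the value \<open>f(x)\<close> of a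
  Lipschitz function on \<open>U\<close> is that of its continuous extension; the value which the total function
  happens to take at \<open>x\<close> carries no information. For \<open>j \<ge> 1\<close> the description is unique whenever
  \<open>x\<close> admits a bounded point derivation of order \<open>j\<close>, since any two approximating sequences
  then have the same limit.\<close>

definition bpd_value ::
    "real \<Rightarrow> complex set \<Rightarrow> complex \<Rightarrow> nat \<Rightarrow> (complex \<Rightarrow> complex) \<Rightarrow> complex" where
  "bpd_value \<alpha> U x j f =
     (if j = 0 then Lim (at x within U) f
      else THE L. \<exists>g. (\<forall>k. g k \<in> analytic_near_space \<alpha> U x) \<and>
                      (\<lambda>k::nat. lip_norm \<alpha> U (\<lambda>z. g k z - f z)) \<longlonglongrightarrow> 0 \<and>
                      (\<lambda>k. (deriv ^^ j) (g k) x) \<longlonglongrightarrow> L)"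

definition taylor_remainder ::
    "real \<Rightarrow> complex set \<Rightarrow> complex \<Rightarrow> nat \<Rightarrow> (complex \<Rightarrow> complex) \<Rightarrow> complex \<Rightarrow> complex" where
  "taylor_remainder \<alpha> U x t f y =
     f y - (\<Sum>j = 0..t. bpd_value \<alpha> U x j f / fact j * (y - x) ^ j)"

definition full_area_density :: "complex set \<Rightarrow> complex \<Rightarrow> bool" where
  "full_area_density E x \<longleftrightarrow>
     E \<in> sets lebesgue \<and>
     ((\<lambda>r. measure lebesgue (ball x r \<inter> E) / measure lebesgue (ball x r)) \<longlongrightarrow> 1) (at_right 0)"

end

theory Submission
  imports Defs
begin

text \<open>Write \<open>D\<close> for the derivation \<open>f \<mapsto> f\<^sup>(\<^sup>t\<^sup>)(x)\<close>. Instead of representing \<open>D\<close> by a measure without mass at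
  \<open>x\<close>, we test it on explicit functions. A gliding hump argument, resting on \<open>lip\<close> being the little
  Lipschitz space, shows that there are no functions with bounded seminorm, arbitrarily small supremum
  and \<open>Re (D F)\<close> bounded below by a positive constant.

  If the complement of \<open>U\<close> had positive upper density at \<open>x\<close>, then Cauchy transforms of
  \<open>(\<zeta> - x)\<^sup>t\<^sup>+\<^sup>1 / r\<^sup>2\<close> over the part of the complement at distance about \<open>r\<close> from \<open>x\<close> would be such
  functions. If \<open>\<bar>R f\<^sub>y (y)\<bar> > \<epsilon> \<bar>y - x\<bar>\<^sup>t\<close> with \<open>f\<^sub>y\<close> in the unit ball held for a set of \<open>y \<in> U\<close> of positive
  upper density, then one packs that set with disjoint discs and takes weighted sums, over the
  centres \<open>y\<close>, of the difference quotients \<open>k\<^sub>y(z) = (R f\<^sub>y (z) - R f\<^sub>y (y)) / (z - y)\<close>, for which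
  \<open>D k\<^sub>y = t! R f\<^sub>y (y) / (y - x)\<^sup>t\<^sup>+\<^sup>1\<close>.

  This settles functions analytic near \<open>x\<close>. They are dense by a Vitushkin localization:
  \<open>f\<close> is corrected by \<open>\<integral> b(\<zeta>) (F \<zeta> - F z) / (\<zeta> - z)\<close>, where \<open>F\<close> is a Hoelder extension of \<open>f\<close> near \<open>x\<close>
  and \<open>b\<close> lives on an annulus, the Cauchy transform of \<open>b\<close> being 1 inside the annulus and 0 outside.\<close>

section \<open>Hoelder and Lipschitz spaces\<close>

text \<open>\<open>E\<close> must serve all functions at once, so every bad \<open>y\<close> may
  come with its own \<open>f\<^sub>y\<close>; only the common bound on the norms of the remainders
  ties the superposed quotients together. The weights are dictated by scaling. For discs of radius
  \<open>\<rho>\<close> inside the disc of radius \<open>r\<close> about \<open>x\<close>, a weight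
  of modulus \<open>\<rho>\<^sup>2 / r\<close> turns a sum over the packing into a Riesz potential
  divided by \<open>r\<close>. As \<open>k\<^sub>y(z)\<close> has size |z - y|^(\<alpha> - 1), the
  supremum of the sum is of order r^\<alpha>; as its Hoelder quotients have size 1 / |z - y|, the
  Hoelder constant is of order 1; and after a choice of phases each disc contributes at least
  \<rho>^2 / r times \<epsilon> / r to \<open>D\<close>, in total a constant. So the supremum tends
  to 0 while the seminorm need not: boundedness of \<open>D\<close> alone gives no contradiction,
  and this gap is what the gliding hump closes. Since values of \<open>f\<close> off
  \<open>U\<close> carry no information, \<open>E\<close> has to lie in \<open>U\<close>, which is
  why the complement must be shown to be thin as well.\<close>

lemma powr_add_le_add_powr:
  fixes a b p :: real
  assumes "0 \<le> a" "0 \<le> b" "0 \<le> p" "p \<le> 1"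
  shows "(a + b) powr p \<le> a powr p + b powr p"
proof (cases "a = 0 \<or> b = 0")
  case False
  then have pos: "0 < a" "0 < b" using assms by auto
  have le: "u \<le> u powr p" if "0 < u" "u \<le> 1" for u :: real
    using powr_mono'[of p 1 u] that assms by simp
  \<comment> \<open>After division by \<open>a + b\<close> both summands lie in [0, 1], where
    \<open>le\<close> applies.\<close>
  have "(a + b) powr p = (a + b) powr p * (a / (a + b) + b / (a + b))"
    using pos by (simp add: add_divide_distrib[symmetric])
  also have "\<dots> \<le> (a + b) powr p * ((a / (a + b)) powr p + (b / (a + b)) powr p)"
    using pos by (intro mult_left_mono add_mono le) auto
  also have "\<dots> = a powr p + b powr p"
    using pos by (simp add: powr_divide distrib_left)
  finally show ?thesis .
qed (use assms in auto)

text \<open>The constant is kept explicit, so that bounds can be added and multiplied without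
  handling the infimum in \<open>lip_seminorm\<close>.\<close>

definition holder_on :: "real \<Rightarrow> real \<Rightarrow> complex set \<Rightarrow> (complex \<Rightarrow> complex) \<Rightarrow> bool" where
  "holder_on \<alpha> k U f \<longleftrightarrow> (\<forall>z\<in>U. \<forall>w\<in>U. cmod (f z - f w) \<le> k * cmod (z - w) powr \<alpha>)"

lemma holder_onI:
  "(\<And>z w. z \<in> U \<Longrightarrow> w \<in> U \<Longrightarrow> cmod (f z - f w) \<le> k * cmod (z - w) powr \<alpha>) \<Longrightarrow> holder_on \<alpha> k U f"
  by (auto simp: holder_on_def)

lemma holder_onD:
  "holder_on \<alpha> k U f \<Longrightarrow> z \<in> U \<Longrightarrow> w \<in> U \<Longrightarrow> cmod (f z - f w) \<le> k * cmod (z - w) powr \<alpha>"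
  by (auto simp: holder_on_def)

lemma holder_on_mono: "holder_on \<alpha> k U f \<Longrightarrow> k \<le> k' \<Longrightarrow> holder_on \<alpha> k' U f"
  unfolding holder_on_def by (meson mult_right_mono order_trans powr_ge_zero)

lemma holder_on_add:
  assumes "holder_on \<alpha> k U f" "holder_on \<alpha> l U g"
  shows "holder_on \<alpha> (k + l) U (\<lambda>z. f z + g z)"
proof (rule holder_onI)
  fix z w assume zw: "z \<in> U" "w \<in> U"
  have "cmod (f z + g z - (f w + g w)) \<le> cmod (f z - f w) + cmod (g z - g w)"
    by (metis add_diff_add norm_triangle_ineq)
  also have "\<dots> \<le> k * cmod (z - w) powr \<alpha> + l * cmod (z - w) powr \<alpha>"
    using assms zw by (intro add_mono holder_onD) auto
  finally show "cmod (f z + g z - (f w + g w)) \<le> (k + l) * cmod (z - w) powr \<alpha>"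
    by (simp add: distrib_right)
qed

lemma holder_on_cmult:
  assumes "holder_on \<alpha> k U f"
  shows "holder_on \<alpha> (cmod c * k) U (\<lambda>z. c * f z)"
  using assms unfolding holder_on_def
  by (auto simp: right_diff_distrib[symmetric] norm_mult mult.assoc intro!: mult_left_mono)

lemma holder_on_const: "0 \<le> k \<Longrightarrow> holder_on \<alpha> k U (\<lambda>z. c)"
  by (auto simp: holder_on_def)

lemma norm_mult_diff_le:
  fixes a b c d :: complex
  shows "cmod (a * b - c * d) \<le> cmod a * cmod (b - d) + cmod d * cmod (a - c)"
proof -
  have "a * b - c * d = a * (b - d) + d * (a - c)" by (simp add: algebra_simps)
  then show ?thesis by (metis norm_mult norm_triangle_ineq)
qed

lemma holder_on_mult:
  assumes "holder_on \<alpha> k U f" "holder_on \<alpha> l U g"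
    and "\<And>z. z \<in> U \<Longrightarrow> cmod (f z) \<le> A" "\<And>z. z \<in> U \<Longrightarrow> cmod (g z) \<le> B"
  shows "holder_on \<alpha> (A * l + B * k) U (\<lambda>z. f z * g z)"
proof (rule holder_onI)
  fix z w assume zw: "z \<in> U" "w \<in> U"
  have "cmod (f z * g z - f w * g w) \<le> cmod (f z) * cmod (g z - g w) + cmod (g w) * cmod (f z - f w)"
    by (rule norm_mult_diff_le)
  also have "\<dots> \<le> A * (l * cmod (z - w) powr \<alpha>) + B * (k * cmod (z - w) powr \<alpha>)"
    using assms zw by (intro add_mono mult_mono holder_onD) (auto intro: order_trans[OF norm_ge_zero])
  finally show "cmod (f z * g z - f w * g w) \<le> (A * l + B * k) * cmod (z - w) powr \<alpha>"
    by (simp add: algebra_simps)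
qed

text \<open>Such pairs force Hoelder constants to be nonnegative and keep the suprema in the
  definition of \<open>lip\<close> from running over the empty set.\<close>

lemma open_close_points:
  fixes U :: "complex set"
  assumes "open U" "U \<noteq> {}" "0 < d"
  obtains z w where "z \<in> U" "w \<in> U" "0 < cmod (z - w)" "cmod (z - w) < d"
proof -
  obtain z where z: "z \<in> U" using assms by auto
  then obtain e where e: "e > 0" "ball z e \<subseteq> U" using assms openE by blast
  define w where "w = z + of_real (min d e / 2)"
  have "cmod (z - w) = min d e / 2"
    unfolding w_def using assms e by (simp add: norm_minus_commute[of _ z] del: of_real_divide)
  then have "cmod (z - w) < d" "0 < cmod (z - w)" "w \<in> ball z e"
    using assms e by (auto simp: dist_norm)
  then show thesis using z e that by blast
qed

locale lip_domain =
  fixes \<alpha> :: real and U :: "complex set"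
  assumes alpha_pos: "0 < \<alpha>" and alpha_less: "\<alpha> < 1"
    and open_U: "open U" and bounded_U: "bounded U" and U_nonempty: "U \<noteq> {}"
begin

abbreviation "lnorm \<equiv> lip_norm \<alpha> U"

abbreviation "Near \<equiv> analytic_near_space \<alpha> U"

abbreviation "Lip \<equiv> big_lip_space \<alpha> U"

abbreviation "lip \<equiv> little_lip_space \<alpha> U"

lemma holder_const_nonneg:
  assumes "holder_on \<alpha> k U f"
  shows "0 \<le> k"
proof -
  obtain z w where "z \<in> U" "w \<in> U" "0 < cmod (z - w)" "cmod (z - w) < 1"
    using open_close_points[OF open_U U_nonempty, of 1] by auto
  then have "0 \<le> k * cmod (z - w) powr \<alpha>" "0 < cmod (z - w) powr \<alpha>"
    using holder_onD[OF assms, of z w] order_trans[OF norm_ge_zero] by auto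
  then show ?thesis
    by (simp add: zero_le_mult_iff)
qed

lemma big_lip_iff: "f \<in> Lip \<longleftrightarrow> (\<exists>k. holder_on \<alpha> k U f) \<and> bounded (f ` U)"
  by (simp add: big_lip_space_def holder_on_def)

lemma lip_seminorm_eq: "lip_seminorm \<alpha> U f = Inf {k. holder_on \<alpha> k U f}"
  by (simp add: lip_seminorm_def holder_on_def)

lemma lip_seminorm_le: "holder_on \<alpha> k U f \<Longrightarrow> lip_seminorm \<alpha> U f \<le> k"
  unfolding lip_seminorm_eq
  by (rule cInf_lower) (auto intro!: bdd_belowI[of _ 0] holder_const_nonneg)

text \<open>The infimum is attained: for fixed distinct \<open>z\<close> and \<open>w\<close> the
  Hoelder quotient is a lower bound of all admissible constants.\<close>

lemma holder_on_lip_seminorm: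
  assumes "f \<in> Lip"
  shows "holder_on \<alpha> (lip_seminorm \<alpha> U f) U f"
proof (rule holder_onI)
  fix z w assume zw: "z \<in> U" "w \<in> U"
  obtain k where k: "holder_on \<alpha> k U f" using assms by (auto simp: big_lip_iff)
  show "cmod (f z - f w) \<le> lip_seminorm \<alpha> U f * cmod (z - w) powr \<alpha>"
  proof (cases "z = w")
    case False
    then have pos: "0 < cmod (z - w) powr \<alpha>" by simp
    have "cmod (f z - f w) / cmod (z - w) powr \<alpha> \<le> lip_seminorm \<alpha> U f"
      unfolding lip_seminorm_eq
      by (rule cInf_greatest) (use k pos zw in \<open>auto simp: pos_divide_le_eq holder_onD\<close>)
    then show ?thesis using pos by (simp add: field_simps)
  qed simp
qed

lemma norm_le_SUP:
  assumes "f \<in> Lip" "z \<in> U"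
  shows "cmod (f z) \<le> (SUP z\<in>U. cmod (f z))"
proof (rule cSUP_upper)
  show "bdd_above ((\<lambda>z. cmod (f z)) ` U)"
    using assms by (force simp: big_lip_iff bounded_iff bdd_above_def)
qed (use assms in auto)

lemma lip_seminorm_nonneg: "f \<in> Lip \<Longrightarrow> 0 \<le> lip_seminorm \<alpha> U f"
  using holder_on_lip_seminorm holder_const_nonneg by blast

lemma norm_le_lip_norm:
  assumes "f \<in> Lip" "z \<in> U"
  shows "cmod (f z) \<le> lnorm f"
  using norm_le_SUP[OF assms] lip_seminorm_nonneg[OF assms(1)] by (simp add: lip_norm_def)

lemma lip_norm_nonneg: "f \<in> Lip \<Longrightarrow> 0 \<le> lnorm f"
  using norm_le_lip_norm U_nonempty by (metis ex_in_conv norm_ge_zero order_trans)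

lemma holder_on_lip_norm:
  assumes "f \<in> Lip"
  shows "holder_on \<alpha> (lnorm f) U f"
proof -
  obtain z where "z \<in> U" using U_nonempty by auto
  then have "0 \<le> (SUP z\<in>U. cmod (f z))"
    using norm_le_SUP[OF assms] norm_ge_zero order_trans by blast
  then show ?thesis
    using holder_on_mono[OF holder_on_lip_seminorm[OF assms]] by (simp add: lip_norm_def)
qed

lemma big_lipI:
  assumes "holder_on \<alpha> k U f" "\<And>z. z \<in> U \<Longrightarrow> cmod (f z) \<le> B"
  shows "f \<in> Lip"
  using assms by (auto simp: big_lip_iff bounded_iff)

lemma lip_norm_le:
  assumes "holder_on \<alpha> k U f" "\<And>z. z \<in> U \<Longrightarrow> cmod (f z) \<le> B"
  shows "lnorm f \<le> k + B"
  unfolding lip_norm_def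
  using assms U_nonempty by (intro add_mono lip_seminorm_le cSUP_least) auto

lemma lip_norm_triangle:
  assumes "f \<in> Lip" "g \<in> Lip"
  shows "lnorm (\<lambda>z. f z + g z) \<le> lnorm f + lnorm g"
proof -
  have "lnorm (\<lambda>z. f z + g z) \<le> (lip_seminorm \<alpha> U f + lip_seminorm \<alpha> U g)
      + ((SUP z\<in>U. cmod (f z)) + (SUP z\<in>U. cmod (g z)))"
    using assms by (intro lip_norm_le holder_on_add holder_on_lip_seminorm
        order_trans[OF norm_triangle_ineq] add_mono norm_le_SUP)
  then show ?thesis by (simp add: lip_norm_def)
qed

lemma lip_norm_cmult_le:
  assumes "f \<in> Lip"
  shows "lnorm (\<lambda>z. c * f z) \<le> cmod c * lnorm f"
proof -
  have "lnorm (\<lambda>z. c * f z) \<le> cmod c * lip_seminorm \<alpha> U f + cmod c * (SUP z\<in>U. cmod (f z))"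
    using assms by (intro lip_norm_le holder_on_cmult holder_on_lip_seminorm)
      (auto simp: norm_mult intro!: mult_left_mono norm_le_SUP)
  then show ?thesis by (simp add: lip_norm_def distrib_left)
qed

section \<open>The little Lipschitz condition in epsilon-delta form\<close>

definition vanishing_holder :: "(complex \<Rightarrow> complex) \<Rightarrow> bool" where
  "vanishing_holder f \<longleftrightarrow> (\<forall>e>0. \<exists>d>0. \<forall>z\<in>U. \<forall>w\<in>U. cmod (z - w) < d \<longrightarrow>
      cmod (f z - f w) \<le> e * cmod (z - w) powr \<alpha>)"

lemma vanishing_holderD:
  assumes "vanishing_holder f" "0 < e"
  obtains d where "d > 0" "\<And>z w. z \<in> U \<Longrightarrow> w \<in> U \<Longrightarrow> cmod (z - w) < d \<Longrightarrow>
      cmod (f z - f w) \<le> e * cmod (z - w) powr \<alpha>"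
  using assms unfolding vanishing_holder_def by blast

text \<open>Membership in \<open>Lip\<close> bounds the quotients and openness of \<open>U\<close>
  makes every \<open>P \<delta>\<close> with \<delta> > 0 nonempty, so the \<open>SUP\<close> is a
  true supremum; off \<open>Lip\<close> both sides are false.\<close>

lemma little_lip_iff:
  "f \<in> lip \<longleftrightarrow> f \<in> Lip \<and> vanishing_holder f"
proof (cases "f \<in> Lip")
  case True
  define P where "P \<delta> = {(z, w). z \<in> U \<and> w \<in> U \<and> 0 < cmod (z - w) \<and> cmod (z - w) < \<delta>}" for \<delta>
  define q where "q = (\<lambda>(z, w). cmod (f z - f w) / cmod (z - w) powr \<alpha>)"
  obtain k where k: "holder_on \<alpha> k U f" using True by (auto simp: big_lip_iff)
  have qk: "q p \<le> k" if "p \<in> P \<delta>" for p \<delta>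
    using that holder_onD[OF k] by (auto simp: P_def q_def field_simps)
  have bdd: "bdd_above (q ` P \<delta>)" for \<delta>
    using qk by (auto intro!: bdd_aboveI[of _ k])
  have ne: "P \<delta> \<noteq> {}" if "\<delta> > 0" for \<delta>
  proof -
    obtain z w where "z \<in> U" "w \<in> U" "0 < cmod (z - w)" "cmod (z - w) < \<delta>"
      using open_close_points[OF open_U U_nonempty \<open>\<delta> > 0\<close>] .
    then have "(z, w) \<in> P \<delta>" by (simp add: P_def)
    then show ?thesis by blast
  qed
  have nonneg: "0 \<le> q p" for p by (auto simp: q_def split: prod.splits)
  have sup_nonneg: "0 \<le> (SUP p\<in>P \<delta>. q p)" if "\<delta> > 0" for \<delta>
    using ne[OF that] nonneg cSUP_upper[OF _ bdd] order_trans by (metis ex_in_conv)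
  have "((\<lambda>\<delta>. SUP p\<in>P \<delta>. q p) \<longlongrightarrow> 0) (at_right 0) \<longleftrightarrow> vanishing_holder f"
  proof
    assume lim: "((\<lambda>\<delta>. SUP p\<in>P \<delta>. q p) \<longlongrightarrow> 0) (at_right 0)"
    show "vanishing_holder f"
      unfolding vanishing_holder_def
    proof (intro allI impI)
      fix e :: real assume "e > 0"
      then have "eventually (\<lambda>\<delta>. (SUP p\<in>P \<delta>. q p) < e) (at_right 0)"
        using lim order_tendstoD(2) by blast
      then obtain b where b: "b > 0" "\<And>\<delta>. 0 < \<delta> \<Longrightarrow> \<delta> < b \<Longrightarrow> (SUP p\<in>P \<delta>. q p) < e"
        by (auto simp: eventually_at_right_field)
      have "cmod (f z - f w) \<le> e * cmod (z - w) powr \<alpha>"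
        if zw: "z \<in> U" "w \<in> U" "cmod (z - w) < b / 2" for z w
      proof (cases "z = w")
        case False
        then have "(z, w) \<in> P (b / 2)" using zw by (auto simp: P_def)
        then have "q (z, w) \<le> (SUP p\<in>P (b / 2). q p)" using bdd by (rule cSUP_upper)
        also have "\<dots> < e" using b by simp
        finally show ?thesis using False by (simp add: q_def field_simps)
      qed simp
      then show "\<exists>d>0. \<forall>z\<in>U. \<forall>w\<in>U. cmod (z - w) < d \<longrightarrow> cmod (f z - f w) \<le> e * cmod (z - w) powr \<alpha>"
        using \<open>b > 0\<close> by (intro exI[of _ "b / 2"]) auto
    qed
  next
    assume van: "vanishing_holder f"
    show "((\<lambda>\<delta>. SUP p\<in>P \<delta>. q p) \<longlongrightarrow> 0) (at_right 0)"
    proof (rule tendstoI)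
      fix e :: real assume "e > 0"
      then obtain d where d: "d > 0" "\<And>z w. z \<in> U \<Longrightarrow> w \<in> U \<Longrightarrow> cmod (z - w) < d \<Longrightarrow>
          cmod (f z - f w) \<le> e / 2 * cmod (z - w) powr \<alpha>"
        using vanishing_holderD[OF van, of "e/2"] by (metis half_gt_zero)
      have "dist (SUP p\<in>P \<delta>. q p) 0 < e" if \<delta>: "0 < \<delta>" "\<delta> < d" for \<delta>
      proof -
        have "(SUP p\<in>P \<delta>. q p) \<le> e / 2"
          using ne[OF \<delta>(1)]
          by (intro cSUP_least) (use d(2) \<delta> in \<open>fastforce simp: P_def q_def field_simps\<close>)+
        then show ?thesis using sup_nonneg[OF \<delta>(1)] \<open>e > 0\<close> by simp
      qed
      then show "eventually (\<lambda>\<delta>. dist (SUP p\<in>P \<delta>. q p) 0 < e) (at_right 0)"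
        using \<open>d > 0\<close> by (auto simp: eventually_at_right_field)
    qed
  qed
  then show ?thesis
    using True by (simp add: little_lip_space_def P_def q_def)
qed (auto simp: little_lip_space_def)

lemma vanishing_holder_add:
  assumes "vanishing_holder f" "vanishing_holder g"
  shows "vanishing_holder (\<lambda>z. f z + g z)"
  unfolding vanishing_holder_def
proof (intro allI impI)
  fix e :: real assume "e > 0"
  then obtain d1 d2 where d: "d1 > 0" "d2 > 0"
    and f: "\<And>z w. z \<in> U \<Longrightarrow> w \<in> U \<Longrightarrow> cmod (z - w) < d1 \<Longrightarrow> cmod (f z - f w) \<le> e/2 * cmod (z - w) powr \<alpha>"
    and g: "\<And>z w. z \<in> U \<Longrightarrow> w \<in> U \<Longrightarrow> cmod (z - w) < d2 \<Longrightarrow> cmod (g z - g w) \<le> e/2 * cmod (z - w) powr \<alpha>"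
    using vanishing_holderD[OF assms(1), of "e/2"] vanishing_holderD[OF assms(2), of "e/2"]
    by (metis half_gt_zero)
  have "cmod (f z + g z - (f w + g w)) \<le> e * cmod (z - w) powr \<alpha>"
    if "z \<in> U" "w \<in> U" "cmod (z - w) < min d1 d2" for z w
  proof -
    have "cmod (f z + g z - (f w + g w)) \<le> cmod (f z - f w) + cmod (g z - g w)"
      by (metis add_diff_add norm_triangle_ineq)
    with f[of z w] g[of z w] that show ?thesis by auto
  qed
  then show "\<exists>d>0. \<forall>z\<in>U. \<forall>w\<in>U. cmod (z - w) < d \<longrightarrow>
      cmod (f z + g z - (f w + g w)) \<le> e * cmod (z - w) powr \<alpha>"
    using d by (intro exI[of _ "min d1 d2"]) auto
qed

lemma vanishing_holder_mult:
  assumes "vanishing_holder f" "vanishing_holder g"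
    and A: "\<And>z. z \<in> U \<Longrightarrow> cmod (f z) \<le> A" and B: "\<And>z. z \<in> U \<Longrightarrow> cmod (g z) \<le> B"
  shows "vanishing_holder (\<lambda>z. f z * g z)"
  unfolding vanishing_holder_def
proof (intro allI impI)
  fix e :: real assume "e > 0"
  have "0 \<le> A" "0 \<le> B"
    using A B U_nonempty norm_ge_zero order_trans by (metis ex_in_conv)+
  define e' where "e' = e / (A + B + 1)"
  have e': "e' > 0" "(A + B) * e' \<le> e"
    using \<open>e > 0\<close> \<open>0 \<le> A\<close> \<open>0 \<le> B\<close> by (auto simp: e'_def field_simps)
  then obtain d1 d2 where d: "d1 > 0" "d2 > 0"
    and f: "\<And>z w. z \<in> U \<Longrightarrow> w \<in> U \<Longrightarrow> cmod (z - w) < d1 \<Longrightarrow> cmod (f z - f w) \<le> e' * cmod (z - w) powr \<alpha>"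
    and g: "\<And>z w. z \<in> U \<Longrightarrow> w \<in> U \<Longrightarrow> cmod (z - w) < d2 \<Longrightarrow> cmod (g z - g w) \<le> e' * cmod (z - w) powr \<alpha>"
    using vanishing_holderD[OF assms(1), of e'] vanishing_holderD[OF assms(2), of e'] by metis
  have "cmod (f z * g z - f w * g w) \<le> e * cmod (z - w) powr \<alpha>"
    if zw: "z \<in> U" "w \<in> U" "cmod (z - w) < min d1 d2" for z w
  proof -
    have "cmod (f z * g z - f w * g w) \<le> cmod (f z) * cmod (g z - g w) + cmod (g w) * cmod (f z - f w)"
      by (rule norm_mult_diff_le)
    also have "\<dots> \<le> A * (e' * cmod (z - w) powr \<alpha>) + B * (e' * cmod (z - w) powr \<alpha>)"
      using A B \<open>0 \<le> A\<close> \<open>0 \<le> B\<close> f[of z w] g[of z w] zw by (intro add_mono mult_mono) auto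
    also have "\<dots> = ((A + B) * e') * cmod (z - w) powr \<alpha>" by (simp add: algebra_simps)
    also have "\<dots> \<le> e * cmod (z - w) powr \<alpha>" using e' by (intro mult_right_mono) auto
    finally show ?thesis .
  qed
  then show "\<exists>d>0. \<forall>z\<in>U. \<forall>w\<in>U. cmod (z - w) < d \<longrightarrow>
      cmod (f z * g z - f w * g w) \<le> e * cmod (z - w) powr \<alpha>"
    using d by (intro exI[of _ "min d1 d2"]) auto
qed

text \<open>The spare factor |z - w|^(\<beta> - \<alpha>) is bounded on the bounded set
  \<open>U\<close> and small for close points. This puts constants, the identity and Cauchy
  transforms into \<open>lip\<close>.\<close>

lemma little_lip_holder:
  assumes "holder_on \<beta> k U f" "\<alpha> < \<beta>" "0 \<le> k"
  shows "f \<in> lip"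
proof -
  obtain D where D: "D > 0" "\<And>z w. z \<in> U \<Longrightarrow> w \<in> U \<Longrightarrow> cmod (z - w) \<le> D"
    using bounded_U unfolding bounded_two_points
    by (metis dist_norm less_eq_real_def max.cobounded1 max.cobounded2 order_trans
        max.strict_coboundedI2 zero_less_one)
  have split: "cmod (z - w) powr \<beta> = cmod (z - w) powr (\<beta> - \<alpha>) * cmod (z - w) powr \<alpha>" for z w
    by (simp add: powr_add[symmetric])
  have main: "cmod (f z - f w) \<le> (k * d powr (\<beta> - \<alpha>)) * cmod (z - w) powr \<alpha>"
    if "z \<in> U" "w \<in> U" "cmod (z - w) \<le> d" for z w d
  proof -
    have "cmod (f z - f w) \<le> k * (cmod (z - w) powr (\<beta> - \<alpha>) * cmod (z - w) powr \<alpha>)"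
      using holder_onD[OF assms(1) that(1,2)] by (simp only: split)
    also have "\<dots> \<le> k * (d powr (\<beta> - \<alpha>) * cmod (z - w) powr \<alpha>)"
      using that assms by (intro mult_left_mono mult_right_mono powr_mono2) auto
    finally show ?thesis by simp
  qed
  have h: "holder_on \<alpha> (k * D powr (\<beta> - \<alpha>)) U f"
    using main D by (intro holder_onI) auto
  obtain z0 where z0: "z0 \<in> U" using U_nonempty by auto
  have bd: "cmod (f z) \<le> k * D powr \<beta> + cmod (f z0)" if "z \<in> U" for z
  proof -
    have "cmod (f z - f z0) \<le> k * cmod (z - z0) powr \<beta>" using assms that z0 holder_onD by blast
    also have "\<dots> \<le> k * D powr \<beta>"
      using D(2)[OF that z0] assms alpha_pos by (intro mult_left_mono powr_mono2) auto
    finally show ?thesis using norm_triangle_sub[of "f z" "f z0"] by linarith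
  qed
  have van: "vanishing_holder f"
    unfolding vanishing_holder_def
  proof (intro allI impI)
    fix e :: real assume "e > 0"
    \<comment> \<open>Solves (k + 1) d^(\<beta> - \<alpha>) = e; the added 1 avoids division by 0
      when k = 0.\<close>
    define d where "d = (e / (k + 1)) powr (1 / (\<beta> - \<alpha>))"
    have "d > 0" using \<open>e > 0\<close> assms by (simp add: d_def)
    have "k * d powr (\<beta> - \<alpha>) \<le> e"
      using assms \<open>e > 0\<close> by (simp add: d_def powr_powr field_simps)
    then have "cmod (f z - f w) \<le> e * cmod (z - w) powr \<alpha>"
      if "z \<in> U" "w \<in> U" "cmod (z - w) < d" for z w
      using main[of z w d] that mult_right_mono[OF _ powr_ge_zero] by (meson less_imp_le order_trans)
    then show "\<exists>d>0. \<forall>z\<in>U. \<forall>w\<in>U. cmod (z - w) < d \<longrightarrow> cmod (f z - f w) \<le> e * cmod (z - w) powr \<alpha>"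
      using \<open>d > 0\<close> by blast
  qed
  show ?thesis
    using big_lipI[OF h bd] van by (simp add: little_lip_iff)
qed

section \<open>Closure properties of the function spaces\<close>

lemma little_lip_imp_big: "f \<in> lip \<Longrightarrow> f \<in> Lip"
  by (simp add: little_lip_iff)

lemma big_lip_add:
  assumes "f \<in> Lip" "g \<in> Lip"
  shows "(\<lambda>z. f z + g z) \<in> Lip"
  by (rule big_lipI[OF holder_on_add[OF assms[THEN holder_on_lip_norm]]])
    (use assms norm_le_lip_norm norm_triangle_mono in blast)

lemma big_lip_mult:
  assumes "f \<in> Lip" "g \<in> Lip"
  shows "(\<lambda>z. f z * g z) \<in> Lip"
proof (rule big_lipI)
  show "holder_on \<alpha> (lnorm f * lnorm g + lnorm g * lnorm f) U (\<lambda>z. f z * g z)"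
    using assms by (intro holder_on_mult holder_on_lip_norm norm_le_lip_norm)
  show "cmod (f z * g z) \<le> lnorm f * lnorm g" if "z \<in> U" for z
    using assms that by (simp add: norm_mult mult_mono norm_le_lip_norm lip_norm_nonneg)
qed

text \<open>The 3 counts two Leibniz terms from the seminorm and one product of suprema.\<close>

lemma lip_norm_mult_le:
  assumes "f \<in> Lip" "g \<in> Lip"
  shows "lnorm (\<lambda>z. f z * g z) \<le> 3 * lnorm f * lnorm g"
proof -
  have "lnorm (\<lambda>z. f z * g z)
      \<le> (lnorm f * lnorm g + lnorm g * lnorm f) + lnorm f * lnorm g"
    using assms by (intro lip_norm_le holder_on_mult holder_on_lip_norm)
      (auto simp: norm_mult mult_mono norm_le_lip_norm lip_norm_nonneg)
  then show ?thesis by (simp add: algebra_simps)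
qed

lemma little_lip_add:
  "f \<in> lip \<Longrightarrow> g \<in> lip \<Longrightarrow> (\<lambda>z. f z + g z) \<in> lip"
  by (simp add: little_lip_iff big_lip_add vanishing_holder_add)

lemma little_lip_mult:
  "f \<in> lip \<Longrightarrow> g \<in> lip \<Longrightarrow> (\<lambda>z. f z * g z) \<in> lip"
  by (auto simp: little_lip_iff big_lip_mult intro!: vanishing_holder_mult norm_le_lip_norm)

lemma little_lip_const: "(\<lambda>z. c) \<in> lip"
  using little_lip_holder[of 1 0 "\<lambda>z. c"] alpha_less by (auto intro: holder_on_const)

lemma big_lip_diff:
  assumes "f \<in> Lip" "g \<in> Lip"
  shows "(\<lambda>z. f z - g z) \<in> Lip"
  using big_lip_add[OF assms(1) big_lip_mult[OF little_lip_imp_big[OF little_lip_const[of "-1"]] assms(2)]]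
  by simp

lemma little_lip_ident: "(\<lambda>z. z) \<in> lip"
  using little_lip_holder[of 1 1 "\<lambda>z. z"] alpha_less by (auto simp: holder_on_def)

lemma near_little: "f \<in> Near x \<Longrightarrow> f \<in> lip"
  by (simp add: analytic_near_space_def)

lemma near_big: "f \<in> Near x \<Longrightarrow> f \<in> Lip"
  by (simp add: near_little little_lip_imp_big)

lemma near_analytic_at: "f \<in> Near x \<Longrightarrow> f analytic_on {x}"
  by (auto simp: analytic_near_space_def intro: analytic_on_subset)

lemma near_holomorphic: "f \<in> Near x \<Longrightarrow> f holomorphic_on U"
  by (auto simp: analytic_near_space_def intro: analytic_imp_holomorphic analytic_on_subset)

lemma near_add:
  "f \<in> Near x \<Longrightarrow> g \<in> Near x \<Longrightarrow>
    (\<lambda>z. f z + g z) \<in> Near x"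
  by (simp add: analytic_near_space_def little_lip_add analytic_on_add)

lemma near_mult:
  "f \<in> Near x \<Longrightarrow> g \<in> Near x \<Longrightarrow>
    (\<lambda>z. f z * g z) \<in> Near x"
  by (simp add: analytic_near_space_def little_lip_mult analytic_on_mult)

lemma near_const: "(\<lambda>z. c) \<in> Near x"
  by (simp add: analytic_near_space_def little_lip_const)

lemma near_ident: "(\<lambda>z. z) \<in> Near x"
  by (simp add: analytic_near_space_def little_lip_ident)

lemma near_cmult:
  "f \<in> Near x \<Longrightarrow> (\<lambda>z. c * f z) \<in> Near x"
  by (rule near_mult[OF near_const])

lemma near_diff:
  assumes "f \<in> Near x" "g \<in> Near x"
  shows "(\<lambda>z. f z - g z) \<in> Near x"
  using near_add[OF assms(1) near_cmult[OF assms(2), of "-1"]] by simp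

lemma near_power:
  "f \<in> Near x \<Longrightarrow> (\<lambda>z. f z ^ n) \<in> Near x"
  by (induction n) (auto intro: near_const near_mult)

lemma near_sum:
  "(\<And>i. i \<in> I \<Longrightarrow> f i \<in> Near x) \<Longrightarrow>
    (\<lambda>z. \<Sum>i\<in>I. f i z) \<in> Near x"
  by (induction I rule: infinite_finite_induct) (auto intro: near_const near_add)

end

section \<open>Riesz potentials in the plane\<close>

text \<open>Dyadic rings around the pole: between the radii R / 2^(k+1) and R / 2^k the kernel is at
  most \<open>c k\<close>, and enlarging the ring to the full disc leaves a geometric series of
  ratio 2^s / 4, which is below 1 because s < 2.\<close>

lemma riesz_nn_bound:
  assumes "0 \<le> s" "s < 2"
    and R: "0 < R"
  shows "(\<integral>\<^sup>+v\<in>cball (z::complex) R. ennreal (cmod (v - z) powr - s) \<partial>lborel)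
    \<le> ennreal (2 powr s * pi / (1 - 2 powr s / 4) * R powr (2 - s))"
proof -
  define q where "q = 2 powr s / 4"
  have q: "0 < q" "q < 1"
    using powr_less_mono[of s 2 "2::real"] assms by (auto simp: q_def)
  define c where "c k = (R / 2 ^ Suc k) powr - s" for k :: nat
  have pointwise: "ennreal (cmod (v - z) powr - s) * indicator (cball z R) v
      \<le> (\<Sum>k. ennreal (c k) * indicator (cball z (R / 2 ^ k)) v)" for v
  proof (cases "v \<noteq> z \<and> v \<in> cball z R")
    case True
    define a where "a = cmod (v - z)"
    have a: "0 < a" "a \<le> R" using True by (auto simp: a_def dist_norm norm_minus_commute)
    have "\<exists>n. R / a < 2 ^ n" using real_arch_pow[of 2 "R / a"] by simp
    then have "\<exists>n. R / 2 ^ n < a" using a by (simp add: field_simps)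
    \<comment> \<open>This least exponent is positive because a <= R; its predecessor indexes the
      ring that contains \<open>v\<close>.\<close>
    define n where "n = (LEAST n. R / 2 ^ n < a)"
    have n: "R / 2 ^ n < a" unfolding n_def by (rule LeastI_ex) fact
    have "n \<noteq> 0" using n a by (intro notI) simp
    then obtain k where k: "n = Suc k" by (cases n) auto
    have "a \<le> R / 2 ^ k" using not_less_Least[of k "\<lambda>n. R / 2 ^ n < a"] k by (simp add: n_def)
    moreover have "cmod (v - z) powr - s \<le> c k"
      unfolding c_def a_def[symmetric] using n k R assms by (intro powr_mono2') auto
    ultimately have "ennreal (cmod (v - z) powr - s) * indicator (cball z R) v
        \<le> ennreal (c k) * indicator (cball z (R / 2 ^ k)) v"
      using True by (auto simp: a_def dist_norm norm_minus_commute indicator_def intro!: ennreal_leI)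
    also have "\<dots> \<le> (\<Sum>k. ennreal (c k) * indicator (cball z (R / 2 ^ k)) v)"
    proof -
      define f where "f = (\<lambda>k. ennreal (c k) * indicator (cball z (R / 2 ^ k)) v)"
      have "f k \<le> suminf f" using sum_le_suminf[of f "{k}"] by simp
      then show ?thesis by (simp only: f_def)
    qed
    finally show ?thesis .
  \<comment> \<open>At the pole the left-hand side is 0, because \<open>0 powr - s = 0\<close>; off
    the disc the indicator vanishes.\<close>
  qed auto
  have "(\<integral>\<^sup>+v\<in>cball z R. ennreal (cmod (v - z) powr - s) \<partial>lborel)
      \<le> (\<integral>\<^sup>+v. (\<Sum>k. ennreal (c k) * indicator (cball z (R / 2 ^ k)) v) \<partial>lborel)"
    by (intro nn_integral_mono) (rule pointwise)
  also have "\<dots> = (\<Sum>k. \<integral>\<^sup>+v. ennreal (c k) * indicator (cball z (R / 2 ^ k)) v \<partial>lborel)"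
    by (intro nn_integral_suminf) (auto intro!: borel_measurable_times_ennreal borel_measurable_indicator)
  also have "\<dots> = (\<Sum>k. ennreal (2 powr s * pi * R powr (2 - s) * q ^ k))"
  proof (intro suminf_cong)
    fix k
    have "(\<integral>\<^sup>+v. ennreal (c k) * indicator (cball z (R / 2 ^ k)) v \<partial>lborel)
        = ennreal (c k) * emeasure lborel (cball z (R / 2 ^ k))"
      by (intro nn_integral_cmult_indicator) auto
    also have "\<dots> = ennreal (c k * (pi * (R / 2 ^ k)\<^sup>2))"
      using R by (simp add: emeasure_cball unit_ball_vol_2 ennreal_mult c_def)
    also have "c k * (pi * (R / 2 ^ k)\<^sup>2) = 2 powr s * pi * R powr (2 - s) * q ^ k"
    proof -
      have "c k = R powr - s * (2 powr s * (2 powr s) ^ k)"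
        unfolding c_def using R
        by (simp add: powr_divide powr_minus powr_mult divide_simps powr_powr powr_realpow[symmetric] mult.commute)
      moreover have "R powr (2 - s) = R\<^sup>2 * R powr - s"
        using R by (simp add: powr_diff powr_minus divide_inverse)
      moreover have "(2 ^ k :: real)\<^sup>2 = 4 ^ k"
        by (simp add: power2_eq_square power_mult_distrib[symmetric])
      ultimately show ?thesis by (simp add: q_def power_divide)
    qed
    finally show "(\<integral>\<^sup>+v. ennreal (c k) * indicator (cball z (R / 2 ^ k)) v \<partial>lborel)
        = ennreal (2 powr s * pi * R powr (2 - s) * q ^ k)" .
  qed
  also have "\<dots> = ennreal (\<Sum>k. 2 powr s * pi * R powr (2 - s) * q ^ k)"
    using q by (intro suminf_ennreal2 summable_mult summable_geometric) auto
  also have "(\<Sum>k. 2 powr s * pi * R powr (2 - s) * q ^ k) = 2 powr s * pi / (1 - 2 powr s / 4) * R powr (2 - s)"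
    using q by (simp add: suminf_mult suminf_geometric summable_geometric q_def)
  finally show ?thesis .
qed

text \<open>The first summand is for a pole within \<open>2 * r\<close> of the centre: the disc then
  fits into one of radius \<open>3 * r\<close> about the pole. The second is for a farther pole,
  where the kernel is at most \<open>r powr - s\<close> and only the area pi * r^2 remains.\<close>

definition riesz_const :: "real \<Rightarrow> real" where
  "riesz_const s = 2 powr s * pi / (1 - 2 powr s / 4) * 3 powr (2 - s) + pi"

text \<open>The bound does not depend on where the pole \<open>z\<close> lies relative to the disc;
  the later estimates are uniform in \<open>z\<close> for this reason.\<close>

lemma
  assumes "0 \<le> s" "s < 2"
  shows riesz_const_pos: "0 < riesz_const s"
    and riesz_integrable: "0 < r \<Longrightarrow> set_integrable lborel (cball x r) (\<lambda>v. cmod (v - z) powr - s)"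
    and riesz_integral_le: "0 < r \<Longrightarrow>
      (LINT v:cball x r|lborel. cmod (v - z) powr - s) \<le> riesz_const s * r powr (2 - s)"
proof -
  define C0 C where C0_def: "C0 = 2 powr s * pi / (1 - 2 powr s / 4)" and C_eq: "C = riesz_const s"
  have "2 powr s < (4::real)"
    using powr_less_mono[of s 2 "2::real"] assms by simp
  then have "0 < C0" by (simp add: C0_def)
  have C_def: "C = C0 * 3 powr (2 - s) + pi" by (simp add: C_eq riesz_const_def C0_def)
  have "0 < C" using \<open>0 < C0\<close> by (simp add: C_def add_pos_pos)
  then show "0 < riesz_const s" by (simp add: C_eq)
  have nn: "(\<integral>\<^sup>+v\<in>cball x r. ennreal (cmod (v - z) powr - s) \<partial>lborel) \<le> ennreal (C * r powr (2 - s))"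
    if r: "0 < r" for x z :: complex and r
  proof (cases "dist x z \<le> 2 * r")
    case True
    have "cball x r \<subseteq> cball z (3 * r)"
    proof
      fix y assume "y \<in> cball x r"
      then show "y \<in> cball z (3 * r)" using True dist_triangle[of z y x] by (simp add: dist_commute)
    qed
    then have "(\<integral>\<^sup>+v\<in>cball x r. ennreal (cmod (v - z) powr - s) \<partial>lborel)
        \<le> (\<integral>\<^sup>+v\<in>cball z (3*r). ennreal (cmod (v - z) powr - s) \<partial>lborel)"
      by (intro nn_set_integral_set_mono) auto
    also have "\<dots> \<le> ennreal (C0 * (3 * r) powr (2 - s))" unfolding C0_def using r by (intro riesz_nn_bound assms) simp
    also have "\<dots> \<le> ennreal (C * r powr (2 - s))"
      using r \<open>0 < C0\<close> by (intro ennreal_leI) (simp add: powr_mult C_def distrib_right)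
    finally show ?thesis .
  next
    case False
    have "(\<integral>\<^sup>+v\<in>cball x r. ennreal (cmod (v - z) powr - s) \<partial>lborel)
        \<le> (\<integral>\<^sup>+v\<in>cball x r. ennreal (r powr - s) \<partial>lborel)"
    proof (intro nn_integral_mono)
      fix v
      have "cmod (v - z) powr - s \<le> r powr - s" if "v \<in> cball x r"
        using that False r assms dist_triangle[of x z v]
        by (intro powr_mono2') (auto simp: dist_norm)
      then show "ennreal (cmod (v - z) powr - s) * indicator (cball x r) v
          \<le> ennreal (r powr - s) * indicator (cball x r) v"
        by (auto simp: indicator_def intro!: ennreal_leI)
    qed
    also have "\<dots> = ennreal (r powr - s) * emeasure lborel (cball x r)"
      by (intro nn_integral_cmult_indicator) auto
    also have "\<dots> = ennreal (r powr - s * (pi * r\<^sup>2))"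
      using r by (simp add: emeasure_cball unit_ball_vol_2 ennreal_mult)
    also have "\<dots> \<le> ennreal (C * r powr (2 - s))"
      using r \<open>0 < C0\<close> by (intro ennreal_leI) (simp add: powr_diff powr_minus divide_simps C_def distrib_right)
    finally show ?thesis .
  qed
  have int: "set_integrable lborel (cball x r) (\<lambda>v. cmod (v - z) powr - s)" if r: "0 < r" for x z :: complex and r
    unfolding set_integrable_def
  proof (rule integrableI_nonneg)
    show "(\<lambda>v. indicat_real (cball x r) v *\<^sub>R cmod (v - z) powr - s) \<in> borel_measurable lborel"
      by (auto intro!: borel_measurable_times borel_measurable_indicator powr_real_measurable)
    have "(\<integral>\<^sup>+v. ennreal (indicat_real (cball x r) v *\<^sub>R cmod (v - z) powr - s) \<partial>lborel)
        = (\<integral>\<^sup>+v\<in>cball x r. ennreal (cmod (v - z) powr - s) \<partial>lborel)"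
      by (intro nn_integral_cong) (auto simp: indicator_def)
    also have "\<dots> < \<infinity>" using order.strict_trans1[OF nn[OF r, of z x] ennreal_less_top] by simp
    finally show "(\<integral>\<^sup>+v. ennreal (indicat_real (cball x r) v *\<^sub>R cmod (v - z) powr - s) \<partial>lborel) < \<infinity>" .
  qed auto
  have "(LINT v:cball x r|lborel. cmod (v - z) powr - s) \<le> C * r powr (2 - s)" if r: "0 < r" for x z :: complex and r
    unfolding set_lebesgue_integral_def
  proof (rule integral_real_bounded)
    have "(\<integral>\<^sup>+v. ennreal (indicat_real (cball x r) v *\<^sub>R cmod (v - z) powr - s) \<partial>lborel)
        = (\<integral>\<^sup>+v\<in>cball x r. ennreal (cmod (v - z) powr - s) \<partial>lborel)"
      by (intro nn_integral_cong) (auto simp: indicator_def)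
    then show "(\<integral>\<^sup>+v. ennreal (indicat_real (cball x r) v *\<^sub>R cmod (v - z) powr - s) \<partial>lborel)
        \<le> ennreal (C * r powr (2 - s))" using nn[OF r] by simp
  qed (use \<open>0 < C\<close> in auto)
  with int show "0 < r \<Longrightarrow> set_integrable lborel (cball x r) (\<lambda>v. cmod (v - z) powr - s)"
    and "0 < r \<Longrightarrow> (LINT v:cball x r|lborel. cmod (v - z) powr - s) \<le> riesz_const s * r powr (2 - s)"
    by (simp_all add: C_eq)
qed

text \<open>The exceptional points \<open>z\<close> and \<open>w\<close> are where \<open>x / 0 = 0\<close> would spoil the bound.\<close>

lemma kernel_bound:
  fixes g :: "complex \<Rightarrow> complex"
  assumes s: "0 \<le> s" "s < 2" and r: "0 < r"
    and A: "A \<in> sets borel" "A \<subseteq> cball x r" and g: "g \<in> borel_measurable borel"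
    and B: "0 \<le> B" and bound: "\<And>v. v \<in> A \<Longrightarrow> v \<noteq> z \<Longrightarrow> v \<noteq> w \<Longrightarrow>
      cmod (g v) \<le> B * (cmod (v - z) powr - s + cmod (v - w) powr - s)"
  shows "set_integrable lborel A g"
    and "cmod (LINT v:A|lborel. g v) \<le> 2 * B * riesz_const s * r powr (2 - s)"
proof -
  define h where "h v = B * (cmod (v - z) powr - s + cmod (v - w) powr - s)" for v
  have h: "set_integrable lborel (cball x r) h"
    unfolding h_def by (intro set_integrable_mult_right set_integral_add riesz_integrable s r)
  have ae: "AE v in lborel. v \<noteq> z \<and> v \<noteq> w"
    using AE_lborel_singleton[of z] AE_lborel_singleton[of w] by eventually_elim auto
  have dom: "AE v in lborel. norm (indicat_real A v *\<^sub>R g v) \<le> indicat_real (cball x r) v *\<^sub>R h v"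
    using ae by eventually_elim (use A bound B in \<open>auto simp: indicator_def h_def\<close>)
  show int: "set_integrable lborel A g"
    unfolding set_integrable_def
  proof (rule Bochner_Integration.integrable_bound)
    show "integrable lborel (\<lambda>v. indicat_real (cball x r) v *\<^sub>R h v)"
      using h by (simp add: set_integrable_def)
    show "(\<lambda>v. indicat_real A v *\<^sub>R g v) \<in> borel_measurable lborel"
      using A g by (auto intro!: borel_measurable_scaleR borel_measurable_indicator)
    show "AE v in lborel. norm (indicat_real A v *\<^sub>R g v) \<le> norm (indicat_real (cball x r) v *\<^sub>R h v)"
      using dom by eventually_elim (auto intro: order_trans[OF _ abs_ge_self])
  qed
  have "cmod (LINT v:A|lborel. g v) \<le> (LINT v|lborel. norm (indicat_real A v *\<^sub>R g v))"
    unfolding set_lebesgue_integral_def by (rule integral_norm_bound)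
  also have "\<dots> \<le> (LINT v|lborel. indicat_real (cball x r) v *\<^sub>R h v)"
    using int h dom unfolding set_integrable_def by (intro integral_mono_AE integrable_norm)
  also have "\<dots> = B * ((LINT v:cball x r|lborel. cmod (v - z) powr - s) + (LINT v:cball x r|lborel. cmod (v - w) powr - s))"
    unfolding h_def set_lebesgue_integral_def[symmetric]
    by (simp add: set_integral_add(2) riesz_integrable s r)
  also have "\<dots> \<le> B * (riesz_const s * r powr (2 - s) + riesz_const s * r powr (2 - s))"
    using B by (intro mult_left_mono add_mono riesz_integral_le s r)
  finally show "cmod (LINT v:A|lborel. g v) \<le> 2 * B * riesz_const s * r powr (2 - s)"
    by (simp add: algebra_simps)
qed

text \<open>With a = |v - z|, b = |v - w| and d = |z - w| the left side is the modulus of 1 / (v -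
  z) - 1 / (v - w). In d = d^\<beta> d^(1 - \<beta>) only the second factor is estimated, by a power
  of twice the larger of \<open>a\<close> and \<open>b\<close>. The singularity rises to order 1 +
  \<beta>, which is still integrable for \<beta> < 1.\<close>

lemma kernel_difference_bound:
  fixes a b d \<beta> :: real
  assumes "0 < a" "0 < b" "0 \<le> d" "d \<le> a + b" "0 \<le> \<beta>" "\<beta> \<le> 1"
  shows "d / (a * b) \<le> 2 * d powr \<beta> * (a powr - (1 + \<beta>) + b powr - (1 + \<beta>))"
proof -
  have wlog: "d / (a * b) \<le> 2 * d powr \<beta> * a powr - (1 + \<beta>)"
    if "0 < a" "a \<le> b" "d \<le> a + b" for a b :: real
  proof -
    have "d = d powr \<beta> * d powr (1 - \<beta>)"
      using assms by (cases "d = 0") (auto simp: powr_add[symmetric])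
    also have "\<dots> \<le> d powr \<beta> * (2 * b) powr (1 - \<beta>)"
      using assms that by (intro mult_left_mono powr_mono2) auto
    also have "\<dots> \<le> d powr \<beta> * (2 * b powr (1 - \<beta>))"
      using powr_mono[of "1 - \<beta>" 1 "2::real"] assms that
      by (intro mult_left_mono) (auto simp: powr_mult intro!: mult_right_mono)
    finally have "d / (a * b) \<le> d powr \<beta> * (2 * b powr (1 - \<beta>)) / (a * b)"
      using that by (intro divide_right_mono) auto
    also have "\<dots> = 2 * d powr \<beta> * (b powr - \<beta> / a)"
      using that by (simp add: powr_diff powr_minus divide_simps)
    also have "\<dots> \<le> 2 * d powr \<beta> * (a powr - \<beta> / a)"
      using that assms by (intro mult_left_mono divide_right_mono powr_mono2') auto
    also have "a powr - \<beta> / a = a powr - (1 + \<beta>)"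
      using that by (simp add: powr_diff powr_minus_divide divide_simps powr_add)
    finally show ?thesis .
  qed
  have nn: "0 \<le> 2 * d powr \<beta> * a powr - (1 + \<beta>)" "0 \<le> 2 * d powr \<beta> * b powr - (1 + \<beta>)"
    by auto
  show ?thesis
  proof (cases "a \<le> b")
    case True
    then show ?thesis unfolding distrib_left using wlog[of a b] assms nn by linarith
  next
    case False
    then show ?thesis unfolding distrib_left mult.commute[of a b] using wlog[of b a] assms nn by linarith
  qed
qed

text \<open>Here the exponent of \<open>f\<close> itself is gained, and the singularity stays of
  order 1. The identity \<open>split\<close> isolates f w - f z over one pole; in the remaining term
  the factor a^\<alpha> supplied by \<open>f\<close> cancels part of the double pole before d =
  d^\<alpha> d^(1 - \<alpha>) is interpolated.\<close>

lemma holder_kernel_bound: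
  assumes f: "holder_on \<alpha> k V f" and \<alpha>: "0 < \<alpha>" "\<alpha> \<le> 1" and "0 \<le> k"
    and V: "z \<in> V" "w \<in> V" "v \<in> V" and ne: "v \<noteq> z" "v \<noteq> w"
  shows "cmod ((f v - f z) / (v - z) - (f v - f w) / (v - w))
    \<le> 3 * k * cmod (z - w) powr \<alpha> * (1 / cmod (v - z) + 1 / cmod (v - w))"
proof -
  define a b d where "a = cmod (v - z)" "b = cmod (v - w)" "d = cmod (z - w)"
  have ab: "0 < a" "0 < b" "0 \<le> d" using ne by (auto simp: a_b_d_def)
  have "z - w = (v - w) - (v - z)" by simp
  then have dab: "d \<le> a + b" unfolding a_b_d_def by (metis norm_triangle_ineq4 add.commute)
  have split: "A / p - B / q = (A - B) / q + A * (q - p) / (p * q)"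
    if "p \<noteq> 0" "q \<noteq> 0" for A B p q :: complex
    using that by (simp add: field_simps)
  have "(f v - f z) / (v - z) - (f v - f w) / (v - w)
      = (f w - f z) / (v - w) + (f v - f z) * (z - w) / ((v - z) * (v - w))"
    using split[of "v - z" "v - w" "f v - f z" "f v - f w"] ne by simp
  then have "cmod ((f v - f z) / (v - z) - (f v - f w) / (v - w))
      \<le> cmod ((f w - f z) / (v - w)) + cmod ((f v - f z) * (z - w) / ((v - z) * (v - w)))"
    by (metis norm_triangle_ineq)
  also have "\<dots> = cmod (f w - f z) / b + cmod (f v - f z) * d / (a * b)"
    by (simp add: norm_divide norm_mult a_b_d_def)
  also have "\<dots> \<le> k * d powr \<alpha> / b + (k * a powr \<alpha>) * d / (a * b)"
    using holder_onD[OF f V(2,1)] holder_onD[OF f V(3,1)] ab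
    by (intro add_mono divide_right_mono mult_right_mono) (auto simp: a_b_d_def norm_minus_commute)
  also have "(k * a powr \<alpha>) * d / (a * b) \<le> k * d powr \<alpha> * (2 / b + 1 / a)"
  proof -
    have "d = d powr \<alpha> * d powr (1 - \<alpha>)"
      using ab \<alpha> by (cases "d = 0") (auto simp: powr_add[symmetric])
    also have "\<dots> \<le> d powr \<alpha> * (a powr (1 - \<alpha>) + b powr (1 - \<alpha>))"
      using dab ab \<alpha> powr_add_le_add_powr[of a b "1 - \<alpha>"] powr_mono2[of "1 - \<alpha>" d "a + b"]
      by (intro mult_left_mono) auto
    finally have "a powr \<alpha> * d / (a * b) \<le> a powr \<alpha> * (d powr \<alpha> * (a powr (1 - \<alpha>) + b powr (1 - \<alpha>))) / (a * b)"
      using ab by (intro divide_right_mono mult_left_mono) auto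
    also have "\<dots> = d powr \<alpha> * (1 / b + (b / a) powr (1 - \<alpha>) / b)"
      using ab by (simp add: powr_diff powr_divide field_simps)
    also have "\<dots> \<le> d powr \<alpha> * (1 / b + (1 / b + 1 / a))"
    proof (intro mult_left_mono add_left_mono)
      have "(b / a) powr (1 - \<alpha>) \<le> 1 + b / a"
      proof (cases "b / a \<le> 1")
        case True
        then have "(b / a) powr (1 - \<alpha>) \<le> 1" using ab \<alpha> by (intro powr_le1) auto
        then show ?thesis using ab by (smt (verit) divide_pos_pos)
      next
        case False
        then have "(b / a) powr (1 - \<alpha>) \<le> (b / a) powr 1" using \<alpha> by (intro powr_mono) auto
        then show ?thesis using False ab by simp
      qed
      then have "(b / a) powr (1 - \<alpha>) / b \<le> (1 + b / a) / b" using ab by (intro divide_right_mono) auto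
      then show "(b / a) powr (1 - \<alpha>) / b \<le> 1 / b + 1 / a" using ab by (simp add: field_simps)
    qed auto
    finally have "k * (a powr \<alpha> * d / (a * b)) \<le> k * (d powr \<alpha> * (1 / b + (1 / b + 1 / a)))"
      using \<open>0 \<le> k\<close> by (rule mult_left_mono)
    then show ?thesis by (simp add: mult.assoc)
  qed
  also have "k * d powr \<alpha> / b + k * d powr \<alpha> * (2 / b + 1 / a) \<le> 3 * k * d powr \<alpha> * (1 / a + 1 / b)"
  proof -
    have "0 \<le> k * d powr \<alpha> * (2 / a)" using ab \<open>0 \<le> k\<close> by auto
    also have "\<dots> = 3 * k * d powr \<alpha> * (1 / a + 1 / b) - (k * d powr \<alpha> / b + k * d powr \<alpha> * (2 / b + 1 / a))"
      using ab by (simp add: field_simps)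
    finally show ?thesis by simp
  qed
  finally show ?thesis by (simp add: a_b_d_def)
qed

text \<open>Dominated convergence for difference quotients. Cauchy's inequality turns the uniform
  bound \<open>B\<close> on the kernel into the bound \<open>B / \<rho>\<close> on its derivative,
  hence into a constant dominating function on \<open>A\<close>.\<close>

lemma holomorphic_set_integral:
  fixes k :: "complex \<Rightarrow> complex \<Rightarrow> complex"
  assumes A: "A \<in> sets borel" "emeasure lborel A < \<infinity>"
    and hol: "\<And>v. v \<in> A \<Longrightarrow> (\<lambda>z. k z v) holomorphic_on V" and V: "open V"
    and bound: "\<And>z v. z \<in> V \<Longrightarrow> v \<in> A \<Longrightarrow> cmod (k z v) \<le> B"
    and meas: "\<And>z. z \<in> V \<Longrightarrow> k z \<in> borel_measurable borel"
  shows "(\<lambda>z. LINT v:A|lborel. k z v) holomorphic_on V"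
  unfolding holomorphic_on_open[OF V]
proof (intro ballI)
  fix z assume z: "z \<in> V"
  define F where "F z = (LINT v:A|lborel. k z v)" for z
  define I where "I = (\<lambda>v. indicat_real A v)"
  define k' where "k' v = deriv (\<lambda>z. k z v) z" for v
  \<comment> \<open>Radius \<open>2 * \<rho>\<close> leaves room for discs of radius
    \<open>\<rho>\<close> about all points of \<open>ball z \<rho>\<close>, as Cauchy's inequality
    requires.\<close>
  obtain \<rho> where \<rho>: "\<rho> > 0" "cball z (2 * \<rho>) \<subseteq> V"
    using V z open_contains_cball by (metis field_sum_of_halves half_gt_zero mult_2)
  have Imeas[measurable]: "I \<in> borel_measurable borel" using A by (simp add: I_def)
  have Iint: "integrable lborel I" using A by (simp add: I_def)
  have int: "integrable lborel (\<lambda>v. I v *\<^sub>R k u v)" if "u \<in> V" for u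
  proof (rule Bochner_Integration.integrable_bound)
    show "integrable lborel (\<lambda>v. B * I v)" using Iint by simp
    show "(\<lambda>v. I v *\<^sub>R k u v) \<in> borel_measurable lborel" using meas[OF that] by measurable
    show "AE v in lborel. norm (I v *\<^sub>R k u v) \<le> norm (B * I v)"
      using bound[OF that] by (intro AE_I2) (auto simp: I_def indicator_def intro: order_trans[OF _ abs_ge_self])
  qed
  have lip: "cmod (k u v - k z v) \<le> (B / \<rho>) * cmod (u - z)" if "v \<in> A" "u \<in> ball z \<rho>" for u v
  proof (rule field_differentiable_bound)
    show "convex (ball z \<rho>)" by simp
    fix b assume b: "b \<in> ball z \<rho>"
    have "cball b \<rho> \<subseteq> cball z (2 * \<rho>)"
    proof
      fix u assume "u \<in> cball b \<rho>"
      then show "u \<in> cball z (2 * \<rho>)" using b dist_triangle[of z u b] by simp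
    qed
    with \<rho>(2) have sub: "cball b \<rho> \<subseteq> V" by blast
    then have holv: "(\<lambda>z. k z v) holomorphic_on cball b \<rho>"
      using hol[OF that(1)] holomorphic_on_subset by blast
    have "b \<in> V" using sub \<rho>(1) by auto
    then have "(\<lambda>z. k z v) field_differentiable at b"
      using hol[OF that(1)] V holomorphic_on_imp_differentiable_at by blast
    then show "((\<lambda>z. k z v) has_field_derivative deriv (\<lambda>z. k z v) b) (at b within ball z \<rho>)"
      using DERIV_deriv_iff_field_differentiable has_field_derivative_at_within by blast
    have "cmod ((deriv ^^ 1) (\<lambda>z. k z v) b) \<le> fact 1 * B / \<rho> ^ 1"
    proof (rule Cauchy_inequality)
      show "(\<lambda>z. k z v) holomorphic_on ball b \<rho>" using holv by (rule holomorphic_on_subset) auto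
      show "continuous_on (cball b \<rho>) (\<lambda>z. k z v)" using holv by (rule holomorphic_on_imp_continuous_on)
      show "cmod (k u v) \<le> B" if u: "cmod (b - u) = \<rho>" for u
        using bound[OF _ \<open>v \<in> A\<close>] sub u by (auto simp: subset_iff dist_norm)
    qed (use \<rho> in auto)
    then show "cmod (deriv (\<lambda>z. k z v) b) \<le> B / \<rho>" by simp
  qed (use that \<rho> in auto)
  have deriv_lim: "(\<lambda>n. I v *\<^sub>R ((k (X n) v - k z v) / (X n - z))) \<longlonglongrightarrow> I v *\<^sub>R k' v"
    if X: "X \<longlonglongrightarrow> z" "\<And>n. X n \<noteq> z" for X v
  proof (cases "v \<in> A")
    case True
    have "(\<lambda>z. k z v) field_differentiable at z"
      using hol[OF True] V z holomorphic_on_imp_differentiable_at by blast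
    then have "((\<lambda>u. (k u v - k z v) / (u - z)) \<longlongrightarrow> k' v) (at z)"
      unfolding k'_def by (simp add: DERIV_deriv_iff_field_differentiable[symmetric] has_field_derivative_iff)
    then have "((\<lambda>u. (k u v - k z v) / (u - z)) \<circ> X) \<longlonglongrightarrow> k' v"
      using X unfolding tendsto_at_iff_sequentially by auto
    then show ?thesis by (intro tendsto_scaleR tendsto_const) (simp add: o_def)
  qed (auto simp: I_def)
  \<comment> \<open>Measurable as a pointwise limit of difference quotients along one fixed
    sequence.\<close>
  have k'_meas: "(\<lambda>v. I v *\<^sub>R k' v) \<in> borel_measurable lborel"
  proof (rule borel_measurable_LIMSEQ_metric)
    define X where "X n = z + complex_of_real (\<rho> / real (Suc n))" for n
    show "(\<lambda>n. I v *\<^sub>R ((k (X n) v - k z v) / (X n - z))) \<longlonglongrightarrow> I v *\<^sub>R k' v" for v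
    proof (rule deriv_lim)
      have "(\<lambda>n. \<rho> / real (Suc n)) \<longlonglongrightarrow> 0" by (rule LIMSEQ_Suc) (rule lim_const_over_n)
      then have "(\<lambda>n. complex_of_real (\<rho> / real (Suc n))) \<longlonglongrightarrow> of_real 0" by (rule tendsto_of_real)
      then have "X \<longlonglongrightarrow> z + of_real 0" unfolding X_def by (intro tendsto_add tendsto_const)
      then show "X \<longlonglongrightarrow> z" by simp
      show "X n \<noteq> z" for n using \<rho> by (simp add: X_def del: of_nat_Suc)
    qed
    have "X n \<in> V" for n
    proof -
      have "dist z (X n) \<le> 2 * \<rho>"
      proof -
        have "dist z (X n) = \<rho> / real (Suc n)"
          using \<rho>(1) by (simp add: X_def dist_norm del: of_nat_Suc of_real_divide)
        also have "\<dots> \<le> \<rho> / 1" using \<rho>(1) by (intro divide_left_mono) auto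
        finally show ?thesis using \<rho>(1) by simp
      qed
      then show ?thesis using \<rho>(2) by auto
    qed
    then have [measurable]: "k (X n) \<in> borel_measurable borel" "k z \<in> borel_measurable borel" for n
      using meas z by auto
    show "(\<lambda>v. I v *\<^sub>R ((k (X n) v - k z v) / (X n - z))) \<in> borel_measurable lborel" for n
      by measurable
  qed
  have "((\<lambda>u. (F u - F z) / (u - z)) \<longlongrightarrow> (LINT v|lborel. I v *\<^sub>R k' v)) (at z within ball z \<rho>)"
    unfolding tendsto_at_iff_sequentially
  proof (intro allI impI, goal_cases)
    case (1 X)
    then have X: "X n \<in> ball z \<rho>" "X n \<noteq> z" for n by auto
    have Xlim: "X \<longlonglongrightarrow> z" using 1 by simp
    have XV: "X n \<in> V" for n
    proof -
      have "X n \<in> cball z (2 * \<rho>)" using X(1)[of n] \<rho>(1) by auto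
      then show ?thesis using \<rho>(2) by blast
    qed
    have eq: "(F (X n) - F z) / (X n - z) = (LINT v|lborel. I v *\<^sub>R ((k (X n) v - k z v) / (X n - z)))" for n
    proof -
      have "F (X n) - F z = (LINT v|lborel. I v *\<^sub>R k (X n) v - I v *\<^sub>R k z v)"
        unfolding F_def set_lebesgue_integral_def I_def[symmetric]
        using int[OF XV] int[OF z] by (intro Bochner_Integration.integral_diff[symmetric])
      then have "(F (X n) - F z) / (X n - z) = (LINT v|lborel. (I v *\<^sub>R k (X n) v - I v *\<^sub>R k z v) / (X n - z))"
        by simp
      also have "\<dots> = (LINT v|lborel. I v *\<^sub>R ((k (X n) v - k z v) / (X n - z)))"
        by (intro Bochner_Integration.integral_cong) (simp_all add: scaleR_diff_right[symmetric] scaleR_conv_of_real right_diff_distrib diff_divide_distrib)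
      finally show ?thesis .
    qed
    have "(\<lambda>n. LINT v|lborel. I v *\<^sub>R ((k (X n) v - k z v) / (X n - z))) \<longlonglongrightarrow> (LINT v|lborel. I v *\<^sub>R k' v)"
    proof (rule integral_dominated_convergence[where w = "\<lambda>v. (B / \<rho>) * I v"])
      show "integrable lborel (\<lambda>v. (B / \<rho>) * I v)" using Iint by simp
      have [measurable]: "k (X n) \<in> borel_measurable borel" "k z \<in> borel_measurable borel" for n
        using meas XV z by auto
      show "(\<lambda>v. I v *\<^sub>R ((k (X n) v - k z v) / (X n - z))) \<in> borel_measurable lborel" for n
        by measurable
      show "AE v in lborel. norm (I v *\<^sub>R ((k (X n) v - k z v) / (X n - z))) \<le> (B / \<rho>) * I v" for n
        using lip[of _ "X n"] X[of n]
        by (intro AE_I2) (auto simp: I_def indicator_def norm_divide divide_le_eq)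
      show "AE v in lborel. (\<lambda>n. I v *\<^sub>R ((k (X n) v - k z v) / (X n - z))) \<longlonglongrightarrow> I v *\<^sub>R k' v"
        using deriv_lim[OF Xlim X(2)] by simp
    qed (rule k'_meas)
    then show ?case by (simp add: o_def eq)
  qed
  then have "(F has_field_derivative (LINT v|lborel. I v *\<^sub>R k' v)) (at z within ball z \<rho>)"
    by (simp add: has_field_derivative_iff)
  then have "(F has_field_derivative (LINT v|lborel. I v *\<^sub>R k' v)) (at z)"
    using \<rho>(1) by (simp add: at_within_open[of z "ball z \<rho>"])
  then show "\<exists>f'. ((\<lambda>z. LINT v:A|lborel. k z v) has_field_derivative f') (at z)"
    unfolding F_def by blast
qed

lemma holomorphic_lipschitz_cball:
  assumes "open U" "f holomorphic_on U" "cball y e \<subseteq> U"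
  obtains M where "0 \<le> M" "\<And>z. z \<in> cball y e \<Longrightarrow> cmod (deriv f z) \<le> M"
    "\<And>z w. z \<in> cball y e \<Longrightarrow> w \<in> cball y e \<Longrightarrow> cmod (f z - f w) \<le> M * cmod (z - w)"
proof -
  have "continuous_on (cball y e) (deriv f)"
    using assms by (meson holomorphic_deriv holomorphic_on_imp_continuous_on holomorphic_on_subset)
  then have "bounded (deriv f ` cball y e)"
    by (intro compact_imp_bounded compact_continuous_image) auto
  then obtain M where M: "0 < M" "\<And>z. z \<in> cball y e \<Longrightarrow> cmod (deriv f z) \<le> M"
    unfolding bounded_pos by blast
  have "cmod (f z - f w) \<le> M * cmod (z - w)" if "z \<in> cball y e" "w \<in> cball y e" for z w
  proof (rule field_differentiable_bound[OF convex_cball _ M(2) that(1,2)])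
    fix u assume "u \<in> cball y e"
    then have "f field_differentiable at u" using assms holomorphic_on_imp_differentiable_at by blast
    then show "(f has_field_derivative deriv f u) (at u within cball y e)"
      using DERIV_deriv_iff_field_differentiable has_field_derivative_at_within by blast
  qed
  then show thesis using that M by (meson less_imp_le)
qed

section \<open>Cauchy transforms\<close>

definition cauchy_transform :: "complex set \<Rightarrow> (complex \<Rightarrow> complex) \<Rightarrow> complex \<Rightarrow> complex" where
  "cauchy_transform A c z = (LINT v:A|lborel. c v / (v - z))"

locale cauchy_density =
  fixes A :: "complex set" and c :: "complex \<Rightarrow> complex" and B :: real and x :: complex and r :: real
  assumes A_borel: "A \<in> sets borel" and A_subset: "A \<subseteq> cball x r" and r_pos: "0 < r"
    and c_measurable [measurable]: "c \<in> borel_measurable borel"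
    and c_bound: "\<And>v. v \<in> A \<Longrightarrow> cmod (c v) \<le> B" and B_nonneg: "0 \<le> B"
begin

lemma A_finite: "emeasure lborel A < \<infinity>"
proof -
  have "emeasure lborel A \<le> emeasure lborel (cball x r)"
    using A_subset by (intro emeasure_mono) auto
  also have "\<dots> < \<infinity>" using r_pos by (simp add: emeasure_cball)
  finally show ?thesis .
qed

text \<open>\<open>kernel_bound\<close> expects two poles; both are taken to be \<open>z\<close>,
  each with half of the bound.\<close>

lemma cauchy_kernel_le:
  assumes "v \<in> A"
  shows "cmod (c v / (v - z)) \<le> B / 2 * (cmod (v - z) powr - 1 + cmod (v - z) powr - 1)"
  using c_bound[OF assms] by (auto simp: norm_divide powr_minus_divide divide_right_mono)

lemma cauchy_integrable: "set_integrable lborel A (\<lambda>v. c v / (v - z))"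
  by (rule kernel_bound(1)[where s=1 and B="B/2" and x=x and r=r and z=z and w=z])
    (use A_borel A_subset r_pos B_nonneg cauchy_kernel_le in auto)

lemma cauchy_transform_le: "cmod (cauchy_transform A c z) \<le> B * riesz_const 1 * r"
proof -
  have "cmod (cauchy_transform A c z) \<le> 2 * (B / 2) * riesz_const 1 * r powr (2 - 1)"
    unfolding cauchy_transform_def
    by (rule kernel_bound(2)[where s=1 and B="B/2" and x=x and r=r and z=z and w=z])
      (use A_borel A_subset r_pos B_nonneg cauchy_kernel_le in auto)
  then show ?thesis using r_pos by simp
qed

text \<open>An exponent above \<alpha> will put the transform into \<open>lip\<close>, while \<beta>
  = \<alpha> gives the Hoelder constant of a hump; hence the free exponent.\<close>

lemma holder_on_cauchy_transform:
  assumes "0 \<le> \<beta>" "\<beta> < 1"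
  shows "holder_on \<beta> (4 * B * riesz_const (1 + \<beta>) * r powr (1 - \<beta>)) V (cauchy_transform A c)"
proof (rule holder_onI)
  fix z w
  have "cauchy_transform A c z - cauchy_transform A c w
      = (LINT v:A|lborel. c v / (v - z) - c v / (v - w))"
    unfolding cauchy_transform_def
    by (rule set_integral_diff(2)[OF cauchy_integrable cauchy_integrable, symmetric])
  also have "cmod \<dots> \<le> 2 * (2 * B * cmod (z - w) powr \<beta>) * riesz_const (1 + \<beta>) * r powr (2 - (1 + \<beta>))"
  proof (rule kernel_bound(2)[where x=x and z=z and w=w])
    fix v assume v: "v \<in> A" "v \<noteq> z" "v \<noteq> w"
    have "z - w = (v - w) - (v - z)" by simp
    then have tri: "cmod (z - w) \<le> cmod (v - z) + cmod (v - w)"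
      by (metis norm_triangle_ineq4 add.commute)
    have "c v / (v - z) - c v / (v - w) = c v * ((z - w) / ((v - z) * (v - w)))"
      using v by (simp add: field_simps)
    then have "cmod (c v / (v - z) - c v / (v - w))
        = cmod (c v) * (cmod (z - w) / (cmod (v - z) * cmod (v - w)))"
      by (simp add: norm_mult norm_divide)
    also have "\<dots> \<le> B * (2 * cmod (z - w) powr \<beta> *
        (cmod (v - z) powr - (1 + \<beta>) + cmod (v - w) powr - (1 + \<beta>)))"
      using v tri assms B_nonneg c_bound by (intro mult_mono kernel_difference_bound) auto
    finally show "cmod (c v / (v - z) - c v / (v - w)) \<le> 2 * B * cmod (z - w) powr \<beta> *
        (cmod (v - z) powr - (1 + \<beta>) + cmod (v - w) powr - (1 + \<beta>))"
      by (simp add: algebra_simps)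
  qed (use assms A_borel A_subset r_pos B_nonneg in auto)
  finally show "cmod (cauchy_transform A c z - cauchy_transform A c w)
      \<le> 4 * B * riesz_const (1 + \<beta>) * r powr (1 - \<beta>) * cmod (z - w) powr \<beta>"
    by (simp add: algebra_simps)
qed

text \<open>\<open>V\<close> may touch the closure of \<open>A\<close>, so the kernel is bounded
  only over small discs in \<open>V\<close>; holomorphy is obtained there and glued through
  \<open>analytic_on\<close>.\<close>

lemma holomorphic_cauchy_transform:
  assumes V: "open V" "V \<inter> A = {}"
  shows "cauchy_transform A c holomorphic_on V"
proof -
  have "\<exists>\<rho>>0. cauchy_transform A c holomorphic_on ball z \<rho>" if z: "z \<in> V" for z
  proof -
    obtain e where e: "e > 0" "ball z e \<subseteq> V" using openE[OF V(1) z] by blast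
    define \<rho> where "\<rho> = e / 2"
    have \<rho>: "\<rho> > 0" "ball z (2 * \<rho>) \<subseteq> V" using e by (auto simp: \<rho>_def)
    have far: "\<rho> \<le> cmod (v - u)" if "v \<in> A" "u \<in> ball z \<rho>" for v u
    proof -
      have "v \<notin> ball z (2 * \<rho>)" using \<rho> V that by blast
      then show ?thesis using that dist_triangle[of z v u] by (simp add: dist_norm norm_minus_commute)
    qed
    have "cauchy_transform A c holomorphic_on ball z \<rho>"
      unfolding cauchy_transform_def
    proof (rule holomorphic_set_integral[where B = "B / \<rho>"])
      fix v assume "v \<in> A"
      then have "v - u \<noteq> 0" if "u \<in> ball z \<rho>" for u
        using far[of v u] that \<rho>(1) by (metis norm_zero not_less)
      then show "(\<lambda>u. c v / (v - u)) holomorphic_on ball z \<rho>"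
        by (intro holomorphic_intros) auto
    next
      fix u v assume "u \<in> ball z \<rho>" "v \<in> A"
      then show "cmod (c v / (v - u)) \<le> B / \<rho>"
        using far[of v u] c_bound[of v] \<rho>(1) B_nonneg by (simp add: norm_divide frac_le)
    qed (use A_borel A_finite in auto)
    then show ?thesis using \<rho>(1) by blast
  qed
  then have "cauchy_transform A c analytic_on V" by (simp add: analytic_on_def)
  then show ?thesis by (rule analytic_imp_holomorphic)
qed

end

text \<open>Leibniz' rule with a factor of degree 1, of which two terms survive. This recursion
  drives the derivatives of Cauchy transforms, the descent to derivations of lower order and the
  derivatives of difference quotients.\<close>

lemma higher_deriv_linear_mult:
  assumes "g analytic_on {x}"
  shows "(deriv ^^ Suc n) (\<lambda>z. (z - y) * g z) x
    = (x - y) * (deriv ^^ Suc n) g x + of_nat (Suc n) * (deriv ^^ n) g x"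
proof -
  have lin: "(deriv ^^ i) (\<lambda>z. z - y) x = (if i = 0 then x - y else if i = 1 then 1 else 0)" for i
  proof (cases i)
    case (Suc j)
    have "deriv (\<lambda>z. z - y) = (\<lambda>z. 1)" by (intro ext DERIV_imp_deriv) (auto intro!: derivative_eq_intros)
    then show ?thesis using Suc by (simp add: funpow_Suc_right del: funpow.simps)
  qed simp
  have "(deriv ^^ Suc n) (\<lambda>z. (z - y) * g z) x
      = (\<Sum>i = 0..Suc n. of_nat (Suc n choose i) * (deriv ^^ i) (\<lambda>z. z - y) x * (deriv ^^ (Suc n - i)) g x)"
    using assms by (intro higher_deriv_mult_at) (auto intro!: analytic_intros)
  also have "\<dots> = (\<Sum>i \<in> {0, 1}. of_nat (Suc n choose i) * (deriv ^^ i) (\<lambda>z. z - y) x * (deriv ^^ (Suc n - i)) g x)"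
    by (intro sum.mono_neutral_right) (auto simp: lin)
  finally show ?thesis by (simp add: lin del: funpow.simps)
qed

lemma higher_deriv_const_add:
  assumes "g analytic_on {x}"
  shows "(deriv ^^ Suc n) (\<lambda>z. a + g z) x = (deriv ^^ Suc n) g x"
  using assms by (subst higher_deriv_add_at) auto

text \<open>Near \<open>x\<close> the transform is its value at \<open>x\<close> plus z - x times
  the transform of the density c v / (v - x). One order of differentiation thus costs one change of
  density, so the induction has to range over all \<open>c\<close> and \<open>B\<close>.\<close>

lemma higher_deriv_cauchy_transform:
  assumes "cauchy_density A c B x r" "0 < d" "ball x d \<inter> A = {}"
  shows "(deriv ^^ n) (cauchy_transform A c) x = fact n * (LINT v:A|lborel. c v / (v - x) ^ Suc n)"
  using assms(1)
proof (induction n arbitrary: c B)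
  case 0
  then show ?case by (simp add: cauchy_transform_def)
next
  case (Suc n)
  interpret cauchy_density A c B x r by fact
  define c' where "c' v = c v / (v - x)" for v
  have [measurable]: "c' \<in> borel_measurable borel" unfolding c'_def by measurable
  have far: "d \<le> cmod (v - x)" if "v \<in> A" for v
  proof (rule ccontr)
    assume "\<not> d \<le> cmod (v - x)"
    then have "v \<in> ball x d" by (simp add: dist_norm norm_minus_commute)
    then show False using assms(3) that by blast
  qed
  interpret c': cauchy_density A c' "B / d" x r
    using A_borel A_subset r_pos far c_bound B_nonneg assms(2)
    by unfold_locales (auto simp: c'_def norm_divide intro!: frac_le)
  have an: "cauchy_transform A c' analytic_on {x}"
    using c'.holomorphic_cauchy_transform[OF open_ball assms(3)] assms(2)
    by (auto simp: analytic_at intro!: exI[of _ "ball x d"])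
  have eq: "cauchy_transform A c z = cauchy_transform A c x + (z - x) * cauchy_transform A c' z"
    if "z \<in> ball x d" for z
  proof -
    have "(z - x) * cauchy_transform A c' z = (LINT v:A|lborel. (z - x) * (c' v / (v - z)))"
      unfolding cauchy_transform_def by (rule set_integral_mult_right[symmetric])
    also have "\<dots> = (LINT v:A|lborel. c v / (v - z) - c v / (v - x))"
    proof (rule set_lebesgue_integral_cong)
      show "\<forall>v. v \<in> A \<longrightarrow> (z - x) * (c' v / (v - z)) = c v / (v - z) - c v / (v - x)"
      proof (intro allI impI)
        fix v assume "v \<in> A"
        then have "v \<noteq> z" "v \<noteq> x" using that assms(2,3) far[of v] by auto
        then show "(z - x) * (c' v / (v - z)) = c v / (v - z) - c v / (v - x)"
          by (simp add: c'_def field_simps)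
      qed
    qed (use A_borel in auto)
    also have "\<dots> = cauchy_transform A c z - cauchy_transform A c x"
      unfolding cauchy_transform_def by (rule set_integral_diff(2)[OF cauchy_integrable cauchy_integrable])
    finally show ?thesis by simp
  qed
  have "(deriv ^^ Suc n) (cauchy_transform A c) x
      = (deriv ^^ Suc n) (\<lambda>z. cauchy_transform A c x + (z - x) * cauchy_transform A c' z) x"
  proof (rule higher_deriv_transform_within_open)
    show "cauchy_transform A c holomorphic_on ball x d"
      by (rule holomorphic_cauchy_transform[OF open_ball assms(3)])
    show "(\<lambda>z. cauchy_transform A c x + (z - x) * cauchy_transform A c' z) holomorphic_on ball x d"
      by (intro holomorphic_intros c'.holomorphic_cauchy_transform[OF open_ball assms(3)])
    show "x \<in> ball x d" using assms(2) by simp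
  qed (rule open_ball, rule eq)
  also have "\<dots> = (deriv ^^ Suc n) (\<lambda>z. (z - x) * cauchy_transform A c' z) x"
    by (rule higher_deriv_const_add) (intro analytic_intros an)
  also have "\<dots> = of_nat (Suc n) * (deriv ^^ n) (cauchy_transform A c') x"
    using higher_deriv_linear_mult[OF an, of n x] by simp
  also have "\<dots> = of_nat (Suc n) * (fact n * (LINT v:A|lborel. c' v / (v - x) ^ Suc n))"
    using Suc.IH[OF c'.cauchy_density_axioms] by (simp only:)
  also have "(LINT v:A|lborel. c' v / (v - x) ^ Suc n) = (LINT v:A|lborel. c v / (v - x) ^ Suc (Suc n))"
    by (simp add: c'_def mult.assoc)
  finally show ?case by (simp add: algebra_simps del: funpow.simps)
qed

section \<open>Rotation invariance of planar Lebesgue measure, through the identification with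
  \<open>real^2\<close>\<close>

lemma distr_lborel_vec_complex:
  "distr lborel borel (\<lambda>v::real^2. Complex (v $ 1) (v $ 2)) = lborel"
proof (rule lborel_eqI[symmetric])
  fix l u :: complex assume le: "\<And>b. b \<in> Basis \<Longrightarrow> l \<bullet> b \<le> u \<bullet> b"
  have lu: "Re l \<le> Re u" "Im l \<le> Im u"
    using le[of 1] le[of \<i>] by (auto simp: Basis_complex_def inner_complex_def)
  have meas: "(\<lambda>v::real^2. Complex (v $ 1) (v $ 2)) \<in> borel_measurable borel"
    by (simp add: Complex_eq borel_measurable_continuous_onI continuous_intros)
  have pre: "(\<lambda>v::real^2. Complex (v $ 1) (v $ 2)) -` box l u = box (vector [Re l, Im l]) (vector [Re u, Im u])"
    by (auto simp: mem_box_cart forall_2 in_box_complex_iff)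
  have "emeasure (distr lborel borel (\<lambda>v::real^2. Complex (v $ 1) (v $ 2))) (box l u)
      = emeasure lborel (box (vector [Re l, Im l]) (vector [Re u, Im u]) :: (real^2) set)"
    using meas by (subst emeasure_distr) (auto simp: pre)
  also have "\<dots> = ennreal ((Re u - Re l) * (Im u - Im l))"
    using lu by (subst emeasure_lborel_box)
      (auto simp: Basis_vec_def axis_eq_axis UNIV_2 inner_axis prod.insert_if)
  finally show "emeasure (distr lborel borel (\<lambda>v::real^2. Complex (v $ 1) (v $ 2))) (box l u)
      = ennreal (\<Prod>b\<in>Basis. (u - l) \<bullet> b)"
    by (simp add: Basis_complex_def inner_complex_def)
qed auto

text \<open>Boxes determine the measure. Read in \<open>real^2\<close>, the preimage of a box under
  the rotation is the image of a box under the orthogonal map \<open>R\<close>, multiplication by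
  \<open>cnj \<omega>\<close>, and orthogonal maps preserve measure.\<close>

lemma distr_lborel_rotation:
  assumes "cmod \<omega> = 1"
  shows "distr lborel borel ((*) \<omega>) = lborel"
proof (rule lborel_eqI[symmetric])
  fix l u :: complex assume le: "\<And>b. b \<in> Basis \<Longrightarrow> l \<bullet> b \<le> u \<bullet> b"
  define V where "V v = Complex (v $ 1) (v $ 2)" for v :: "real^2"
  define W where "W z = (vector [Re z, Im z] :: real^2)" for z
  have VW: "V (W z) = z" and WV: "W (V v) = v" for z v
    by (auto simp: V_def W_def vec_eq_iff forall_2 complex_eq_iff)
  have V_lebesgue: "emeasure lborel S = emeasure lborel (V -` S)" if "S \<in> sets borel" for S
  proof -
    have "V \<in> borel_measurable borel"
      by (simp add: V_def Complex_eq borel_measurable_continuous_onI continuous_intros)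
    moreover have "emeasure lborel S = emeasure (distr lborel borel V) S"
      unfolding V_def using distr_lborel_vec_complex by simp
    ultimately show ?thesis using that by (simp add: emeasure_distr)
  qed
  have norm_eq: "norm v = cmod (V v)" for v
    by (simp add: norm_vec_def L2_set_def UNIV_2 V_def cmod_def)
  have \<omega>: "\<omega> * cnj \<omega> = 1" using assms by (simp add: complex_norm_square[symmetric])
  define R where "R v = W (cnj \<omega> * V v)" for v
  have orth: "orthogonal_transformation R"
  proof -
    have "linear R"
      by (rule linearI) (auto simp: R_def W_def V_def vec_eq_iff forall_2 algebra_simps)
    moreover have "norm (R v) = norm v" for v
      by (simp add: norm_eq R_def VW norm_mult assms)
    ultimately show ?thesis by (simp add: orthogonal_transformation)
  qed
  have pre: "V -` ((*) \<omega> -` box l u) = R ` (V -` box l u)"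
  proof (intro set_eqI iffI)
    fix v assume v: "v \<in> V -` ((*) \<omega> -` box l u)"
    have "v = R (W (\<omega> * V v))"
      using \<omega> by (simp add: R_def VW mult.assoc[symmetric] mult.commute[of "cnj \<omega>"] WV)
    moreover have "W (\<omega> * V v) \<in> V -` box l u" using v by (simp add: VW)
    ultimately show "v \<in> R ` (V -` box l u)" by (rule image_eqI)
  next
    fix v assume "v \<in> R ` (V -` box l u)"
    then obtain v' where "v = R v'" "V v' \<in> box l u" by auto
    moreover have "\<omega> * V (R v') = V v'" using \<omega> by (simp add: R_def VW mult.assoc[symmetric])
    ultimately show "v \<in> V -` ((*) \<omega> -` box l u)" by simp
  qed
  have box: "V -` box l u = box (W l) (W u)"
    by (auto simp: V_def W_def mem_box_cart forall_2 in_box_complex_iff)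
  have meas: "(*) \<omega> \<in> borel_measurable borel" by simp
  have "emeasure (distr lborel borel ((*) \<omega>)) (box l u) = emeasure lborel ((*) \<omega> -` box l u)"
    using meas by (subst emeasure_distr) auto
  also have "\<dots> = emeasure lborel (V -` ((*) \<omega> -` box l u))"
    by (rule V_lebesgue) (use measurable_sets[OF meas, of "box l u"] in auto)
  also have "\<dots> = emeasure lebesgue (V -` ((*) \<omega> -` box l u))"
  proof -
    have "(\<lambda>v. \<omega> * V v) \<in> borel_measurable borel"
      by (simp add: V_def Complex_eq borel_measurable_continuous_onI continuous_intros)
    from measurable_sets[OF this, of "box l u"]
    have "V -` ((*) \<omega> -` box l u) \<in> sets lborel" by (simp add: vimage_def)
    then show ?thesis by simp
  qed
  also have "\<dots> = emeasure lebesgue (R ` box (W l) (W u))" unfolding pre box ..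
  also have "\<dots> = emeasure lebesgue (box (W l) (W u))"
    using measure_orthogonal_image[OF orth, of "box (W l) (W u)"]
      measurable_orthogonal_image[OF orth, of "box (W l) (W u)"]
    by (simp add: emeasure_eq_measure2 fmeasurableD2)
  also have "\<dots> = emeasure lborel (box l u)"
    by (simp add: V_lebesgue box)
  finally show "emeasure (distr lborel borel ((*) \<omega>)) (box l u) = ennreal (\<Prod>b\<in>Basis. (u - l) \<bullet> b)"
    using le by (simp add: emeasure_lborel_box)
qed auto

section \<open>Annuli and Hoelder extension\<close>

lemma distr_lborel_rotation_about:
  fixes x :: complex
  assumes "cmod \<omega> = 1"
  shows "distr lborel borel (\<lambda>v. x + \<omega> * (v - x)) = lborel"
proof -
  have "distr lborel borel (\<lambda>v. x + \<omega> * (v - x)) = distr (distr lborel borel ((*) \<omega>)) borel ((+) (x - \<omega> * x))"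
    by (subst distr_distr) (auto simp: o_def algebra_simps)
  then show ?thesis
    using distr_lborel_rotation[OF assms] lborel_distr_plus[of "x - \<omega> * x"] by simp
qed

definition annulus :: "complex \<Rightarrow> real \<Rightarrow> complex set" where
  "annulus x d = cball x (2 * d) - ball x d"

lemma annulus_iff: "v \<in> annulus x d \<longleftrightarrow> d \<le> cmod (v - x) \<and> cmod (v - x) \<le> 2 * d"
  by (auto simp: annulus_def dist_norm norm_minus_commute)

lemma annulus_borel [measurable]: "annulus x d \<in> sets borel"
  by (simp add: annulus_def)

lemma measure_annulus:
  assumes "0 < d"
  shows "measure lborel (annulus x d) = 3 * pi * d\<^sup>2"
proof -
  have "measure lborel (annulus x d) = measure lborel (cball x (2 * d)) - measure lborel (ball x d)"
    unfolding annulus_def using assms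
    by (intro measure_Diff) (auto simp: emeasure_cball)
  then show ?thesis using assms
    by (simp add: content_cball content_ball unit_ball_vol_2 power_mult_distrib)
qed

lemma emeasure_annulus_finite: "0 < d \<Longrightarrow> emeasure lborel (annulus x d) < \<infinity>"
  using emeasure_mono[of "annulus x d" "cball x (2 * d)" lborel]
  by (auto simp: annulus_def emeasure_cball order.strict_trans1)

text \<open>The rotation preserves both the annulus and the measure, so the integral equals
  \<open>l\<close> times itself.\<close>

lemma annulus_integral_eq_0:
  assumes \<omega>: "cmod \<omega> = 1" and f [measurable]: "f \<in> borel_measurable borel"
    and eq: "\<And>u. f (\<omega> * u) = l * f u" and l: "l \<noteq> (1::complex)"
  shows "(LINT v:annulus x d|lborel. f (v - x)) = 0"
proof -
  define T where "T v = x + \<omega> * (v - x)" for v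
  define g where "g v = indicat_real (annulus x d) v *\<^sub>R f (v - x)" for v
  have [measurable]: "T \<in> borel_measurable borel" unfolding T_def by measurable
  have [measurable]: "g \<in> borel_measurable borel" unfolding g_def by measurable
  have "integral\<^sup>L lborel g = integral\<^sup>L (distr lborel borel T) g"
    using distr_lborel_rotation_about[OF \<omega>, of x] by (simp add: T_def[abs_def])
  also have "\<dots> = (LINT v|lborel. g (T v))" by (rule integral_distr) auto
  also have "\<dots> = (LINT v|lborel. l * g v)"
  proof (rule Bochner_Integration.integral_cong)
    fix v
    have "indicat_real (annulus x d) (T v) = indicat_real (annulus x d) v"
      by (simp add: T_def annulus_iff indicator_def norm_mult \<omega>)
    then show "g (T v) = l * g v" by (simp add: g_def T_def eq)
  qed simp
  also have "\<dots> = l * integral\<^sup>L lborel g" by simp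
  finally have "integral\<^sup>L lborel g = 0" using l by (simp add: algebra_simps)
  then show ?thesis by (simp add: g_def[abs_def] set_lebesgue_integral_def)
qed

lemma
  fixes g :: "complex \<Rightarrow> complex"
  assumes A: "A \<in> sets borel" "emeasure lborel A < \<infinity>" and g [measurable]: "g \<in> borel_measurable borel"
    and bound: "\<And>v. v \<in> A \<Longrightarrow> cmod (g v) \<le> B"
  shows set_integrable_bounded: "set_integrable lborel A g"
    and set_integral_bounded: "cmod (LINT v:A|lborel. g v) \<le> B * measure lborel A"
proof -
  have [measurable]: "A \<in> sets lborel" using A by simp
  have I: "integrable lborel (\<lambda>v. B * indicat_real A v)" using A by simp
  show int: "set_integrable lborel A g"
    unfolding set_integrable_def
  proof (rule Bochner_Integration.integrable_bound[OF I])
    show "AE v in lborel. norm (indicat_real A v *\<^sub>R g v) \<le> norm (B * indicat_real A v)"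
      using bound by (intro AE_I2) (auto simp: indicator_def intro: order_trans[OF _ abs_ge_self])
  qed measurable
  have "cmod (LINT v:A|lborel. g v) \<le> (LINT v|lborel. norm (indicat_real A v *\<^sub>R g v))"
    unfolding set_lebesgue_integral_def by (rule integral_norm_bound)
  also have "\<dots> \<le> (LINT v|lborel. B * indicat_real A v)"
    using int bound I unfolding set_integrable_def
    by (intro integral_mono integrable_norm) (auto simp: indicator_def)
  also have "\<dots> = B * measure lborel A" using A by simp
  finally show "cmod (LINT v:A|lborel. g v) \<le> B * measure lborel A" .
qed

text \<open>The integrand is the sum of the powers of \<open>w\<close> with positive exponent.
  Peeling them off one at a time leaves a remainder of size q^(n+1) / (1 - q), which avoids
  exchanging sum and integral.\<close>

lemma geometric_integral_eq_0:
  fixes w :: "complex \<Rightarrow> complex"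
  assumes A: "A \<in> sets borel" "emeasure lborel A < \<infinity>" and w [measurable]: "w \<in> borel_measurable borel"
    and q: "0 \<le> q" "q < 1" "\<And>v. v \<in> A \<Longrightarrow> cmod (w v) \<le> q"
    and zero: "\<And>n. (LINT v:A|lborel. w v ^ Suc n) = 0"
  shows "(LINT v:A|lborel. w v / (1 - w v)) = 0"
proof -
  have wpow: "cmod (w v ^ n) \<le> 1" if "v \<in> A" for v n
    using q(3)[OF that] q(2) by (simp add: norm_power power_le_one)
  have pow_int: "set_integrable lborel A (\<lambda>v. w v ^ Suc n)" for n
    using wpow by (intro set_integrable_bounded[OF A, where B = 1]) (measurable, auto simp del: power_Suc)
  have rem: "cmod (w v ^ Suc n / (1 - w v)) \<le> q ^ Suc n / (1 - q)" if "v \<in> A" for v n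
  proof -
    have "1 - q \<le> cmod (1 - w v)" using q(3)[OF that] norm_triangle_ineq2[of 1 "w v"] by simp
    then show ?thesis
      using q(3)[OF that] q by (simp only: norm_divide norm_power) (intro frac_le power_mono, auto)
  qed
  have rem_int: "set_integrable lborel A (\<lambda>v. w v ^ Suc n / (1 - w v))" for n
    by (rule set_integrable_bounded[OF A _ rem]) measurable
  have step: "(LINT v:A|lborel. w v / (1 - w v)) = (LINT v:A|lborel. w v ^ Suc n / (1 - w v))" for n
  proof (induction n)
    case (Suc n)
    have "(LINT v:A|lborel. w v ^ Suc n / (1 - w v))
        = (LINT v:A|lborel. w v ^ Suc n + w v ^ Suc (Suc n) / (1 - w v))"
    proof (rule set_lebesgue_integral_cong)
      show "\<forall>v. v \<in> A \<longrightarrow> w v ^ Suc n / (1 - w v) = w v ^ Suc n + w v ^ Suc (Suc n) / (1 - w v)"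
      proof (intro allI impI)
        fix v assume "v \<in> A"
        then have "1 - w v \<noteq> 0" using q(2) q(3)[of v] by auto
        then show "w v ^ Suc n / (1 - w v) = w v ^ Suc n + w v ^ Suc (Suc n) / (1 - w v)"
          by (simp add: field_simps)
      qed
    qed (use A in auto)
    also have "\<dots> = (LINT v:A|lborel. w v ^ Suc (Suc n) / (1 - w v))"
      using set_integral_add(2)[OF pow_int[of n] rem_int[of "Suc n"]] zero[of n] by simp
    finally show ?case using Suc by simp
  qed simp
  have le: "cmod (LINT v:A|lborel. w v / (1 - w v)) \<le> q ^ Suc n / (1 - q) * measure lborel A" for n
    unfolding step[of n] by (rule set_integral_bounded[OF A _ rem]) measurable
  have "(\<lambda>n. q ^ Suc n / (1 - q) * measure lborel A) \<longlonglongrightarrow> 0 / (1 - q) * measure lborel A"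
    using q by (intro tendsto_mult tendsto_divide tendsto_const LIMSEQ_Suc LIMSEQ_realpow_zero) auto
  then have "cmod (LINT v:A|lborel. w v / (1 - w v)) \<le> 0"
    using le by (intro tendsto_lowerbound[where F = sequentially]) auto
  then show ?thesis by simp
qed

lemma annulus_power_integral:
  fixes e :: complex
  shows "(LINT v:annulus x d|lborel. (e / (v - x)) ^ Suc n) = 0"
    and "(LINT v:annulus x d|lborel. ((v - x) / e) ^ Suc n) = 0"
proof -
  \<comment> \<open>The angle is chosen so that the power \<open>Suc n\<close> of
    \<open>\<omega>\<close> is -1, which serves as the multiplier \<open>l\<close> in
    \<open>annulus_integral_eq_0\<close>.\<close>
  define \<omega> where "\<omega> = cis (pi / real (Suc n))"
  have \<omega>: "cmod \<omega> = 1" by (simp add: \<omega>_def)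
  have pow: "\<omega> ^ Suc n = -1"
  proof -
    have "\<omega> ^ Suc n = cis (real (Suc n) * (pi / real (Suc n)))" unfolding \<omega>_def by (rule Complex.DeMoivre)
    also have "real (Suc n) * (pi / real (Suc n)) = pi" by (simp del: of_nat_Suc)
    finally show ?thesis by (simp only: cis_pi)
  qed
  show "(LINT v:annulus x d|lborel. (e / (v - x)) ^ Suc n) = 0"
  proof (rule annulus_integral_eq_0[OF \<omega>, where f = "\<lambda>u. (e / u) ^ Suc n" and l = "-1"])
    show "(e / (\<omega> * u)) ^ Suc n = - 1 * (e / u) ^ Suc n" for u
    proof -
      have "(e / (\<omega> * u)) ^ Suc n = (e / u) ^ Suc n / \<omega> ^ Suc n"
        by (simp only: power_divide power_mult_distrib divide_divide_eq_left mult.commute)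
      then show ?thesis by (simp only: pow) simp
    qed
  qed auto
  show "(LINT v:annulus x d|lborel. ((v - x) / e) ^ Suc n) = 0"
  proof (rule annulus_integral_eq_0[OF \<omega>, where f = "\<lambda>u. (u / e) ^ Suc n" and l = "-1"])
    show "(\<omega> * u / e) ^ Suc n = - 1 * (u / e) ^ Suc n" for u
    proof -
      have "(\<omega> * u / e) ^ Suc n = \<omega> ^ Suc n * (u / e) ^ Suc n"
        by (simp only: power_divide power_mult_distrib times_divide_eq_right)
      then show ?thesis by (simp only: pow)
    qed
  qed auto
qed

text \<open>This is -1 / pi times the d-bar derivative of the cut-off function that is 1 inside the
  annulus, 0 outside and affine in |v - x|^2 on it; \<open>3 * pi * d\<^sup>2\<close> is the area of
  the annulus.\<close>

definition bump :: "complex \<Rightarrow> real \<Rightarrow> complex \<Rightarrow> complex" where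
  "bump x d v = (v - x) / of_real (3 * pi * d\<^sup>2)"

lemma bump_measurable [measurable]: "bump x d \<in> borel_measurable borel"
  unfolding bump_def by measurable

lemma bump_le:
  assumes "0 < d" "v \<in> annulus x d"
  shows "cmod (bump x d v) \<le> 1 / d"
proof -
  have "cmod (bump x d v) \<le> 2 * d / (3 * pi * d\<^sup>2)"
    using assms by (auto simp: bump_def norm_divide norm_mult norm_power annulus_iff intro!: divide_right_mono)
  also have "\<dots> \<le> 1 / d"
    using assms pi_gt3 by (simp add: field_simps power2_eq_square)
  finally show ?thesis .
qed

text \<open>Here (v - x) / (v - z) = 1 + w / (1 - w) with w = (z - x) / (v - x) of modulus below 1.
  Only the term 1 survives integration, and it gives the normalised area.\<close>

lemma annulus_cauchy_inside:
  assumes d: "0 < d" and z: "cmod (z - x) < d"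
  shows "cauchy_transform (annulus x d) (bump x d) z = 1"
proof -
  define m where "m = 3 * pi * d\<^sup>2"
  have m: "m \<noteq> 0" using d by (simp add: m_def)
  define w where "w v = (z - x) / (v - x)" for v
  have [measurable]: "w \<in> borel_measurable borel" unfolding w_def by measurable
  have wle: "cmod (w v) \<le> cmod (z - x) / d" if "v \<in> annulus x d" for v
    using that d by (auto simp: w_def norm_divide annulus_iff intro!: divide_left_mono mult_pos_pos)
  have q: "0 \<le> cmod (z - x) / d" "cmod (z - x) / d < 1" using d z by auto
  have zero: "(LINT v:annulus x d|lborel. w v / (1 - w v)) = 0"
    by (rule geometric_integral_eq_0[OF _ emeasure_annulus_finite _ q wle])
      (use d in \<open>auto simp: w_def annulus_power_integral simp del: power_Suc\<close>)
  have wint: "set_integrable lborel (annulus x d) (\<lambda>v. w v / (1 - w v))"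
  proof (rule set_integrable_bounded[where B = "1 / (1 - cmod (z - x) / d)"])
    fix v assume v: "v \<in> annulus x d"
    have "1 - cmod (z - x) / d \<le> cmod (1 - w v)"
      using wle[OF v] norm_triangle_ineq2[of 1 "w v"] by simp
    then show "cmod (w v / (1 - w v)) \<le> 1 / (1 - cmod (z - x) / d)"
      unfolding norm_divide using wle[OF v] q by (intro frac_le) auto
  qed (use d emeasure_annulus_finite in auto)
  have "cauchy_transform (annulus x d) (bump x d) z
      = (LINT v:annulus x d|lborel. 1 / of_real m + 1 / of_real m * (w v / (1 - w v)))"
    unfolding cauchy_transform_def
  proof (rule set_lebesgue_integral_cong)
    show "\<forall>v. v \<in> annulus x d \<longrightarrow> bump x d v / (v - z) = 1 / of_real m + 1 / of_real m * (w v / (1 - w v))"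
    proof (intro allI impI)
      fix v assume v: "v \<in> annulus x d"
      then have "v \<noteq> x" "v \<noteq> z" using d z by (auto simp: annulus_iff)
      then have eq: "w v / (1 - w v) = (z - x) / (v - z)"
        by (simp add: w_def divide_simps)
      then show "bump x d v / (v - z) = 1 / of_real m + 1 / of_real m * (w v / (1 - w v))"
        unfolding eq bump_def m_def[symmetric]
        using \<open>v \<noteq> z\<close> m by (simp add: divide_simps)
    qed
  qed auto
  also have "\<dots> = (LINT v:annulus x d|lborel. 1 / complex_of_real m) + 1 / of_real m * (LINT v:annulus x d|lborel. w v / (1 - w v))"
  proof -
    have c1: "set_integrable lborel (annulus x d) (\<lambda>v. 1 / complex_of_real m)"
      by (rule set_integrable_bounded[where B = "cmod (1 / complex_of_real m)"])
        (use d emeasure_annulus_finite in auto)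
    have c2: "set_integrable lborel (annulus x d) (\<lambda>v. 1 / complex_of_real m * (w v / (1 - w v)))"
      using wint by (rule set_integrable_mult_right)
    show ?thesis unfolding set_integral_add(2)[OF c1 c2] by (simp only: set_integral_mult_right)
  qed
  also have "\<dots> = of_real (measure lborel (annulus x d)) / of_real m"
    using zero by (simp add: set_lebesgue_integral_def scaleR_conv_of_real)
  finally show ?thesis using d m by (simp add: measure_annulus m_def)
qed

text \<open>With the inverted ratio w = (v - x) / (z - x) the kernel is -w / (1 - w), a power series
  without constant term.\<close>

lemma annulus_cauchy_outside:
  assumes d: "0 < d" and z: "2 * d < cmod (z - x)"
  shows "cauchy_transform (annulus x d) (bump x d) z = 0"
proof -
  define m where "m = 3 * pi * d\<^sup>2"
  define w where "w v = (v - x) / (z - x)" for v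
  have [measurable]: "w \<in> borel_measurable borel" unfolding w_def by measurable
  have wle: "cmod (w v) \<le> 2 * d / cmod (z - x)" if "v \<in> annulus x d" for v
    using that by (auto simp: w_def norm_divide annulus_iff intro!: divide_right_mono)
  have q: "0 \<le> 2 * d / cmod (z - x)" "2 * d / cmod (z - x) < 1" using d z by (auto simp: divide_less_eq)
  have zero: "(LINT v:annulus x d|lborel. w v / (1 - w v)) = 0"
    by (rule geometric_integral_eq_0[OF _ emeasure_annulus_finite _ q wle])
      (use d in \<open>auto simp: w_def annulus_power_integral simp del: power_Suc\<close>)
  have "cauchy_transform (annulus x d) (bump x d) z
      = (LINT v:annulus x d|lborel. - 1 / of_real m * (w v / (1 - w v)))"
    unfolding cauchy_transform_def
  proof (rule set_lebesgue_integral_cong)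
    show "\<forall>v. v \<in> annulus x d \<longrightarrow> bump x d v / (v - z) = - 1 / of_real m * (w v / (1 - w v))"
    proof (intro allI impI)
      fix v assume v: "v \<in> annulus x d"
      then have ne: "z \<noteq> x" "v \<noteq> z" using d z by (auto simp: annulus_iff)
      then have "w v / (1 - w v) = (v - x) / (z - v)"
        by (simp add: w_def divide_simps)
      also have "\<dots> = - ((v - x) / (v - z))"
        using ne by (metis minus_diff_eq minus_divide_right)
      finally show "bump x d v / (v - z) = - 1 / of_real m * (w v / (1 - w v))"
        by (simp add: bump_def m_def)
    qed
  qed auto
  also have "\<dots> = 0" using zero by (simp only: set_integral_mult_right mult_zero_right)
  finally show ?thesis .
qed

text \<open>McShane's extension: as \<alpha> <= 1, the power |z - w|^\<alpha> satisfies the triangle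
  inequality, and Hoelder functions are the Lipschitz functions of this metric.\<close>

lemma real_holder_extension:
  fixes u :: "complex \<Rightarrow> real"
  assumes W: "W \<noteq> {}" and u: "\<And>z w. z \<in> W \<Longrightarrow> w \<in> W \<Longrightarrow> \<bar>u z - u w\<bar> \<le> k * cmod (z - w) powr \<alpha>"
    and \<alpha>: "0 < \<alpha>" "\<alpha> \<le> 1" and k: "0 \<le> k"
  obtains v where "\<And>z w. \<bar>v z - v w\<bar> \<le> k * cmod (z - w) powr \<alpha>" "\<And>z. z \<in> W \<Longrightarrow> v z = u z"
proof -
  define v where "v z = (INF w\<in>W. u w + k * cmod (z - w) powr \<alpha>)" for z
  have tri: "k * cmod (a - c) powr \<alpha> \<le> k * cmod (a - b) powr \<alpha> + k * cmod (b - c) powr \<alpha>" for a b c :: complex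
  proof -
    have "cmod (a - c) powr \<alpha> \<le> (cmod (a - b) + cmod (b - c)) powr \<alpha>"
      using norm_triangle_ineq[of "a - b" "b - c"] \<alpha> by (intro powr_mono2) auto
    also have "\<dots> \<le> cmod (a - b) powr \<alpha> + cmod (b - c) powr \<alpha>"
      using \<alpha> by (intro powr_add_le_add_powr) auto
    finally show ?thesis using k by (simp add: distrib_left[symmetric] mult_left_mono)
  qed
  have low: "u w0 - k * cmod (z - w0) powr \<alpha> \<le> u w + k * cmod (z - w) powr \<alpha>"
    if "w0 \<in> W" "w \<in> W" for z w0 w
    using u[OF that] tri[of w0 w z] by (simp add: norm_minus_commute)
  have bdd: "bdd_below ((\<lambda>w. u w + k * cmod (z - w) powr \<alpha>) ` W)" for z
  proof -
    obtain w0 where "w0 \<in> W" using W by auto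
    then show ?thesis by (intro bdd_belowI2[where m = "u w0 - k * cmod (z - w0) powr \<alpha>"] low)
  qed
  have half: "v z \<le> v z' + k * cmod (z - z') powr \<alpha>" for z z'
  proof -
    have "v z - k * cmod (z - z') powr \<alpha> \<le> v z'"
      unfolding v_def[of z']
    proof (rule cINF_greatest[OF W])
      fix w assume "w \<in> W"
      then have "v z \<le> u w + k * cmod (z - w) powr \<alpha>"
        unfolding v_def by (intro cINF_lower bdd)
      then show "v z - k * cmod (z - z') powr \<alpha> \<le> u w + k * cmod (z' - w) powr \<alpha>"
        using tri[of z w z'] by simp
    qed
    then show ?thesis by simp
  qed
  have "\<bar>v z - v w\<bar> \<le> k * cmod (z - w) powr \<alpha>" for z w
    using half[of z w] half[of w z] by (simp add: norm_minus_commute abs_le_iff)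
  moreover have "v z = u z" if z: "z \<in> W" for z
  proof (rule antisym)
    show "v z \<le> u z"
      unfolding v_def using cINF_lower[OF bdd z, of z] by simp
    show "u z \<le> v z"
      unfolding v_def by (rule cINF_greatest[OF W]) (use low[OF z, of _ z] in simp)
  qed
  ultimately show thesis using that by blast
qed

text \<open>Real and imaginary parts are extended separately, whence the factor 2.\<close>

lemma holder_extension:
  assumes W: "W \<noteq> {}" and f: "holder_on \<alpha> k W f" and \<alpha>: "0 < \<alpha>" "\<alpha> \<le> 1" and k: "0 \<le> k"
  obtains F where "holder_on \<alpha> (2 * k) UNIV F" "\<And>z. z \<in> W \<Longrightarrow> F z = f z"
proof -
  have re: "\<bar>Re (f z) - Re (f w)\<bar> \<le> k * cmod (z - w) powr \<alpha>"
    and im: "\<bar>Im (f z) - Im (f w)\<bar> \<le> k * cmod (z - w) powr \<alpha>" if "z \<in> W" "w \<in> W" for z w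
    using holder_onD[OF f that] abs_Re_le_cmod[of "f z - f w"] abs_Im_le_cmod[of "f z - f w"] by simp_all
  obtain v1 where v1: "\<And>z w. \<bar>v1 z - v1 w\<bar> \<le> k * cmod (z - w) powr \<alpha>" "\<And>z. z \<in> W \<Longrightarrow> v1 z = Re (f z)"
    using real_holder_extension[OF W re \<alpha> k] by auto
  obtain v2 where v2: "\<And>z w. \<bar>v2 z - v2 w\<bar> \<le> k * cmod (z - w) powr \<alpha>" "\<And>z. z \<in> W \<Longrightarrow> v2 z = Im (f z)"
    using real_holder_extension[OF W im \<alpha> k] by auto
  show thesis
  proof
    show "holder_on \<alpha> (2 * k) UNIV (\<lambda>z. Complex (v1 z) (v2 z))"
    proof (rule holder_onI)
      fix z w
      have "cmod (Complex (v1 z) (v2 z) - Complex (v1 w) (v2 w)) \<le> \<bar>v1 z - v1 w\<bar> + \<bar>v2 z - v2 w\<bar>"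
        using cmod_le[of "Complex (v1 z) (v2 z) - Complex (v1 w) (v2 w)"] by simp
      then show "cmod (Complex (v1 z) (v2 z) - Complex (v1 w) (v2 w)) \<le> 2 * k * cmod (z - w) powr \<alpha>"
        using v1(1)[of z w] v2(1)[of z w] by simp
    qed
    show "Complex (v1 z) (v2 z) = f z" if "z \<in> W" for z
      using that v1(2) v2(2) by (simp add: complex_eq_iff)
  qed
qed

lemma holder_on_imp_continuous_on:
  assumes "holder_on \<alpha> k V F" "0 < \<alpha>"
  shows "continuous_on V F"
  unfolding continuous_on_def
proof
  fix z assume z: "z \<in> V"
  have "((\<lambda>w. k * cmod (w - z) powr \<alpha>) \<longlongrightarrow> k * cmod (z - z) powr \<alpha>) (at z within V)"
    using assms(2) by (intro tendsto_intros tendsto_powr') auto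
  then have lim: "((\<lambda>w. k * cmod (w - z) powr \<alpha>) \<longlongrightarrow> 0) (at z within V)" by simp
  have "((\<lambda>w. F w - F z) \<longlongrightarrow> 0) (at z within V)"
    by (rule Lim_null_comparison[OF _ lim])
      (use holder_onD[OF assms(1) _ z] in \<open>auto simp: eventually_at intro!: exI[of _ 1]\<close>)
  then show "(F \<longlongrightarrow> F z) (at z within V)" by (simp add: LIM_zero_iff)
qed

section \<open>Density of the functions analytic near a boundary point\<close>

text \<open>Because \<open>F z\<close> is subtracted under the integral, all estimates involve only
  the Hoelder constant of \<open>F\<close>, never its size.\<close>

definition local_average :: "complex \<Rightarrow> real \<Rightarrow> (complex \<Rightarrow> complex) \<Rightarrow> complex \<Rightarrow> complex" where
  "local_average x d F z =
     (LINT v:annulus x d|lborel. bump x d v * ((F v - F z) / (v - z)))"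

context
  fixes \<alpha> k d :: real and x :: complex and F :: "complex \<Rightarrow> complex"
  assumes \<alpha>: "0 < \<alpha>" "\<alpha> < 1" and F: "holder_on \<alpha> k UNIV F" and k: "0 \<le> k" and d: "0 < d"
begin

lemma holder_measurable [measurable]: "F \<in> borel_measurable borel"
  using holder_on_imp_continuous_on[OF F \<alpha>(1)] by (rule borel_measurable_continuous_onI)

lemma annulus_cauchy_density: "cauchy_density (annulus x d) (bump x d) (1 / d) x (2 * d)"
  using d bump_le by unfold_locales (auto simp: annulus_def)

lemma holder_bounded_annulus: obtains B where "0 \<le> B" "\<And>v. v \<in> annulus x d \<Longrightarrow> cmod (F v) \<le> B"
proof -
  have "cmod (F v) \<le> cmod (F x) + k * (2 * d) powr \<alpha>" if "v \<in> annulus x d" for v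
  proof -
    have "cmod (F v - F x) \<le> k * cmod (v - x) powr \<alpha>" using F by (simp add: holder_onD)
    also have "\<dots> \<le> k * (2 * d) powr \<alpha>"
      using that k \<alpha> by (intro mult_left_mono powr_mono2) (auto simp: annulus_iff)
    finally show ?thesis using norm_triangle_sub[of "F v" "F x"] by simp
  qed
  then show thesis using that k by (metis add_nonneg_nonneg mult_nonneg_nonneg norm_ge_zero powr_ge_zero)
qed

lemma annulus_cauchy_density_mult:
  obtains B where "cauchy_density (annulus x d) (\<lambda>v. bump x d v * F v) B x (2 * d)"
proof -
  obtain B where B: "0 \<le> B" "\<And>v. v \<in> annulus x d \<Longrightarrow> cmod (F v) \<le> B"
    using holder_bounded_annulus by blast
  have "cauchy_density (annulus x d) (\<lambda>v. bump x d v * F v) (1 / d * B) x (2 * d)"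
    using d B bump_le[OF d]
    by unfold_locales (auto simp: annulus_def norm_mult simp del: times_divide_eq_left intro!: mult_mono)
  then show thesis using that by blast
qed

lemma
  shows local_average_eq: "local_average x d F z
      = cauchy_transform (annulus x d) (\<lambda>v. bump x d v * F v) z
      - F z * cauchy_transform (annulus x d) (bump x d) z"
    and local_average_integrable:
      "set_integrable lborel (annulus x d) (\<lambda>v. bump x d v * ((F v - F z) / (v - z)))"
proof -
  obtain B where "cauchy_density (annulus x d) (\<lambda>v. bump x d v * F v) B x (2 * d)"
    by (rule annulus_cauchy_density_mult)
  note int1 = cauchy_density.cauchy_integrable[OF this, of z]
  note int2 = set_integrable_mult_right[OF cauchy_density.cauchy_integrable[OF annulus_cauchy_density, of z], of "F z"]
  have eq: "bump x d v * ((F v - F z) / (v - z)) =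
     bump x d v * F v / (v - z) - F z * (bump x d v / (v - z))" for v
    by (simp add: diff_divide_distrib right_diff_distrib)
  show "local_average x d F z
      = cauchy_transform (annulus x d) (\<lambda>v. bump x d v * F v) z
      - F z * cauchy_transform (annulus x d) (bump x d) z"
    unfolding local_average_def cauchy_transform_def eq set_integral_diff(2)[OF int1 int2]
    by (simp only: set_integral_mult_right)
  show "set_integrable lborel (annulus x d) (\<lambda>v. bump x d v * ((F v - F z) / (v - z)))"
    unfolding eq by (rule set_integral_diff(1)[OF int1 int2])
qed

text \<open>The bound is free of \<open>d\<close>: the factor 1 / d of \<open>bump\<close> cancels
  against the radius \<open>2 * d\<close>. Smallness therefore has to come from \<open>k\<close>,
  that is, from the little Lipschitz condition.\<close>

lemma holder_on_local_average: "holder_on \<alpha> (12 * k * riesz_const 1) UNIV (local_average x d F)"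
proof (rule holder_onI)
  fix z w
  have "local_average x d F z - local_average x d F w
      = (LINT v:annulus x d|lborel. bump x d v * ((F v - F z) / (v - z))
          - bump x d v * ((F v - F w) / (v - w)))"
    unfolding local_average_def
    by (rule set_integral_diff(2)[OF local_average_integrable local_average_integrable, symmetric])
  also have "cmod \<dots> \<le> 2 * (1 / d * (3 * k * cmod (z - w) powr \<alpha>)) * riesz_const 1 * (2 * d) powr (2 - 1)"
  proof (rule kernel_bound(2)[where x=x and z=z and w=w])
    fix v assume v: "v \<in> annulus x d" "v \<noteq> z" "v \<noteq> w"
    have "cmod (bump x d v * ((F v - F z) / (v - z)) - bump x d v * ((F v - F w) / (v - w)))
       = cmod (bump x d v) * cmod ((F v - F z) / (v - z) - (F v - F w) / (v - w))"
      by (simp only: right_diff_distrib[symmetric] norm_mult)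
    also have "\<dots> \<le> 1 / d * (3 * k * cmod (z - w) powr \<alpha> * (1 / cmod (v - z) + 1 / cmod (v - w)))"
      using v d \<alpha> k by (intro mult_mono bump_le holder_kernel_bound[OF F]) auto
    finally show "cmod (bump x d v * ((F v - F z) / (v - z)) - bump x d v * ((F v - F w) / (v - w)))
        \<le> 1 / d * (3 * k * cmod (z - w) powr \<alpha>) * (cmod (v - z) powr - 1 + cmod (v - w) powr - 1)"
      by (simp add: powr_minus_divide)
  qed (use d k in \<open>auto simp: annulus_def\<close>)
  also have "\<dots> = 12 * k * riesz_const 1 * cmod (z - w) powr \<alpha>" using d by simp
  finally show "cmod (local_average x d F z - local_average x d F w) \<le> 12 * k * riesz_const 1 * cmod (z - w) powr \<alpha>" .
qed

lemma local_average_le: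
  assumes "d \<le> 1 / 2"
  shows "cmod (local_average x d F z) \<le> 2 * k * riesz_const (1 - \<alpha>)"
proof -
  have "cmod (local_average x d F z) \<le> 2 * (1 / d * (k / 2)) * riesz_const (1 - \<alpha>) * (2 * d) powr (2 - (1 - \<alpha>))"
    unfolding local_average_def
  proof (rule kernel_bound(2)[where x=x and z=z and w=z])
    fix v assume v: "v \<in> annulus x d" "v \<noteq> z"
    have "cmod ((F v - F z) / (v - z)) \<le> k * cmod (v - z) powr \<alpha> / cmod (v - z)"
      unfolding norm_divide using F by (intro divide_right_mono) (auto simp: holder_onD)
    also have "\<dots> = k * cmod (v - z) powr - (1 - \<alpha>)"
      using v by (simp add: powr_diff powr_minus)
    finally have "cmod (bump x d v) * cmod ((F v - F z) / (v - z)) \<le> 1 / d * (k * cmod (v - z) powr - (1 - \<alpha>))"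
      using v d k by (intro mult_mono bump_le) auto
    then show "cmod (bump x d v * ((F v - F z) / (v - z)))
        \<le> 1 / d * (k / 2) * (cmod (v - z) powr - (1 - \<alpha>) + cmod (v - z) powr - (1 - \<alpha>))"
      by (simp add: norm_mult del: times_divide_eq_right)
  qed (use d k \<alpha> in \<open>auto simp: annulus_def\<close>)
  also have "\<dots> \<le> 2 * (1 / d * (k / 2)) * riesz_const (1 - \<alpha>) * (2 * d)"
  proof (intro mult_left_mono)
    \<comment> \<open>The base is at most 1 by \<open>assms\<close> and the exponent 1 + \<alpha>
      exceeds 1.\<close>
    have "(2 * d) powr (2 - (1 - \<alpha>)) \<le> (2 * d) powr 1"
      using d assms \<alpha> by (intro powr_mono') auto
    then show "(2 * d) powr (2 - (1 - \<alpha>)) \<le> 2 * d" using d by simp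
  qed (use d k \<alpha> riesz_const_pos[of "1 - \<alpha>"] in auto)
  also have "\<dots> = 2 * k * riesz_const (1 - \<alpha>)" using d by simp
  finally show ?thesis .
qed

text \<open>The delicate points \<open>z\<close> lie in the annulus itself, where the kernel has its
  pole. Since \<open>F\<close> agrees with a holomorphic function near \<open>z\<close>, the
  singularity is removable: filling in the derivative gives a bounded kernel \<open>q\<close> that
  is holomorphic in \<open>z\<close>, and only a null set of \<open>v\<close> is affected.\<close>

lemma holomorphic_local_average:
  assumes U: "open U" "f holomorphic_on U" and z0: "z0 \<in> U" and eq: "\<And>z. z \<in> U \<Longrightarrow> F z = f z"
  obtains e where "0 < e" "ball z0 e \<subseteq> U" "local_average x d F holomorphic_on ball z0 e"
proof -
  obtain e where e: "0 < e" "cball z0 e \<subseteq> U" using U z0 open_contains_cball by blast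
  define V where "V = ball z0 (e / 2)"
  have Vsub: "V \<subseteq> cball z0 e" using e by (auto simp: V_def)
  have holf: "f holomorphic_on cball z0 e" using U e holomorphic_on_subset by blast
  obtain M where M: "\<And>z. z \<in> cball z0 e \<Longrightarrow> cmod (deriv f z) \<le> M"
    and lipf: "\<And>z w. z \<in> cball z0 e \<Longrightarrow> w \<in> cball z0 e \<Longrightarrow> cmod (f z - f w) \<le> M * cmod (z - w)"
    by (rule holomorphic_lipschitz_cball[OF U e(2)]) blast
  define q where "q z v = (if v = z then deriv f z else (F v - f z) / (v - z))" for z v
  define M' where "M' = max M (k * (e / 2) powr - (1 - \<alpha>))"
  have qle: "cmod (q z v) \<le> M'" if z: "z \<in> V" for z v
  proof -
    consider "v = z" | "v \<noteq> z" "v \<in> cball z0 e" | "v \<noteq> z" "v \<notin> cball z0 e" by blast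
    then show ?thesis
    proof cases
      case 1
      then show ?thesis using M[of z] z Vsub by (auto simp: q_def M'_def)
    next
      case 2
      then have "F v = f v" using eq e by blast
      then have "cmod (q z v) \<le> M"
        using 2 lipf[of v z] z Vsub by (auto simp: q_def norm_divide divide_le_eq)
      then show ?thesis by (simp add: M'_def)
    next
      case 3
      then have far: "e / 2 \<le> cmod (v - z)"
        using z dist_triangle[of z0 v z] by (simp add: V_def dist_norm norm_minus_commute)
      have "f z = F z" using eq e Vsub z by auto
      then have "cmod (q z v) \<le> k * cmod (v - z) powr \<alpha> / cmod (v - z)"
        using 3 holder_onD[OF F, of v z] by (simp add: q_def norm_divide divide_right_mono)
      also have "\<dots> = k * cmod (v - z) powr - (1 - \<alpha>)"
        using 3 by (simp add: powr_diff powr_minus)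
      also have "\<dots> \<le> k * (e / 2) powr - (1 - \<alpha>)"
        using far e k \<alpha> by (intro mult_left_mono powr_mono2') auto
      finally show ?thesis by (simp add: M'_def)
    qed
  qed
  have "(\<lambda>z. LINT v:annulus x d|lborel. bump x d v * q z v) holomorphic_on V"
  proof (rule holomorphic_set_integral[where B = "1 / d * M'"])
    fix v assume "v \<in> annulus x d"
    show "(\<lambda>z. bump x d v * q z v) holomorphic_on V"
    proof (cases "v \<in> V")
      case True
      then have Fv: "F v = f v" using eq e Vsub by blast
      have "(\<lambda>z. if z = v then deriv f v else (f z - f v) / (z - v)) holomorphic_on V"
        using True holomorphic_on_subset[OF holf Vsub] by (intro pole_lemma) (auto simp: V_def)
      moreover have "(if z = v then deriv f v else (f z - f v) / (z - v)) = q z v" for z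
        unfolding q_def Fv by (metis (no_types) minus_diff_eq minus_divide_divide)
      ultimately show ?thesis by (auto intro!: holomorphic_intros)
    next
      case False
      then have "q z v = (F v - f z) / (v - z)" "v - z \<noteq> 0" if "z \<in> V" for z using that by (auto simp: q_def)
      then show ?thesis
        using holomorphic_on_subset[OF holf Vsub]
        by (subst holomorphic_cong[OF refl, where g = "\<lambda>z. bump x d v * ((F v - f z) / (v - z))"])
          (auto intro!: holomorphic_intros)
    qed
  next
    fix z v assume "z \<in> V" "v \<in> annulus x d"
    then show "cmod (bump x d v * q z v) \<le> 1 / d * M'"
      using qle d unfolding norm_mult by (intro mult_mono bump_le) auto
  next
    show "(\<lambda>v. bump x d v * q z v) \<in> borel_measurable borel" for z
      unfolding q_def by measurable
  qed (use d emeasure_annulus_finite in \<open>auto simp: V_def\<close>)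
  moreover have "local_average x d F z = (LINT v:annulus x d|lborel. bump x d v * q z v)" if z: "z \<in> V" for z
    unfolding local_average_def set_lebesgue_integral_def
  proof (rule integral_cong_AE)
    have [measurable]: "q z \<in> borel_measurable borel" unfolding q_def by measurable
    show "(\<lambda>v. indicat_real (annulus x d) v *\<^sub>R (bump x d v * q z v)) \<in> borel_measurable lborel"
      by measurable
    have Fz: "f z = F z" using eq e Vsub z by auto
    have ae: "AE v in lborel. v \<noteq> z" by (rule AE_lborel_singleton)
    show "AE v in lborel. indicat_real (annulus x d) v *\<^sub>R (bump x d v * ((F v - F z) / (v - z)))
        = indicat_real (annulus x d) v *\<^sub>R (bump x d v * q z v)"
      using ae by eventually_elim (simp add: q_def Fz)
  qed measurable
  ultimately have "local_average x d F holomorphic_on V"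
    by (simp cong: holomorphic_cong)
  moreover have "V \<subseteq> U" using Vsub e by blast
  ultimately show thesis using that[of "e / 2"] e by (simp add: V_def)
qed

end

context lip_domain
begin

lemma little_lip_cauchy_transform:
  assumes "cauchy_density A c B x r"
  shows "cauchy_transform A c \<in> lip"
proof -
  interpret cauchy_density A c B x r by fact
  \<comment> \<open>The midpoint between \<alpha> and 1, so that \<open>little_lip_holder\<close>
    applies.\<close>
  define \<beta> where "\<beta> = (1 + \<alpha>) / 2"
  have \<beta>: "0 \<le> \<beta>" "\<beta> < 1" "\<alpha> < \<beta>" using alpha_pos alpha_less by (auto simp: \<beta>_def)
  show ?thesis
    by (rule little_lip_holder[OF holder_on_cauchy_transform[OF \<beta>(1,2)] \<beta>(3)])
      (use B_nonneg riesz_const_pos[of "1 + \<beta>"] \<beta> in simp)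
qed

lemma near_dense:
  assumes x: "x \<in> frontier U" and f: "f \<in> analytic_lip_space \<alpha> U" and e: "0 < e"
  obtains g where "g \<in> Near x" "lnorm (\<lambda>z. g z - f z) \<le> e"
proof -
  have f_little: "f \<in> lip" and f_an: "f analytic_on U"
    using f by (auto simp: analytic_lip_space_def)
  \<comment> \<open>The sum of the constants in \<open>holder_on_local_average\<close> and
    \<open>local_average_le\<close> for k = 2 * \<eta>, divided by \<eta>.\<close>
  define R where "R = 24 * riesz_const 1 + 4 * riesz_const (1 - \<alpha>)"
  have Rpos: "0 < riesz_const 1" "0 < riesz_const (1 - \<alpha>)"
    using riesz_const_pos[of 1] riesz_const_pos[of "1 - \<alpha>"] alpha_pos alpha_less by auto
  define \<eta> where "\<eta> = e / R"
  have "0 < R" using Rpos by (simp add: R_def)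
  have \<eta>: "0 < \<eta>" using e \<open>0 < R\<close> by (simp add: \<eta>_def)
  obtain d0 where d0: "0 < d0" "\<And>z w. z \<in> U \<Longrightarrow> w \<in> U \<Longrightarrow> cmod (z - w) < d0 \<Longrightarrow>
      cmod (f z - f w) \<le> \<eta> * cmod (z - w) powr \<alpha>"
    using f_little \<eta> unfolding little_lip_iff by (meson vanishing_holderD)
  \<comment> \<open>Points of the ball of radius 4 d about \<open>x\<close> are less than 8 d <= d0
    apart; the bound 1 / 2 is what \<open>local_average_le\<close> asks for. The ball also reaches
    beyond the outer radius 2 d of the annulus, so \<open>H\<close> vanishes on \<open>U\<close> off
    \<open>W\<close>.\<close>
  define d where "d = min (d0 / 8) (1 / 2)"
  have d: "0 < d" "d \<le> 1 / 2" "8 * d \<le> d0" using d0 by (auto simp: d_def)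
  define W where "W = U \<inter> ball x (4 * d)"
  have "x \<in> closure U" using x by (simp add: frontier_def)
  then have "W \<noteq> {}" unfolding W_def using d(1)
    by (metis closure_approachable dist_commute disjoint_iff mem_ball mult_pos_pos zero_less_numeral)
  have fW: "holder_on \<alpha> \<eta> W f"
  proof (rule holder_onI)
    fix z w assume "z \<in> W" "w \<in> W"
    then have "z \<in> U" "w \<in> U" "cmod (z - w) < d0"
      using dist_triangle_less_add[of z x "4*d" w "4*d"] d(3) by (auto simp: W_def dist_norm norm_minus_commute)
    then show "cmod (f z - f w) \<le> \<eta> * cmod (z - w) powr \<alpha>" by (rule d0(2))
  qed
  obtain F where F: "holder_on \<alpha> (2 * \<eta>) UNIV F" "\<And>z. z \<in> W \<Longrightarrow> F z = f z"
    using holder_extension[OF \<open>W \<noteq> {}\<close> fW] alpha_pos alpha_less \<eta> by auto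
  have k0: "0 \<le> 2 * \<eta>" using \<eta> by simp
  note ctx = alpha_pos alpha_less F(1) k0 d(1)
  define H where "H = cauchy_transform (annulus x d) (bump x d)"
  define G where "G = cauchy_transform (annulus x d) (\<lambda>v. bump x d v * F v)"
  \<comment> \<open>Inside the inner circle H = 1, so only \<open>G\<close> remains, which is
    holomorphic across \<open>x\<close>. Beyond the outer circle H = 0 and g = f + G. On
    \<open>W\<close> the function is \<open>f\<close> plus the local average, which settles the
    annulus.\<close>
  define g where "g z = f z * (1 - H z) + G z" for z
  obtain B where densF: "cauchy_density (annulus x d) (\<lambda>v. bump x d v * F v) B x (2 * d)"
    by (rule annulus_cauchy_density_mult[OF ctx])
  note densH = annulus_cauchy_density[OF ctx, of x]
  have T_eq: "local_average x d F z = G z - F z * H z" for z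
    unfolding G_def H_def by (rule local_average_eq[OF ctx])
  have H0: "H z = 0" if "2 * d < cmod (z - x)" for z
    unfolding H_def using that by (rule annulus_cauchy_outside[OF d(1)])
  have H1: "H z = 1" if "cmod (z - x) < d" for z
    unfolding H_def using that by (rule annulus_cauchy_inside[OF d(1)])
  have diff: "g z - f z = local_average x d F z" if "z \<in> U" for z
  proof (cases "z \<in> W")
    case False
    then have "2 * d < cmod (z - x)" using that d by (auto simp: W_def dist_norm norm_minus_commute)
    then show ?thesis using H0 by (simp add: g_def T_eq)
  qed (simp add: g_def T_eq F(2) algebra_simps)
  have g_little: "g \<in> lip"
    unfolding g_def
    using little_lip_add[OF little_lip_const[of 1] little_lip_mult[OF little_lip_const[of "-1"] little_lip_cauchy_transform[OF densH]]]
    by (intro little_lip_add little_lip_mult f_little) (auto simp: H_def G_def little_lip_cauchy_transform[OF densF])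
  have U_at: "\<exists>e>0. g holomorphic_on ball z e" if z: "z \<in> U" for z
  proof (cases "z \<in> W")
    case True
    have holf: "f holomorphic_on W"
      using f_an by (intro analytic_imp_holomorphic) (auto simp: W_def intro: analytic_on_subset)
    have "open W" using open_U by (auto simp: W_def)
    obtain e where e: "0 < e" "ball z e \<subseteq> W" "local_average x d F holomorphic_on ball z e"
      using holomorphic_local_average[OF ctx \<open>open W\<close> holf True F(2)] by blast
    have "(\<lambda>z. f z + local_average x d F z) holomorphic_on ball z e"
      using e holf by (intro holomorphic_intros) (auto intro: holomorphic_on_subset)
    moreover have "f u + local_average x d F u = g u" if "u \<in> ball z e" for u
    proof -
      have "u \<in> U" using e that by (auto simp: W_def)
      then show ?thesis by (simp add: diff[symmetric])
    qed
    ultimately have "g holomorphic_on ball z e" by (rule holomorphic_transform)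
    then show ?thesis using e(1) by blast
  next
    case False
    define V where "V = U - cball x (2 * d)"
    have "open V" using open_U by (auto simp: V_def)
    have "z \<in> V" using False z d by (auto simp: W_def V_def)
    then obtain e where e: "0 < e" "ball z e \<subseteq> V" using \<open>open V\<close> openE by blast
    have "f holomorphic_on V" using f_an
      by (intro analytic_imp_holomorphic) (auto simp: V_def intro: analytic_on_subset)
    moreover have "G holomorphic_on V"
      unfolding G_def using \<open>open V\<close>
      by (intro cauchy_density.holomorphic_cauchy_transform[OF densF]) (auto simp: V_def annulus_def)
    ultimately have "(\<lambda>z. f z + G z) holomorphic_on V" by (intro holomorphic_intros)
    moreover have "f u + G u = g u" if "u \<in> V" for u
      using H0[of u] that by (simp add: V_def g_def dist_norm norm_minus_commute)
    ultimately have "g holomorphic_on V" by (simp cong: holomorphic_cong)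
    then show ?thesis using e holomorphic_on_subset by blast
  qed
  have "\<exists>e>0. g holomorphic_on ball x e"
  proof -
    have "G holomorphic_on ball x d"
      unfolding G_def
      by (intro cauchy_density.holomorphic_cauchy_transform[OF densF]) (auto simp: annulus_def)
    moreover have "G u = g u" if "u \<in> ball x d" for u
      using H1[of u] that by (simp add: g_def dist_norm norm_minus_commute)
    ultimately have "g holomorphic_on ball x d" by (rule holomorphic_transform)
    then show ?thesis using d(1) by blast
  qed
  then have "g analytic_on (U \<union> {x})" using U_at by (auto simp: analytic_on_def)
  then have near: "g \<in> Near x" using g_little by (simp add: analytic_near_space_def)
  have "lnorm (\<lambda>z. g z - f z) \<le> 12 * (2 * \<eta>) * riesz_const 1 + 2 * (2 * \<eta>) * riesz_const (1 - \<alpha>)"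
  proof (rule lip_norm_le)
    show "holder_on \<alpha> (12 * (2 * \<eta>) * riesz_const 1) U (\<lambda>z. g z - f z)"
      using holder_on_local_average[OF ctx, of x] diff by (simp add: holder_on_def)
    show "cmod (g z - f z) \<le> 2 * (2 * \<eta>) * riesz_const (1 - \<alpha>)" if "z \<in> U" for z
      unfolding diff[OF that] by (rule local_average_le[OF ctx d(2)])
  qed
  also have "\<dots> = \<eta> * R" by (simp add: R_def algebra_simps)
  also have "\<dots> = e" using \<open>0 < R\<close> by (simp add: \<eta>_def)
  finally show thesis using near that by blast
qed

end

section \<open>Gliding humps\<close>

locale bounded_derivation = lip_domain +
  fixes x :: complex and t :: nat
  assumes x_frontier: "x \<in> frontier U" and t_pos: "1 \<le> t"
    and admits: "admits_bounded_point_derivation \<alpha> U t x"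
begin

abbreviation near :: "(complex \<Rightarrow> complex) set" where
  "near \<equiv> Near x"

abbreviation D :: "nat \<Rightarrow> (complex \<Rightarrow> complex) \<Rightarrow> complex" where
  "D j f \<equiv> (deriv ^^ j) f x"

lemma x_notin_U: "x \<notin> U"
  using x_frontier open_U by (simp add: frontier_def interior_open)

lemma D_add: "f \<in> near \<Longrightarrow> g \<in> near \<Longrightarrow> D j (\<lambda>z. f z + g z) = D j f + D j g"
  by (intro higher_deriv_add_at near_analytic_at)

lemma D_diff: "f \<in> near \<Longrightarrow> g \<in> near \<Longrightarrow> D j (\<lambda>z. f z - g z) = D j f - D j g"
  by (intro higher_deriv_diff_at near_analytic_at)

lemma D_cmult: "f \<in> near \<Longrightarrow> D j (\<lambda>z. c * f z) = c * D j f"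
  by (intro higher_deriv_cmult' near_analytic_at)

lemma D_sum: "(\<And>i. i \<in> I \<Longrightarrow> f i \<in> near) \<Longrightarrow> D j (\<lambda>z. \<Sum>i\<in>I. f i z) = (\<Sum>i\<in>I. D j (f i))"
  by (induction I rule: infinite_finite_induct) (simp_all add: D_add near_sum)

lemma near_linear_power: "(\<lambda>z. (z - x) ^ n) \<in> near"
  by (intro near_power near_diff near_ident near_const)

text \<open>Multiplication by z - x turns the derivative of order n + 1 at \<open>x\<close> into n +
  1 times that of order n, so bounds descend from \<open>t\<close>; multiplication is bounded on
  \<open>Lip\<close>.\<close>

lemma lower_derivation_bounded:
  assumes "j \<le> t"
  shows "\<exists>C. \<forall>f\<in>near. cmod (D j f) \<le> C * lnorm f"
  using assms
proof (induction rule: inc_induct)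
  case base
  then show ?case using admits by (simp add: admits_bounded_point_derivation_def)
next
  case (step n)
  then obtain C where C: "\<And>f. f \<in> near \<Longrightarrow> cmod (D (Suc n) f) \<le> C * lnorm f" by blast
  define l where "l z = z - x" for z
  have l: "l \<in> near" unfolding l_def by (intro near_diff near_ident near_const)
  have "cmod (D n f) \<le> (\<bar>C\<bar> * (3 * lnorm l)) * lnorm f" if f: "f \<in> near" for f
  proof -
    have lf: "(\<lambda>z. l z * f z) \<in> near" using l f by (rule near_mult)
    have "D (Suc n) (\<lambda>z. l z * f z) = of_nat (Suc n) * D n f"
      using higher_deriv_linear_mult[OF near_analytic_at[OF f], of n x] by (simp add: l_def)
    then have "cmod (D (Suc n) (\<lambda>z. l z * f z)) = real (Suc n) * cmod (D n f)"
      by (simp only: norm_mult norm_of_nat)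
    moreover have "1 * cmod (D n f) \<le> real (Suc n) * cmod (D n f)" by (intro mult_right_mono) auto
    ultimately have "cmod (D n f) \<le> cmod (D (Suc n) (\<lambda>z. l z * f z))" by simp
    also have "\<dots> \<le> C * lnorm (\<lambda>z. l z * f z)" using C[OF lf] .
    also have "\<dots> \<le> \<bar>C\<bar> * lnorm (\<lambda>z. l z * f z)"
      using lip_norm_nonneg[OF near_big[OF lf]] by (intro mult_right_mono) auto
    also have "\<dots> \<le> \<bar>C\<bar> * (3 * lnorm l * lnorm f)"
      by (intro mult_left_mono lip_norm_mult_le near_big[OF l] near_big[OF f]) auto
    finally show ?thesis by (simp add: mult.assoc)
  qed
  then show ?case by blast
qed

lemma derivation_bounds:
  obtains C where "0 \<le> C" "\<And>j f. j \<le> t \<Longrightarrow> f \<in> near \<Longrightarrow> cmod (D j f) \<le> C * lnorm f"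
proof -
  obtain c where c: "\<And>j f. j \<le> t \<Longrightarrow> f \<in> near \<Longrightarrow> cmod (D j f) \<le> c j * lnorm f"
    using lower_derivation_bounded by metis
  show thesis
  proof
    show "0 \<le> (\<Sum>j\<le>t. \<bar>c j\<bar>)" by (simp add: sum_nonneg)
    fix j f assume j: "j \<le> t" and f: "f \<in> near"
    have "c j \<le> \<bar>c j\<bar>" by simp
    also have "\<dots> \<le> (\<Sum>j\<le>t. \<bar>c j\<bar>)" using j by (intro member_le_sum) auto
    finally have "c j * lnorm f \<le> (\<Sum>j\<le>t. \<bar>c j\<bar>) * lnorm f"
      using lip_norm_nonneg[OF near_big[OF f]] by (rule mult_right_mono)
    with c[OF j f] show "cmod (D j f) \<le> (\<Sum>j\<le>t. \<bar>c j\<bar>) * lnorm f" by linarith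
  qed
qed

text \<open>A gliding hump: since each partial sum \<open>G\<close> is little Lipschitz, a uniformly very small \<open>F\<close>
  interferes with \<open>G\<close> only at scales where the Hoelder quotient of \<open>G\<close> is negligible. So the Hoelder
  constants of the partial sums stay bounded, while \<open>D t\<close> of them grows linearly.\<close>

lemma no_uniformly_small_humps:
  assumes K: "0 \<le> K" and c: "0 < c"
    and hump: "\<And>\<eta>. 0 < \<eta> \<Longrightarrow> \<exists>F\<in>near. (\<forall>z\<in>U. cmod (F z) \<le> \<eta>) \<and> holder_on \<alpha> K U F \<and> c \<le> Re (D t F)"
  shows False
proof -
  \<comment> \<open>The slack 1 / 2^N is halved at each step, which keeps the supremum below 1 and
    the Hoelder constant below K + 2 for every N, while \<open>D t\<close> gains c each
    time.\<close>
  have sums: "\<exists>G\<in>near. (\<forall>z\<in>U. cmod (G z) \<le> 1 - 1 / 2 ^ N) \<and> holder_on \<alpha> (K + 2 - 1 / 2 ^ N) U G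
      \<and> real N * c \<le> Re (D t G)" for N
  proof (induction N)
    case 0
    show ?case
      by (rule bexI[of _ "\<lambda>z. 0"]) (use K in \<open>auto simp: holder_on_const near_const\<close>)
  next
    case (Suc N)
    then obtain G where G: "G \<in> near" "\<And>z. z \<in> U \<Longrightarrow> cmod (G z) \<le> 1 - 1 / 2 ^ N"
      "holder_on \<alpha> (K + 2 - 1 / 2 ^ N) U G" "real N * c \<le> Re (D t G)" by blast
    define e :: real where "e = 1 / 2 ^ Suc N"
    have e: "0 < e" "e \<le> 1 / 2" "1 / 2 ^ N = 2 * e" by (auto simp: e_def field_simps)
    have "vanishing_holder G" using G(1) near_little little_lip_iff by blast
    then obtain \<kappa> where \<kappa>: "0 < \<kappa>" "\<And>z w. z \<in> U \<Longrightarrow> w \<in> U \<Longrightarrow> cmod (z - w) < \<kappa> \<Longrightarrow>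
        cmod (G z - G w) \<le> e * cmod (z - w) powr \<alpha>"
      using vanishing_holderD[OF _ e(1), of G] by blast
    \<comment> \<open>The bound e serves the supremum. The other gives |F z - F w| <= 2 * \<eta> <=
      e * |z - w|^\<alpha> once |z - w| >= \<kappa>, so at these distances \<open>F\<close> adds
      only e to the Hoelder constant.\<close>
    define \<eta> where "\<eta> = min e (e * \<kappa> powr \<alpha> / 2)"
    have "0 < \<eta>" using e \<kappa> by (simp add: \<eta>_def)
    then obtain F where F: "F \<in> near" "\<And>z. z \<in> U \<Longrightarrow> cmod (F z) \<le> \<eta>" "holder_on \<alpha> K U F" "c \<le> Re (D t F)"
      using hump by meson
    show ?case
    proof (intro bexI conjI ballI)
      show "(\<lambda>z. G z + F z) \<in> near" using G(1) F(1) by (rule near_add)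
      show "cmod (G z + F z) \<le> 1 - 1 / 2 ^ Suc N" if "z \<in> U" for z
      proof -
        have "cmod (G z + F z) \<le> (1 - 2 * e) + e"
          using G(2)[OF that] F(2)[OF that] norm_triangle_ineq[of "G z" "F z"] e by (simp add: \<eta>_def)
        then show ?thesis by (simp add: e_def)
      qed
      show "holder_on \<alpha> (K + 2 - 1 / 2 ^ Suc N) U (\<lambda>z. G z + F z)"
        unfolding e_def[symmetric]
      proof (rule holder_onI)
        fix z w assume zw: "z \<in> U" "w \<in> U"
        define p where "p = cmod (z - w) powr \<alpha>"
        have "G z + F z - (G w + F w) = (G z - G w) + (F z - F w)" by simp
        then have tri: "cmod (G z + F z - (G w + F w)) \<le> cmod (G z - G w) + cmod (F z - F w)"
          by (metis norm_triangle_ineq)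
        show "cmod (G z + F z - (G w + F w)) \<le> (K + 2 - e) * cmod (z - w) powr \<alpha>"
        proof (cases "cmod (z - w) < \<kappa>")
          case True
          have "cmod (G z + F z - (G w + F w)) \<le> e * p + K * p"
            using tri \<kappa>(2)[OF zw True] holder_onD[OF F(3) zw] by (simp add: p_def)
          also have "\<dots> = (K + e) * p" by (simp add: algebra_simps)
          also have "\<dots> \<le> (K + 2 - e) * p" using e by (intro mult_right_mono) (auto simp: p_def)
          finally show ?thesis by (simp add: p_def)
        next
          case False
          have "cmod (F z - F w) \<le> 2 * \<eta>"
            using F(2)[OF zw(1)] F(2)[OF zw(2)] norm_triangle_ineq4[of "F z" "F w"] by simp
          also have "\<dots> \<le> e * \<kappa> powr \<alpha>" by (simp add: \<eta>_def)
          also have "\<dots> \<le> e * p"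
            unfolding p_def using False e \<kappa> alpha_pos by (intro mult_left_mono powr_mono2) auto
          finally have "cmod (G z + F z - (G w + F w)) \<le> (K + 2 - 2 * e) * p + e * p"
            using tri holder_onD[OF G(3) zw] e by (simp add: p_def)
          then show ?thesis by (simp add: p_def algebra_simps)
        qed
      qed
      show "real (Suc N) * c \<le> Re (D t (\<lambda>z. G z + F z))"
        using G F by (simp add: D_add distrib_right)
    qed
  qed
  obtain C where C: "0 \<le> C" "\<And>j f. j \<le> t \<Longrightarrow> f \<in> near \<Longrightarrow> cmod (D j f) \<le> C * lnorm f"
    by (rule derivation_bounds) blast
  obtain N :: nat where N: "C * (K + 3) / c < real N" using reals_Archimedean2 by blast
  obtain G where G: "G \<in> near" "\<And>z. z \<in> U \<Longrightarrow> cmod (G z) \<le> 1 - 1 / 2 ^ N"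
    "holder_on \<alpha> (K + 2 - 1 / 2 ^ N) U G" "real N * c \<le> Re (D t G)" using sums[of N] by blast
  have "lnorm G \<le> (K + 2 - 1 / 2 ^ N) + (1 - 1 / 2 ^ N)"
    by (rule lip_norm_le[OF G(3,2)])
  also have "\<dots> \<le> K + 3"
    by simp
  finally have "C * lnorm G \<le> C * (K + 3)" using C(1) by (rule mult_left_mono)
  moreover have "Re (D t G) \<le> C * lnorm G"
    using C(2)[OF order_refl G(1)] complex_Re_le_cmod order_trans by blast
  ultimately have "real N * c \<le> C * (K + 3)" using G(4) by linarith
  then show False using N c by (simp add: divide_less_eq)
qed

text \<open>The numerator of the density \<open>\<rho>\<close> cancels the kernel of
  \<open>D t\<close>, which therefore reads off the area of \<open>A\<close> relative to r^2. The
  density is at most r^(t-1) <= 1, so the supremum of the transform is of order \<open>r\<close> and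
  its Hoelder constant is bounded.\<close>

lemma complement_density:
  assumes c: "0 < c"
  shows "\<exists>r0>0. \<forall>r. 0 < r \<and> r < r0 \<longrightarrow> measure lborel (ball x r - U) < c * r\<^sup>2"
proof (rule ccontr)
  assume not: "\<not> ?thesis"
  have ex: "\<exists>r. 0 < r \<and> r < r0 \<and> c * r\<^sup>2 \<le> measure lborel (ball x r - U)" if "0 < r0" for r0
    using not that by (meson not_le)
  \<comment> \<open>The disc of radius \<open>s * r\<close> has area c / 2 * r^2, half of the
    assumed excess. Its removal keeps \<open>A\<close> away from \<open>x\<close> and makes the
    transform analytic there.\<close>
  define s where "s = sqrt (c / (2 * pi))"
  have s: "0 < s" "pi * s\<^sup>2 = c / 2" using c by (auto simp: s_def)
  have R: "0 < riesz_const 1" "0 < riesz_const (1 + \<alpha>)"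
    using riesz_const_pos alpha_pos alpha_less by auto
  have "\<exists>F\<in>near. (\<forall>z\<in>U. cmod (F z) \<le> \<eta>) \<and> holder_on \<alpha> (4 * riesz_const (1 + \<alpha>)) U F \<and> c / 2 \<le> Re (D t F)"
    if \<eta>: "0 < \<eta>" for \<eta>
  proof -
    obtain r where r: "0 < r" "r < min 1 (\<eta> / riesz_const 1)" "c * r\<^sup>2 \<le> measure lborel (ball x r - U)"
      using ex[of "min 1 (\<eta> / riesz_const 1)"] \<eta> R by auto
    have r1: "r < 1" "riesz_const 1 * r \<le> \<eta>" using r(2) R by (auto simp: field_simps)
    define A where "A = (ball x r - U) - ball x (s * r)"
    define \<rho> where "\<rho> v = (v - x) ^ Suc t / of_real (r\<^sup>2)" for v
    have A_borel: "A \<in> sets borel" using open_U by (auto simp: A_def)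
    have dist_A: "s * r \<le> cmod (v - x)" "cmod (v - x) \<le> r" if "v \<in> A" for v
      using that by (auto simp: A_def dist_norm norm_minus_commute)
    \<comment> \<open>Here \<open>t_pos\<close> enters: for t = 0 the density would have size 1 /
      r.\<close>
    have rt: "r ^ Suc t / r\<^sup>2 = r ^ (t - 1)"
      using t_pos r by (cases t) (auto simp: power2_eq_square field_simps)
    have rt1: "r ^ (t - 1) \<le> 1" using r r1 by (simp add: power_le_one)
    have dens: "cauchy_density A \<rho> (r ^ (t - 1)) x r"
    proof
      show "A \<subseteq> cball x r" by (auto simp: A_def)
      show "\<rho> \<in> borel_measurable borel" unfolding \<rho>_def by measurable
      show "cmod (\<rho> v) \<le> r ^ (t - 1)" if "v \<in> A" for v
        unfolding rt[symmetric] \<rho>_def norm_divide norm_power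
        using dist_A[OF that] r by (intro frac_le power_mono) (auto simp: norm_power)
    qed (use A_borel r in auto)
    interpret cauchy_density A \<rho> "r ^ (t - 1)" x r by (rule dens)
    define F where "F = cauchy_transform A \<rho>"
    have "F holomorphic_on U"
      unfolding F_def using open_U by (intro holomorphic_cauchy_transform) (auto simp: A_def)
    moreover have "F holomorphic_on ball x (s * r)"
      unfolding F_def by (intro holomorphic_cauchy_transform) (auto simp: A_def)
    ultimately have "F holomorphic_on U \<union> ball x (s * r)"
      using open_U by (intro holomorphic_on_Un) auto
    then have "F analytic_on U \<union> ball x (s * r)"
      using open_U by (simp add: analytic_on_open open_Un)
    then have "F analytic_on U \<union> {x}"
      by (rule analytic_on_subset) (use s r in auto)
    then have "F \<in> near"
      using little_lip_cauchy_transform[OF dens] by (simp add: analytic_near_space_def F_def)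
    moreover have "cmod (F z) \<le> \<eta>" for z
    proof -
      have "cmod (F z) \<le> r ^ (t - 1) * riesz_const 1 * r" unfolding F_def by (rule cauchy_transform_le)
      also have "\<dots> \<le> 1 * riesz_const 1 * r" using rt1 R r by (intro mult_right_mono) auto
      finally show ?thesis using r1 by simp
    qed
    moreover have "holder_on \<alpha> (4 * riesz_const (1 + \<alpha>)) U F"
    proof (rule holder_on_mono)
      show "holder_on \<alpha> (4 * r ^ (t - 1) * riesz_const (1 + \<alpha>) * r powr (1 - \<alpha>)) U F"
        unfolding F_def using alpha_pos alpha_less by (intro holder_on_cauchy_transform) auto
      have "r powr (1 - \<alpha>) \<le> 1" using r r1 alpha_less by (intro powr_le1) auto
      then have "r ^ (t - 1) * r powr (1 - \<alpha>) \<le> 1 * 1" using rt1 r by (intro mult_mono) auto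
      then have "(4 * riesz_const (1 + \<alpha>)) * (r ^ (t - 1) * r powr (1 - \<alpha>)) \<le> (4 * riesz_const (1 + \<alpha>)) * 1"
        using R by (intro mult_left_mono) auto
      then show "4 * r ^ (t - 1) * riesz_const (1 + \<alpha>) * r powr (1 - \<alpha>) \<le> 4 * riesz_const (1 + \<alpha>)"
        by (simp add: algebra_simps)
    qed
    moreover have "c / 2 \<le> Re (D t F)"
    proof -
      have "D t F = fact t * (LINT v:A|lborel. \<rho> v / (v - x) ^ Suc t)"
        unfolding F_def using s r by (intro higher_deriv_cauchy_transform[OF dens, of "s * r"]) (auto simp: A_def)
      also have "(LINT v:A|lborel. \<rho> v / (v - x) ^ Suc t) = (LINT v:A|lborel. 1 / complex_of_real (r\<^sup>2))"
      proof (rule set_lebesgue_integral_cong)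
        show "\<forall>v. v \<in> A \<longrightarrow> \<rho> v / (v - x) ^ Suc t = 1 / complex_of_real (r\<^sup>2)"
        proof (intro allI impI)
          fix v assume "v \<in> A"
          then have "v - x \<noteq> 0" using dist_A(1)[of v] s r by (metis mult_pos_pos norm_zero not_less)
          then show "\<rho> v / (v - x) ^ Suc t = 1 / complex_of_real (r\<^sup>2)" by (simp add: \<rho>_def)
        qed
      qed (use A_borel in simp)
      also have "\<dots> = of_real (measure lborel A / r\<^sup>2)"
        using A_borel A_finite by (simp add: set_lebesgue_integral_def scaleR_conv_of_real)
      finally have "Re (D t F) = fact t * (measure lborel A / r\<^sup>2)"
        by (metis Re_complex_of_real of_real_fact of_real_mult)
      moreover have "1 * (measure lborel A / r\<^sup>2) \<le> fact t * (measure lborel A / r\<^sup>2)"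
        by (intro mult_right_mono fact_ge_1) auto
      moreover have "c / 2 \<le> measure lborel A / r\<^sup>2"
      proof -
        have "measure lborel (ball x r - U) \<le> measure lborel (A \<union> ball x (s * r))"
        proof (rule measure_mono_fmeasurable)
          show "A \<union> ball x (s * r) \<in> fmeasurable lborel"
            using A_borel A_finite s r by (intro fmeasurable.Un fmeasurableI) (auto simp: emeasure_ball)
        qed (use open_U in \<open>auto simp: A_def\<close>)
        also have "\<dots> \<le> measure lborel A + measure lborel (ball x (s * r))"
          using A_borel by (intro measure_Un_le) auto
        also have "measure lborel (ball x (s * r)) = c / 2 * r\<^sup>2"
          using s r by (simp add: content_ball unit_ball_vol_2 power_mult_distrib)
        finally have "c / 2 * r\<^sup>2 \<le> measure lborel A" using r(3) by linarith
        then show ?thesis using r by (simp add: field_simps)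
      qed
      ultimately show ?thesis by linarith
    qed
    ultimately show ?thesis by blast
  qed
  then show False using c R by (intro no_uniformly_small_humps[of "4 * riesz_const (1 + \<alpha>)" "c / 2"]) auto
qed

end

section \<open>Disc packings and difference quotients\<close>

text \<open>Comparison of a sum with a Riesz potential. On its disc |v - z| is at most twice the
  maximum in the term, so the kernel there is at least 2^(-s) >= 1 / 4 of the summand's power, and
  the area is at least \<rho>^2. Disjointness adds the integrals up to one over the large
  disc.\<close>

lemma sum_ball_riesz_le:
  fixes y :: "'i \<Rightarrow> complex" and \<rho> :: "'i \<Rightarrow> real"
  assumes s: "0 \<le> s" "s < 2" and r: "0 < r" and I: "finite I"
    and \<rho>: "\<And>i. i \<in> I \<Longrightarrow> 0 < \<rho> i"
    and sub: "\<And>i. i \<in> I \<Longrightarrow> cball (y i) (\<rho> i) \<subseteq> cball x r"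
    and disj: "pairwise (\<lambda>i j. disjnt (cball (y i) (\<rho> i)) (cball (y j) (\<rho> j))) I"
  shows "(\<Sum>i\<in>I. (\<rho> i)\<^sup>2 * max (cmod (z - y i)) (\<rho> i) powr - s) \<le> 4 * riesz_const s * r powr (2 - s)"
proof -
  define g where "g v = cmod (v - z) powr - s" for v
  define B where "B i = cball (y i) (\<rho> i)" for i
  have gint: "set_integrable lborel (cball x r) g"
    unfolding g_def using s r by (rule riesz_integrable)
  have Bint: "integrable lborel (\<lambda>v. indicat_real (B i) v * g v)" if "i \<in> I" for i
    using set_integrable_subset[OF gint, of "B i"] sub[OF that] by (simp add: set_integrable_def B_def)
  have single: "(\<rho> i)\<^sup>2 * max (cmod (z - y i)) (\<rho> i) powr - s \<le> 4 * (LINT v|lborel. indicat_real (B i) v * g v)"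
    if i: "i \<in> I" for i
  proof -
    define a where "a = max (cmod (z - y i)) (\<rho> i)"
    have a: "0 < a" using \<rho>[OF i] by (simp add: a_def)
    have ge: "a powr - s \<le> 4 * g v" if "v \<in> B i" "v \<noteq> z" for v
    proof -
      have "cmod (v - z) \<le> 2 * a"
        using that(1) dist_triangle[of v z "y i"] by (auto simp: B_def a_def dist_norm norm_minus_commute)
      then have "(2 * a) powr - s \<le> g v"
        unfolding g_def using that s by (intro powr_mono2') auto
      moreover have "a powr - s = 2 powr s * (2 * a) powr - s"
        using a by (simp add: powr_mult powr_minus)
      moreover have "2 powr s \<le> (4::real)" using powr_mono[of s 2 "2::real"] s by simp
      ultimately have "a powr - s \<le> 4 * (2 * a) powr - s" by (simp add: mult_right_mono)
      also have "\<dots> \<le> 4 * g v" using \<open>(2 * a) powr - s \<le> g v\<close> by simp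
      finally show ?thesis .
    qed
    have "(\<rho> i)\<^sup>2 * a powr - s \<le> pi * (\<rho> i)\<^sup>2 * a powr - s"
      using pi_gt3 mult_right_mono[of 1 pi "(\<rho> i)\<^sup>2"] by (intro mult_right_mono) auto
    also have "\<dots> = (LINT v|lborel. a powr - s * indicat_real (B i) v)"
      using \<rho>[OF i] by (simp add: B_def content_cball unit_ball_vol_2)
    also have "\<dots> \<le> (LINT v|lborel. 4 * (indicat_real (B i) v * g v))"
    proof (rule integral_mono_AE)
      show "integrable lborel (\<lambda>v. a powr - s * indicat_real (B i) v)"
        by (simp add: B_def emeasure_cball \<rho>[OF i, THEN less_imp_le])
      show "AE v in lborel. a powr - s * indicat_real (B i) v \<le> 4 * (indicat_real (B i) v * g v)"
        using AE_lborel_singleton[of z]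
      proof eventually_elim
        case (elim v)
        then show ?case using ge[of v] by (simp add: indicator_def)
      qed
    qed (use Bint[OF i] in simp)
    finally show ?thesis by (simp add: a_def)
  qed
  have "(\<Sum>i\<in>I. (\<rho> i)\<^sup>2 * max (cmod (z - y i)) (\<rho> i) powr - s)
      \<le> 4 * (\<Sum>i\<in>I. LINT v|lborel. indicat_real (B i) v * g v)"
    unfolding sum_distrib_left by (intro sum_mono single)
  also have "(\<Sum>i\<in>I. LINT v|lborel. indicat_real (B i) v * g v)
      = (LINT v|lborel. (\<Sum>i\<in>I. indicat_real (B i) v * g v))"
    using Bint by (intro Bochner_Integration.integral_sum[symmetric])
  also have "\<dots> \<le> (LINT v|lborel. indicat_real (cball x r) v * g v)"
  proof (rule integral_mono)
    show "integrable lborel (\<lambda>v. \<Sum>i\<in>I. indicat_real (B i) v * g v)" using Bint by auto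
    show "integrable lborel (\<lambda>v. indicat_real (cball x r) v * g v)"
      using gint by (simp add: set_integrable_def)
    fix v
    show "(\<Sum>i\<in>I. indicat_real (B i) v * g v) \<le> indicat_real (cball x r) v * g v"
    proof (cases "\<exists>i\<in>I. v \<in> B i")
      case True
      then obtain i where i: "i \<in> I" "v \<in> B i" by blast
      have "(\<Sum>j\<in>I. indicat_real (B j) v * g v) = (\<Sum>j\<in>{i}. indicat_real (B j) v * g v)"
        using i disj I by (intro sum.mono_neutral_right) (auto simp: pairwise_def disjnt_iff B_def indicator_def)
      moreover have "v \<in> cball x r" using i sub[OF i(1)] by (auto simp: B_def)
      ultimately show ?thesis using i by simp
    qed (auto simp: g_def)
  qed
  also have "\<dots> \<le> riesz_const s * r powr (2 - s)"
    using riesz_integral_le[OF s r, of x z] by (simp add: set_lebesgue_integral_def g_def)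
  finally show ?thesis by simp
qed

text \<open>Vitali's theorem fills \<Omega> up to a null set with countably many disjoint discs, and
  continuity of measure lets finitely many of them keep half of the area. Finiteness keeps the later
  superpositions inside \<open>near\<close>.\<close>

lemma finite_ball_packing:
  fixes \<Omega> :: "complex set"
  assumes \<Omega>: "open \<Omega>" "bounded \<Omega>" and pos: "0 < measure lborel \<Omega>"
  obtains I :: "(complex \<times> real) set" where "finite I"
    "\<And>p. p \<in> I \<Longrightarrow> 0 < snd p" "\<And>p. p \<in> I \<Longrightarrow> cball (fst p) (snd p) \<subseteq> \<Omega>"
    "pairwise (\<lambda>p q. disjnt (cball (fst p) (snd p)) (cball (fst q) (snd q))) I"
    "measure lborel \<Omega> / 2 \<le> (\<Sum>p\<in>I. pi * (snd p)\<^sup>2)"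
proof -
  define K where "K = {p. 0 < snd p \<and> cball (fst p) (snd p) \<subseteq> \<Omega>}"
  have fine: "\<exists>p. p \<in> K \<and> u \<in> cball (fst p) (snd p) \<and> snd p < d" if u: "u \<in> \<Omega>" and d: "0 < d" for u d
  proof -
    obtain e where e: "0 < e" "cball u e \<subseteq> \<Omega>" using \<Omega>(1) u open_contains_cball by blast
    then have "cball u (min e (d / 2)) \<subseteq> \<Omega>" by auto
    then show ?thesis using e d by (intro exI[of _ "(u, min e (d / 2))"]) (auto simp: K_def)
  qed
  obtain C where C: "countable C" "C \<subseteq> K"
    "pairwise (\<lambda>p q. disjnt (cball (fst p) (snd p)) (cball (fst q) (snd q))) C"
    "negligible (\<Omega> - (\<Union>p\<in>C. cball (fst p) (snd p)))"
    using Vitali_covering_theorem_cballs[of K snd \<Omega> fst] fine by (auto simp: K_def)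
  define B where "B p = cball (fst p) (snd p)" for p :: "complex \<times> real"
  have fin: "emeasure lborel \<Omega> < \<infinity>" using \<Omega>(2) by (rule emeasure_bounded_finite)
  have C_ne: "C \<noteq> {}"
  proof
    assume "C = {}"
    then have "\<Omega> \<in> null_sets lebesgue" using C(4) by (simp add: negligible_iff_null_sets)
    then have "measure lebesgue \<Omega> = 0" by (simp add: null_sets_def measure_def)
    then show False using pos \<Omega>(1) by simp
  qed
  \<comment> \<open>\<open>from_nat_into\<close> may repeat members when \<open>C\<close> is finite;
    taking the image absorbs the repetitions.\<close>
  define P where "P n = (\<Union>p\<in>from_nat_into C ` {..<n}. B p)" for n
  have P_sets: "P n \<in> sets lborel" for n by (auto simp: P_def B_def)
  have UN_P: "(\<Union>n. P n) = (\<Union>p\<in>C. B p)"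
  proof -
    have "(\<Union>n. from_nat_into C ` {..<n}) = C"
      using range_from_nat_into[OF C_ne C(1)] by (simp add: image_UN[symmetric] UN_lessThan_UNIV)
    then show ?thesis unfolding P_def by blast
  qed
  have "emeasure lborel \<Omega> \<le> emeasure lborel (\<Union>n. P n)"
  proof -
    have "\<Omega> - (\<Union>n. P n) \<in> sets lborel" using P_sets \<Omega>(1) by auto
    then have "\<Omega> - (\<Union>n. P n) \<in> null_sets lborel"
      using C(4) unfolding UN_P B_def by (simp only: negligible_iff_null_sets null_sets_completion_iff)
    then have "AE u in lborel. u \<notin> \<Omega> - (\<Union>n. P n)" by (rule AE_not_in)
    then have "AE u in lborel. u \<in> \<Omega> \<longrightarrow> u \<in> (\<Union>n. P n)" by eventually_elim auto
    then show ?thesis using P_sets by (intro emeasure_mono_AE) auto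
  qed
  moreover have "ennreal (measure lborel \<Omega> / 2) < emeasure lborel \<Omega>"
    using fin pos by (simp add: emeasure_eq_ennreal_measure ennreal_lessI less_top[symmetric])
  ultimately have big: "ennreal (measure lborel \<Omega> / 2) < emeasure lborel (\<Union>n. P n)" by (rule order.strict_trans2[rotated])
  have "(\<lambda>n. emeasure lborel (P n)) \<longlonglongrightarrow> emeasure lborel (\<Union>n. P n)"
  proof (rule Lim_emeasure_incseq)
    show "incseq P" unfolding incseq_def P_def by (intro allI impI UN_mono image_mono) auto
  qed (use P_sets in auto)
  then have "eventually (\<lambda>n. ennreal (measure lborel \<Omega> / 2) < emeasure lborel (P n)) sequentially"
    using big by (rule order_tendstoD(1))
  then obtain n where n: "ennreal (measure lborel \<Omega> / 2) < emeasure lborel (P n)"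
    by (auto simp: eventually_sequentially)
  define I where "I = from_nat_into C ` {..<n}"
  have "I \<subseteq> C" unfolding I_def using from_nat_into[OF C_ne] by auto
  have IK: "I \<subseteq> K" using \<open>I \<subseteq> C\<close> C(2) by blast
  have "emeasure lborel (P n) \<le> (\<Sum>p\<in>I. emeasure lborel (B p))"
    unfolding P_def I_def[symmetric] by (intro emeasure_subadditive_finite) (auto simp: I_def B_def)
  also have "\<dots> = (\<Sum>p\<in>I. ennreal (pi * (snd p)\<^sup>2))"
    using IK by (intro sum.cong) (auto simp: B_def K_def emeasure_cball unit_ball_vol_2)
  also have "\<dots> = ennreal (\<Sum>p\<in>I. pi * (snd p)\<^sup>2)"
    by (intro sum_ennreal) simp
  finally have "ennreal (measure lborel \<Omega> / 2) \<le> ennreal (\<Sum>p\<in>I. pi * (snd p)\<^sup>2)"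
    using n by simp
  then have "measure lborel \<Omega> / 2 \<le> (\<Sum>p\<in>I. pi * (snd p)\<^sup>2)"
    by (subst (asm) ennreal_le_iff) (auto intro!: sum_nonneg)
  then show thesis
    using IK pairwise_subset[OF C(3) \<open>I \<subseteq> C\<close>] by (intro that[of I]) (auto simp: I_def K_def)
qed

section \<open>Difference quotients of holomorphic Hoelder functions\<close>

definition diff_quot :: "(complex \<Rightarrow> complex) \<Rightarrow> complex \<Rightarrow> complex \<Rightarrow> complex" where
  "diff_quot h y z = (if z = y then deriv h y else (h z - h y) / (z - y))"

text \<open>Symmetry lets the maximum principle act on the centre \<open>y\<close> instead of the
  argument.\<close>

lemma diff_quot_commute: "diff_quot h y z = diff_quot h z y"
  unfolding diff_quot_def by (metis minus_diff_eq minus_divide_divide)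

lemma holomorphic_diff_quot:
  "h holomorphic_on S \<Longrightarrow> y \<in> interior S \<Longrightarrow> diff_quot h y holomorphic_on S"
  unfolding diff_quot_def by (rule pole_lemma)

context lip_domain
begin

context
  fixes h :: "complex \<Rightarrow> complex" and M \<rho> :: real and y :: complex
  assumes holh: "h holomorphic_on U" and hM: "holder_on \<alpha> M U h"
    and \<rho>: "0 < \<rho>" and cball_U: "cball y \<rho> \<subseteq> U"
begin

lemma cball_centre_in: "y \<in> U"
  using \<rho> cball_U by auto

text \<open>Hoelder continuity alone gives a bound that blows up at \<open>y\<close>. Inside the
  disc the maximum principle replaces it by its value on the circle |u - y| = \<rho>; this is why
  the disc has to lie in \<open>U\<close>.\<close>

lemma diff_quot_le:
  assumes z: "z \<in> U"
  shows "cmod (diff_quot h y z) \<le> M * max (cmod (z - y)) \<rho> powr - (1 - \<alpha>)"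
proof -
  have M: "0 \<le> M" by (rule holder_const_nonneg[OF hM])
  have far: "cmod (diff_quot h y u) \<le> M * cmod (u - y) powr - (1 - \<alpha>)" if "u \<in> U" "u \<noteq> y" for u
  proof -
    have "cmod (diff_quot h y u) \<le> M * cmod (u - y) powr \<alpha> / cmod (u - y)"
      using holder_onD[OF hM that(1) cball_centre_in] that by (simp add: diff_quot_def norm_divide divide_right_mono)
    then show ?thesis using that by (simp add: powr_diff powr_minus)
  qed
  show ?thesis
  proof (cases "\<rho> \<le> cmod (z - y)")
    case True
    moreover have "z \<noteq> y" using True \<rho> by auto
    ultimately show ?thesis using far[OF z] by (simp add: max_def)
  next
    case False
    have hol: "diff_quot h y holomorphic_on U"
      using cball_centre_in open_U holh by (intro holomorphic_diff_quot) (auto simp: interior_open)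
    have "cmod (diff_quot h y z) \<le> M * \<rho> powr - (1 - \<alpha>)"
    proof (rule maximum_modulus_frontier[where S = "cball y \<rho>" and f = "diff_quot h y" and \<xi> = z])
      show "diff_quot h y holomorphic_on interior (cball y \<rho>)"
        using hol cball_U interior_subset holomorphic_on_subset by (metis order_trans)
      show "continuous_on (closure (cball y \<rho>)) (diff_quot h y)"
        using holomorphic_on_imp_continuous_on[OF holomorphic_on_subset[OF hol cball_U]] by simp
      fix u assume "u \<in> frontier (cball y \<rho>)"
      then have "cmod (u - y) = \<rho>" "u \<in> cball y \<rho>" by (auto simp: frontier_cball dist_norm norm_minus_commute)
      then show "cmod (diff_quot h y u) \<le> M * \<rho> powr - (1 - \<alpha>)"
        using far[of u] cball_U \<rho> by auto
    qed (use False in \<open>auto simp: dist_norm norm_minus_commute\<close>)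
    then show ?thesis using False by (simp add: max_def)
  qed
qed

text \<open>The maximum principle in the other variable, on one of three circles around \<open>y\<close>: at most two of
  them come close to \<open>z\<close> or \<open>w\<close>.\<close>

lemma diff_quot_holder:
  assumes zw: "z \<in> U" "w \<in> U"
  shows "cmod (diff_quot h y z - diff_quot h y w)
    \<le> 18 * M * cmod (z - w) powr \<alpha> * (1 / max (cmod (z - y)) \<rho> + 1 / max (cmod (w - y)) \<rho>)"
proof -
  have M: "0 \<le> M" by (rule holder_const_nonneg[OF hM])
  obtain \<sigma> where \<sigma>: "0 < \<sigma>" "\<sigma> \<le> \<rho>" "\<rho> / 5 \<le> \<bar>cmod (z - y) - \<sigma>\<bar>" "\<rho> / 5 \<le> \<bar>cmod (w - y) - \<sigma>\<bar>"
  proof -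
    have "\<exists>\<sigma>\<in>{\<rho> / 5, 3 * \<rho> / 5, \<rho>}. \<rho> / 5 \<le> \<bar>a - \<sigma>\<bar> \<and> \<rho> / 5 \<le> \<bar>b - \<sigma>\<bar>" for a b :: real
      using \<rho> by (simp add: abs_if) argo
    from this[of "cmod (z - y)" "cmod (w - y)"] show thesis
      using that[of "\<rho> / 5"] that[of "3 * \<rho> / 5"] that[of \<rho>] \<rho> by auto
  qed
  have near_far: "1 / cmod (v - u) \<le> 6 / max (cmod (u - y)) \<rho>" "v \<noteq> u"
    if v: "cmod (v - y) = \<sigma>" and u: "\<rho> / 5 \<le> \<bar>cmod (u - y) - \<sigma>\<bar>" for v u
  proof -
    have "\<bar>cmod (u - y) - \<sigma>\<bar> \<le> cmod (v - u)"
      using norm_triangle_ineq3[of "u - y" "v - y"] v by (simp add: norm_minus_commute)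
    then have "\<rho> / 5 \<le> cmod (v - u)" "cmod (u - y) - \<rho> \<le> cmod (v - u)" using u \<sigma>(2) by auto
    \<comment> \<open>As \<rho> <= 5 |v - u|, also |u - y| <= |v - u| + \<rho> <= 6 |v - u|. With
      the 3 of \<open>holder_kernel_bound\<close> this makes the 18.\<close>
    then have "max (cmod (u - y)) \<rho> \<le> 6 * cmod (v - u)" and pos: "0 < cmod (v - u)" using \<rho> by auto
    moreover have "0 < max (cmod (u - y)) \<rho>" using \<rho> by simp
    ultimately show "1 / cmod (v - u) \<le> 6 / max (cmod (u - y)) \<rho>"
      by (simp only: divide_le_eq pos_le_divide_eq times_divide_eq_left mult_1 if_True)
    show "v \<noteq> u" using pos by auto
  qed
  define q where "q v = diff_quot h z v - diff_quot h w v" for v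
  have sub: "cball y \<sigma> \<subseteq> U" using cball_U \<sigma>(2) by auto
  have hol: "q holomorphic_on U"
    unfolding q_def using zw open_U holh
    by (intro holomorphic_intros holomorphic_diff_quot) (auto simp: interior_open)
  have "cmod (q y) \<le> 3 * M * cmod (z - w) powr \<alpha> * (6 / max (cmod (z - y)) \<rho> + 6 / max (cmod (w - y)) \<rho>)"
  proof (rule maximum_modulus_frontier[where S = "cball y \<sigma>" and f = q and \<xi> = y])
    show "q holomorphic_on interior (cball y \<sigma>)"
      using hol sub interior_subset holomorphic_on_subset by (metis order_trans)
    show "continuous_on (closure (cball y \<sigma>)) q"
      using holomorphic_on_imp_continuous_on[OF holomorphic_on_subset[OF hol sub]] by simp
    fix v assume "v \<in> frontier (cball y \<sigma>)"
    then have v: "cmod (v - y) = \<sigma>" "v \<in> cball y \<sigma>" by (auto simp: frontier_cball dist_norm norm_minus_commute)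
    then have "v \<in> U" using sub by blast
    have "cmod (q v) \<le> 3 * M * cmod (z - w) powr \<alpha> * (1 / cmod (v - z) + 1 / cmod (v - w))"
      using holder_kernel_bound[OF hM alpha_pos _ M zw \<open>v \<in> U\<close>] near_far(2)[OF v(1)] \<sigma>(3,4) alpha_less
      by (simp add: q_def diff_quot_def)
    also have "\<dots> \<le> 3 * M * cmod (z - w) powr \<alpha> * (6 / max (cmod (z - y)) \<rho> + 6 / max (cmod (w - y)) \<rho>)"
      using near_far(1)[OF v(1)] \<sigma>(3,4) M by (intro mult_left_mono add_mono) auto
    finally show "cmod (q v) \<le> 3 * M * cmod (z - w) powr \<alpha> * (6 / max (cmod (z - y)) \<rho> + 6 / max (cmod (w - y)) \<rho>)" .
  qed (use \<sigma> in auto)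
  then show ?thesis
    unfolding q_def diff_quot_commute[of h _ y] by (simp add: algebra_simps)
qed

text \<open>\<open>diff_quot_holder\<close> yields only \<open>Lip\<close>. The vanishing condition
  is purely qualitative: on the disc the quotient is Lipschitz because it is holomorphic, and away
  from \<open>y\<close> it inherits the modulus of continuity of \<open>h\<close> up to a Lipschitz
  term.\<close>

lemma diff_quot_little_lip:
  assumes h: "vanishing_holder h" and B: "\<And>z. z \<in> U \<Longrightarrow> cmod (h z) \<le> B"
  shows "diff_quot h y \<in> lip"
proof -
  define k where "k = diff_quot h y"
  have M: "0 \<le> M" by (rule holder_const_nonneg[OF hM])
  have B0: "0 \<le> B" using B[OF cball_centre_in] norm_ge_zero order_trans by blast
  have hol: "k holomorphic_on U"
    unfolding k_def using cball_centre_in open_U holh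
    by (intro holomorphic_diff_quot) (auto simp: interior_open)
  obtain L where L: "0 \<le> L" "\<And>z w. z \<in> cball y \<rho> \<Longrightarrow> w \<in> cball y \<rho> \<Longrightarrow> cmod (k z - k w) \<le> L * cmod (z - w)"
    by (rule holomorphic_lipschitz_cball[OF open_U hol cball_U]) blast
  have "holder_on \<alpha> (18 * M * (2 / \<rho>)) U k"
  proof (rule holder_onI)
    fix z w assume zw: "z \<in> U" "w \<in> U"
    have "1 / max (cmod (z - y)) \<rho> + 1 / max (cmod (w - y)) \<rho> \<le> 1 / \<rho> + 1 / \<rho>"
      using \<rho> by (intro add_mono divide_left_mono) auto
    then have "18 * M * cmod (z - w) powr \<alpha> * (1 / max (cmod (z - y)) \<rho> + 1 / max (cmod (w - y)) \<rho>)
        \<le> 18 * M * cmod (z - w) powr \<alpha> * (2 / \<rho>)"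
      using M by (intro mult_left_mono) auto
    with diff_quot_holder[OF zw]
    show "cmod (k z - k w) \<le> 18 * M * (2 / \<rho>) * cmod (z - w) powr \<alpha>"
      by (simp add: k_def mult.commute mult.left_commute)
  qed
  moreover have "cmod (k z) \<le> M * \<rho> powr - (1 - \<alpha>)" if "z \<in> U" for z
  proof -
    have "max (cmod (z - y)) \<rho> powr - (1 - \<alpha>) \<le> \<rho> powr - (1 - \<alpha>)"
      using \<rho> alpha_less by (intro powr_mono2') auto
    then show ?thesis using diff_quot_le[OF that] M mult_left_mono unfolding k_def by (meson order_trans)
  qed
  ultimately have big: "k \<in> Lip" by (rule big_lipI)
  \<comment> \<open>If one of two points closer than \<open>\<sigma>\<close> lies outside the disc
    of radius \<open>\<rho>\<close>, both stay at distance at least \<open>\<sigma>\<close> from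
    \<open>y\<close>.\<close>
  define \<sigma> where "\<sigma> = \<rho> / 2"
  have \<sigma>: "0 < \<sigma>" using \<rho> by (simp add: \<sigma>_def)
  have "vanishing_holder k"
    unfolding vanishing_holder_def
  proof (intro allI impI)
    fix e :: real assume e: "0 < e"
    \<comment> \<open>\<open>N\<close> dominates the Lipschitz constant on the disc and twice the
      coefficient 2 * B / \<sigma>^2 of the linear term off it; the 1 keeps it positive. Below
      \<open>d2\<close> a Lipschitz bound with \<open>N\<close> is a Hoelder bound with
      \<open>e\<close>.\<close>
    define N where "N = L + 4 * B / \<sigma>\<^sup>2 + 1"
    have N: "0 < N" "L \<le> N" "4 * B / \<sigma>\<^sup>2 \<le> N" using L(1) B0 \<sigma> by (auto simp: N_def add_pos_nonneg add_nonneg_pos)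
    obtain d1 where d1: "0 < d1" "\<And>z w. z \<in> U \<Longrightarrow> w \<in> U \<Longrightarrow> cmod (z - w) < d1 \<Longrightarrow>
        cmod (h z - h w) \<le> (e * \<sigma> / 2) * cmod (z - w) powr \<alpha>"
      using vanishing_holderD[OF h, of "e * \<sigma> / 2"] e \<sigma> by auto
    define d2 where "d2 = (e / N) powr (1 / (1 - \<alpha>))"
    have d2: "0 < d2" using e N by (simp add: d2_def)
    have pow: "N * cmod (z - w) \<le> e * cmod (z - w) powr \<alpha>" if "cmod (z - w) < d2" for z w :: complex
    proof -
      have "cmod (z - w) powr (1 - \<alpha>) \<le> d2 powr (1 - \<alpha>)"
        using that alpha_less by (intro powr_mono2) auto
      also have "\<dots> = e / N" using e N alpha_less by (simp add: d2_def powr_powr)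
      finally have "N * cmod (z - w) powr (1 - \<alpha>) \<le> e" using N by (simp add: field_simps)
      then have "N * cmod (z - w) powr (1 - \<alpha>) * cmod (z - w) powr \<alpha> \<le> e * cmod (z - w) powr \<alpha>"
        by (rule mult_right_mono) auto
      moreover have "cmod (z - w) powr (1 - \<alpha>) * cmod (z - w) powr \<alpha> = cmod (z - w)"
        by (simp add: powr_add[symmetric])
      ultimately show ?thesis by (simp add: mult.assoc)
    qed
    have "cmod (k z - k w) \<le> e * cmod (z - w) powr \<alpha>"
      if zw: "z \<in> U" "w \<in> U" and d: "cmod (z - w) < min \<sigma> (min d1 d2)" for z w
    proof (cases "z \<in> cball y \<rho> \<and> w \<in> cball y \<rho>")
      case True
      then have "cmod (k z - k w) \<le> N * cmod (z - w)"
        using L(2) N(2) mult_right_mono[OF N(2) norm_ge_zero] order_trans by blast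
      then show ?thesis using pow[of z w] d by simp
    next
      case False
      have far: "\<sigma> \<le> cmod (z - y)" "\<sigma> \<le> cmod (w - y)"
        using False d dist_triangle[of y w z] dist_triangle[of y z w] \<sigma>
        by (auto simp: dist_norm norm_minus_commute \<sigma>_def)
      then have ne: "z \<noteq> y" "w \<noteq> y" using \<sigma> by auto
      have split: "A / p - A' / q = (A - A') / p + A' * (q - p) / (p * q)"
        if "p \<noteq> 0" "q \<noteq> 0" for A A' p q :: complex
        using that by (simp add: field_simps)
      have "k z - k w = (h z - h w) / (z - y) + (h w - h y) * (w - z) / ((z - y) * (w - y))"
        using split[of "z - y" "w - y" "h z - h y" "h w - h y"] ne by (simp add: k_def diff_quot_def)
      then have "cmod (k z - k w) \<le> cmod ((h z - h w) / (z - y)) + cmod ((h w - h y) * (w - z) / ((z - y) * (w - y)))"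
        by (metis norm_triangle_ineq)
      also have "\<dots> = cmod (h z - h w) / cmod (z - y) + cmod (h w - h y) * cmod (z - w) / (cmod (z - y) * cmod (w - y))"
        by (simp add: norm_divide norm_mult norm_minus_commute)
      also have "\<dots> \<le> (e * \<sigma> / 2) * cmod (z - w) powr \<alpha> / \<sigma> + (2 * B) * cmod (z - w) / (\<sigma> * \<sigma>)"
      proof (intro add_mono frac_le mult_right_mono mult_mono)
        show "cmod (h z - h w) \<le> (e * \<sigma> / 2) * cmod (z - w) powr \<alpha>" using d1(2)[OF zw] d by simp
        show "cmod (h w - h y) \<le> 2 * B"
          using B[OF zw(2)] B[OF cball_centre_in] norm_triangle_ineq4[of "h w" "h y"] by simp
      qed (use far \<sigma> e B0 in auto)
      also have "(2 * B) * cmod (z - w) / (\<sigma> * \<sigma>) = (4 * B / \<sigma>\<^sup>2) * cmod (z - w) / 2"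
        by (simp add: power2_eq_square)
      also have "\<dots> \<le> (N * cmod (z - w)) / 2"
        using N(3) by (intro divide_right_mono mult_right_mono) auto
      also have "(e * \<sigma> / 2) * cmod (z - w) powr \<alpha> / \<sigma> = e * cmod (z - w) powr \<alpha> / 2"
        using \<sigma> by simp
      finally show ?thesis using pow[of z w] d by simp
    qed
    then show "\<exists>d>0. \<forall>z\<in>U. \<forall>w\<in>U. cmod (z - w) < d \<longrightarrow> cmod (k z - k w) \<le> e * cmod (z - w) powr \<alpha>"
      using \<sigma> d1(1) d2 by (intro exI[of _ "min \<sigma> (min d1 d2)"]) auto
  qed
  then show ?thesis using big by (simp add: little_lip_iff k_def)
qed

end

lemma lip_norm_sum_le:
  assumes "finite I" "\<And>i. i \<in> I \<Longrightarrow> f i \<in> Near x"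
  shows "lnorm (\<lambda>z. \<Sum>i\<in>I. f i z) \<le> (\<Sum>i\<in>I. lnorm (f i))"
  using assms
proof (induction I)
  case empty
  show ?case using lip_norm_le[OF holder_on_const[of 0 \<alpha> U 0], of 0] by simp
next
  case (insert a I)
  have "lnorm (\<lambda>z. f a z + (\<Sum>i\<in>I. f i z)) \<le> lnorm (f a) + lnorm (\<lambda>z. \<Sum>i\<in>I. f i z)"
    using insert by (intro lip_norm_triangle near_big[where x=x] near_sum) auto
  then show ?case using insert by simp
qed

end

section \<open>Taylor remainders\<close>

context bounded_derivation
begin

text \<open>The remainder with true derivatives at \<open>x\<close> in place of
  \<open>bpd_value\<close>, for functions in \<open>near\<close>; \<open>bpd_value_tendsto\<close>
  links it to \<open>taylor_remainder\<close>.\<close>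

definition taylor_rest :: "(complex \<Rightarrow> complex) \<Rightarrow> complex \<Rightarrow> complex" where
  "taylor_rest g y = g y - (\<Sum>j = 0..t. D j g / fact j * (y - x) ^ j)"

lemma D_linear_power: "D i (\<lambda>z. (z - x) ^ j) = (if i = j then fact j else 0)"
proof (cases "i = j")
  case True
  then show ?thesis by (simp add: higher_deriv_power pochhammer_fact)
next
  case False
  then show ?thesis
    by (cases "i < j") (auto simp: higher_deriv_power pochhammer_0_left)
qed

lemma near_taylor_rest:
  assumes "g \<in> near"
  shows "taylor_rest g \<in> near"
  unfolding taylor_rest_def
  by (intro near_diff near_sum near_cmult near_linear_power assms)

lemma D_taylor_rest:
  assumes g: "g \<in> near" and i: "i \<le> t"
  shows "D i (taylor_rest g) = 0"
proof -
  have "D i (taylor_rest g) = D i g - D i (\<lambda>y. \<Sum>j = 0..t. D j g / fact j * (y - x) ^ j)"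
    unfolding taylor_rest_def
    by (intro D_diff g near_sum near_cmult near_linear_power)
  also have "D i (\<lambda>y. \<Sum>j = 0..t. D j g / fact j * (y - x) ^ j)
      = (\<Sum>j = 0..t. D i (\<lambda>y. D j g / fact j * (y - x) ^ j))"
    by (intro D_sum near_cmult near_linear_power)
  also have "\<dots> = (\<Sum>j = 0..t. D j g / fact j * (if i = j then fact j else 0))"
    by (intro sum.cong refl) (simp only: D_cmult[OF near_linear_power] D_linear_power)
  also have "\<dots> = (\<Sum>j = 0..t. if i = j then D j g else 0)"
    by (intro sum.cong) auto
  also have "\<dots> = D i g" using i by simp
  finally show ?thesis by simp
qed

lemma taylor_rest_cmult:
  assumes "g \<in> near"
  shows "taylor_rest (\<lambda>z. c * g z) y = c * taylor_rest g y"
  by (simp add: taylor_rest_def D_cmult[OF assms] right_diff_distrib sum_distrib_left mult.assoc)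

text \<open>The derivations of order at most \<open>t\<close> bound the Taylor coefficients on the
  unit ball. The resulting \<open>M\<close> is the common Hoelder constant that allows remainders of
  different functions to be superposed.\<close>

lemma taylor_rest_bounds:
  obtains M where "0 < M" "\<And>g. g \<in> near \<Longrightarrow> lnorm g \<le> 1 \<Longrightarrow> lnorm (taylor_rest g) \<le> M"
proof -
  obtain C where C: "0 \<le> C" "\<And>j f. j \<le> t \<Longrightarrow> f \<in> near \<Longrightarrow> cmod (D j f) \<le> C * lnorm f"
    by (rule derivation_bounds) blast
  define L where "L j = lnorm (\<lambda>z. (z - x) ^ j)" for j
  have L: "0 \<le> L j" for j
    unfolding L_def by (intro lip_norm_nonneg near_big[OF near_linear_power])
  define M where "M = 1 + (\<Sum>j = 0..t. C * L j)"
  have "0 < M" using C(1) L by (simp add: M_def add_pos_nonneg sum_nonneg)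
  moreover have "lnorm (taylor_rest g) \<le> M" if g: "g \<in> near" "lnorm g \<le> 1" for g
  proof -
    define p where "p j z = (- (D j g / fact j)) * (z - x) ^ j" for j z
    have p: "p j \<in> near" for j unfolding p_def by (intro near_cmult near_linear_power)
    have pn: "lnorm (p j) \<le> C * L j" if j: "j \<le> t" for j
    proof -
      have "lnorm (p j) \<le> cmod (- (D j g / fact j)) * L j"
        unfolding p_def L_def by (intro lip_norm_cmult_le near_big[OF near_linear_power])
      also have "\<dots> \<le> C * L j"
      proof (rule mult_right_mono[OF _ L])
        have "cmod (D j g) / fact j \<le> cmod (D j g) / 1"
          by (intro divide_left_mono fact_ge_1) auto
        also have "\<dots> \<le> C * lnorm g" using C(2)[OF j g(1)] by simp
        also have "\<dots> \<le> C * 1" using g(2) C(1) by (rule mult_left_mono)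
        finally show "cmod (- (D j g / fact j)) \<le> C" by (simp add: norm_divide)
      qed
      finally show ?thesis .
    qed
    have "taylor_rest g = (\<lambda>z. g z + (\<Sum>j = 0..t. p j z))"
      by (auto simp: taylor_rest_def p_def sum_negf)
    then have "lnorm (taylor_rest g) \<le> lnorm g + lnorm (\<lambda>z. \<Sum>j = 0..t. p j z)"
      using lip_norm_triangle[OF near_big[OF g(1)] near_big[OF near_sum[OF p]]] by simp
    also have "\<dots> \<le> 1 + (\<Sum>j = 0..t. lnorm (p j))"
      using g(2) lip_norm_sum_le[where I = "{0..t}" and f = p and x = x] p by (intro add_mono) auto
    also have "\<dots> \<le> M" unfolding M_def using pn by (intro add_mono sum_mono) auto
    finally show ?thesis .
  qed
  ultimately show thesis using that by blast
qed

lemma near_diff_quot: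
  assumes h: "h \<in> near" and y: "y \<in> U"
  shows "diff_quot h y \<in> near"
proof -
  obtain \<rho> where \<rho>: "0 < \<rho>" "cball y \<rho> \<subseteq> U" using open_U y open_contains_cball by blast
  have little: "diff_quot h y \<in> lip"
  proof (rule diff_quot_little_lip[OF near_holomorphic[OF h] holder_on_lip_norm[OF near_big[OF h]] \<rho>])
    show "vanishing_holder h" using near_little[OF h] by (simp add: little_lip_iff)
    show "cmod (h z) \<le> lnorm h" if "z \<in> U" for z using near_big[OF h] that by (rule norm_le_lip_norm)
  qed
  obtain V where V: "open V" "U \<union> {x} \<subseteq> V" "h holomorphic_on V"
    using h by (auto simp: analytic_near_space_def analytic_on_holomorphic)
  have "diff_quot h y holomorphic_on V"
    using V y by (intro holomorphic_diff_quot) (auto simp: interior_open)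
  then have "diff_quot h y analytic_on U \<union> {x}"
    using V analytic_on_holomorphic by blast
  with little show ?thesis by (simp add: analytic_near_space_def)
qed

text \<open>Differentiate (z - y) * k z = h z - h y at \<open>x\<close>. The right side contributes
  nothing in orders 1 to \<open>t\<close>, which leaves (y - x) * D (n + 1) k = (n + 1) * D n k,
  with starting value h y / (y - x).\<close>

lemma D_diff_quot:
  assumes h: "h \<in> near" and y: "y \<in> U" and zero: "\<And>i. i \<le> t \<Longrightarrow> D i h = 0" and n: "n \<le> t"
  shows "D n (diff_quot h y) = fact n * h y / (y - x) ^ Suc n"
proof -
  define k where "k = diff_quot h y"
  have k: "k \<in> near" unfolding k_def using h y by (rule near_diff_quot)
  have yx: "y \<noteq> x" using y x_notin_U by auto
  have mult: "(\<lambda>z. (z - y) * k z) = (\<lambda>z. - h y + h z)"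
    by (auto simp: k_def diff_quot_def)
  have "D n k = fact n * h y / (y - x) ^ Suc n"
    using n
  proof (induction n)
    case 0
    have "k x = - h y / (x - y)" using zero[of 0] yx by (simp add: k_def diff_quot_def)
    also have "\<dots> = h y / (y - x)" using minus_divide_divide[of "h y" "y - x"] by simp
    finally show ?case by simp
  next
    case (Suc n)
    have "(x - y) * D (Suc n) k + of_nat (Suc n) * D n k = D (Suc n) (\<lambda>z. - h y + h z)"
      using higher_deriv_linear_mult[OF near_analytic_at[OF k], of n y] mult by simp
    also have "\<dots> = D (Suc n) h" by (rule higher_deriv_const_add[OF near_analytic_at[OF h]])
    also have "\<dots> = 0" using Suc.prems by (intro zero)
    finally have "(y - x) * D (Suc n) k = of_nat (Suc n) * D n k"
      by (simp add: algebra_simps del: funpow.simps)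
    then have "D (Suc n) k = of_nat (Suc n) * D n k / (y - x)"
      using yx by (simp add: nonzero_eq_divide_eq mult.commute del: funpow.simps)
    also have "\<dots> = fact (Suc n) * h y / (y - x) ^ Suc (Suc n)"
      using Suc.IH Suc.prems by (simp add: mult_ac)
    finally show ?case .
  qed
  then show ?thesis by (simp add: k_def)
qed

text \<open>The strict inequality makes every member open, so this uncountable union is measurable.
  Homogeneity reduces all of \<open>near\<close> to the unit ball, see
  \<open>taylor_rest_good\<close>.\<close>

definition bad_set :: "real \<Rightarrow> complex set" where
  "bad_set \<epsilon> = (\<Union>g\<in>{g \<in> near. lnorm g \<le> 1}.
     {y \<in> U. \<epsilon> * cmod (y - x) ^ t < cmod (taylor_rest g y)})"

lemma bad_set_subset: "bad_set \<epsilon> \<subseteq> U"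
  by (auto simp: bad_set_def)

lemma open_bad_set: "open (bad_set \<epsilon>)"
  unfolding bad_set_def
proof (intro open_UN ballI)
  fix g assume "g \<in> {g \<in> near. lnorm g \<le> 1}"
  then have "taylor_rest g holomorphic_on U" by (intro near_holomorphic[where x = x] near_taylor_rest) auto
  then have "continuous_on U (taylor_rest g)" by (rule holomorphic_on_imp_continuous_on)
  then have "continuous_on U (\<lambda>y. cmod (taylor_rest g y) - \<epsilon> * cmod (y - x) ^ t)"
    by (intro continuous_intros)
  from this[unfolded continuous_on_open_vimage[OF open_U], rule_format, OF open_greaterThan]
  have "open ((\<lambda>y. cmod (taylor_rest g y) - \<epsilon> * cmod (y - x) ^ t) -` {0<..} \<inter> U)" .
  moreover have "(\<lambda>y. cmod (taylor_rest g y) - \<epsilon> * cmod (y - x) ^ t) -` {0<..} \<inter> U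
      = {y \<in> U. \<epsilon> * cmod (y - x) ^ t < cmod (taylor_rest g y)}" by auto
  ultimately show "open {y \<in> U. \<epsilon> * cmod (y - x) ^ t < cmod (taylor_rest g y)}" by simp
qed

lemma bad_set_density:
  assumes \<epsilon>: "0 < \<epsilon>" and c: "0 < c"
  shows "\<exists>r0>0. \<forall>r. 0 < r \<and> r < r0 \<longrightarrow> measure lborel (ball x r \<inter> bad_set \<epsilon>) < c * r\<^sup>2"
proof (rule ccontr)
  assume not: "\<not> ?thesis"
  have ex: "\<exists>r. 0 < r \<and> r < r0 \<and> c * r\<^sup>2 \<le> measure lborel (ball x r \<inter> bad_set \<epsilon>)" if "0 < r0" for r0
    using not that by (meson not_le)
  define s where "s = sqrt (c / (2 * pi))"
  have s: "0 < s" "pi * s\<^sup>2 = c / 2" using c by (auto simp: s_def)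
  obtain M where M: "0 < M"
    "\<And>g. g \<in> near \<Longrightarrow> lnorm g \<le> 1 \<Longrightarrow> lnorm (taylor_rest g) \<le> M"
    by (rule taylor_rest_bounds) blast
  have R: "0 < riesz_const 1" "0 < riesz_const (1 - \<alpha>)"
    using riesz_const_pos alpha_pos alpha_less by auto
  \<comment> \<open>144 = 18 * (4 + 4): the 18 from \<open>diff_quot_holder\<close>, and a 4 from
    \<open>sum_ball_riesz_le\<close> for each of the two points.\<close>
  define K where "K = 144 * M * riesz_const 1"
  \<comment> \<open>At least c / 2 * r^2 of area is left after removing the small disc, the packing
    keeps half of it, and area enters \<open>D t\<close> with the factor \<epsilon> / (pi *
    r^2).\<close>
  define c' where "c' = \<epsilon> * (c / (4 * pi))"
  have "\<exists>F\<in>near. (\<forall>z\<in>U. cmod (F z) \<le> \<eta>) \<and> holder_on \<alpha> K U F \<and> c' \<le> Re (D t F)"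
    if \<eta>: "0 < \<eta>" for \<eta>
  proof -
    \<comment> \<open>\<open>Q * r powr \<alpha>\<close> will bound \<open>F\<close>; this decides
      how small \<open>r\<close> is chosen.\<close>
    define Q where "Q = 4 * M * riesz_const (1 - \<alpha>)"
    have Q: "0 < Q" using M R by (simp add: Q_def)
    obtain r where r: "0 < r" "r < (\<eta> / Q) powr (1 / \<alpha>)"
      "c * r\<^sup>2 \<le> measure lborel (ball x r \<inter> bad_set \<epsilon>)"
      using ex[of "(\<eta> / Q) powr (1 / \<alpha>)"] \<eta> Q by auto
    have rQ: "Q * r powr \<alpha> \<le> \<eta>"
    proof -
      have "r powr \<alpha> \<le> ((\<eta> / Q) powr (1 / \<alpha>)) powr \<alpha>"
        using r alpha_pos by (intro powr_mono2) auto
      also have "\<dots> = \<eta> / Q" using alpha_pos \<eta> Q by (simp add: powr_powr)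
      finally show ?thesis using Q by (simp add: field_simps)
    qed
    define \<Omega> where "\<Omega> = ball x r \<inter> bad_set \<epsilon> - cball x (s * r)"
    have \<Omega>: "open \<Omega>" "bounded \<Omega>" "\<Omega> \<in> sets borel"
      using open_bad_set by (auto simp: \<Omega>_def intro!: open_Diff bounded_subset[OF bounded_ball[of x r]])
    have m\<Omega>: "c / 2 * r\<^sup>2 \<le> measure lborel \<Omega>"
    proof -
      have "measure lborel (ball x r \<inter> bad_set \<epsilon>) \<le> measure lborel (\<Omega> \<union> cball x (s * r))"
      proof (rule measure_mono_fmeasurable)
        show "\<Omega> \<union> cball x (s * r) \<in> fmeasurable lborel"
          using \<Omega> s r emeasure_bounded_finite[OF \<Omega>(2)]
          by (intro fmeasurable.Un fmeasurableI) (auto simp: emeasure_cball)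
      qed (use open_bad_set in \<open>auto simp: \<Omega>_def\<close>)
      also have "\<dots> \<le> measure lborel \<Omega> + measure lborel (cball x (s * r))"
        using \<Omega> by (intro measure_Un_le) auto
      also have "measure lborel (cball x (s * r)) = c / 2 * r\<^sup>2"
        using s r by (simp add: content_cball unit_ball_vol_2 power_mult_distrib)
      finally show ?thesis using r(3) by linarith
    qed
    moreover have "0 < c / 2 * r\<^sup>2" using c r by simp
    ultimately have \<Omega>_pos: "0 < measure lborel \<Omega>" by linarith
    obtain I :: "(complex \<times> real) set" where I: "finite I"
      "\<And>p. p \<in> I \<Longrightarrow> 0 < snd p" "\<And>p. p \<in> I \<Longrightarrow> cball (fst p) (snd p) \<subseteq> \<Omega>"
      "pairwise (\<lambda>p q. disjnt (cball (fst p) (snd p)) (cball (fst q) (snd q))) I"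
      "measure lborel \<Omega> / 2 \<le> (\<Sum>p\<in>I. pi * (snd p)\<^sup>2)"
      by (rule finite_ball_packing[OF \<Omega>(1,2) \<Omega>_pos]) blast
    have I_centre: "fst p \<in> \<Omega>" if "p \<in> I" for p
      using I(2,3)[OF that] by (meson centre_in_cball less_imp_le subsetD)
    have "\<exists>g. g \<in> near \<and> lnorm g \<le> 1 \<and> \<epsilon> * cmod (fst p - x) ^ t < cmod (taylor_rest g (fst p))"
      if "p \<in> I" for p
    proof -
      have "fst p \<in> bad_set \<epsilon>" using I_centre[OF that] by (simp add: \<Omega>_def)
      then show ?thesis unfolding bad_set_def by blast
    qed
    then obtain g where g: "\<And>p. p \<in> I \<Longrightarrow> g p \<in> near" "\<And>p. p \<in> I \<Longrightarrow> lnorm (g p) \<le> 1"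
      "\<And>p. p \<in> I \<Longrightarrow> \<epsilon> * cmod (fst p - x) ^ t < cmod (taylor_rest (g p) (fst p))"
      by metis
    define h where "h p = taylor_rest (g p)" for p
    have h: "h p \<in> near" "lnorm (h p) \<le> M" if "p \<in> I" for p
      using g[OF that] M(2) near_taylor_rest by (auto simp: h_def)
    have hM: "holder_on \<alpha> M U (h p)" if "p \<in> I" for p
      using holder_on_lip_norm[OF near_big[OF h(1)[OF that]]] h(2)[OF that] by (rule holder_on_mono)
    have \<Omega>U: "\<Omega> \<subseteq> U" using bad_set_subset by (auto simp: \<Omega>_def)
    have cU: "cball (fst p) (snd p) \<subseteq> U" if "p \<in> I" for p using I(3)[OF that] \<Omega>U by blast
    define k where "k p = diff_quot (h p) (fst p)" for p
    have k: "k p \<in> near" if "p \<in> I" for p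
      unfolding k_def using h(1)[OF that] I_centre[OF that] \<Omega>U by (intro near_diff_quot) auto
    define \<tau> where "\<tau> p = D t (k p)" for p
    have \<tau>: "\<epsilon> \<le> r * cmod (\<tau> p)" if p: "p \<in> I" for p
    proof -
      have y: "fst p \<in> U" "cmod (fst p - x) \<le> r"
        using I_centre[OF p] \<Omega>U by (auto simp: \<Omega>_def dist_norm norm_minus_commute)
      have y0: "0 < cmod (fst p - x)" using y(1) x_notin_U by auto
      have "\<tau> p = fact t * h p (fst p) / (fst p - x) ^ Suc t"
        unfolding \<tau>_def k_def using h(1)[OF p] y(1) D_taylor_rest[OF g(1)[OF p]]
        by (intro D_diff_quot) (auto simp: h_def)
      then have "cmod (\<tau> p) = fact t * (cmod (h p (fst p)) / cmod (fst p - x) ^ Suc t)"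
        by (simp add: norm_divide norm_mult norm_power)
      also have "\<dots> \<ge> 1 * (cmod (h p (fst p)) / cmod (fst p - x) ^ Suc t)"
        by (intro mult_right_mono fact_ge_1) auto
      finally have "cmod (h p (fst p)) / cmod (fst p - x) ^ Suc t \<le> cmod (\<tau> p)" by simp
      moreover have "\<epsilon> * cmod (fst p - x) ^ t / cmod (fst p - x) ^ Suc t \<le> cmod (h p (fst p)) / cmod (fst p - x) ^ Suc t"
        using g(3)[OF p] by (intro divide_right_mono) (auto simp: h_def)
      moreover have "\<epsilon> * cmod (fst p - x) ^ t / cmod (fst p - x) ^ Suc t = \<epsilon> / cmod (fst p - x)"
        using y0 by simp
      ultimately have "\<epsilon> / cmod (fst p - x) \<le> cmod (\<tau> p)" by linarith
      then have "\<epsilon> \<le> cmod (fst p - x) * cmod (\<tau> p)" using y0 by (simp add: field_simps)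
      also have "\<dots> \<le> r * cmod (\<tau> p)" using y by (intro mult_right_mono) auto
      finally show ?thesis .
    qed
    have \<tau>0: "\<tau> p \<noteq> 0" if "p \<in> I" for p using \<tau>[OF that] \<epsilon> by auto
    \<comment> \<open>The phase conjugate to that of \<open>\<tau> p\<close> makes all contributions
      to \<open>D t\<close> positive, so that none cancel; the modulus is the area scale of the disc
      over \<open>r\<close>.\<close>
    define v where "v p = of_real ((snd p)\<^sup>2 / r) * (cnj (\<tau> p) / of_real (cmod (\<tau> p)))" for p
    have v: "cmod (v p) = (snd p)\<^sup>2 / r" if "p \<in> I" for p
    proof -
      have "cmod (v p) = \<bar>(snd p)\<^sup>2 / r\<bar> * (cmod (\<tau> p) / \<bar>cmod (\<tau> p)\<bar>)"
        unfolding v_def by (simp only: norm_mult norm_divide norm_of_real complex_mod_cnj)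
      then show ?thesis using \<tau>0[OF that] r by simp
    qed
    define F where "F z = (\<Sum>p\<in>I. v p * k p z)" for z
    have F: "F \<in> near" unfolding F_def by (intro near_sum near_cmult k)
    have rr: "cball (fst p) (snd p) \<subseteq> cball x r" if "p \<in> I" for p
      using I(3)[OF that] by (auto simp: \<Omega>_def)
    have riesz: "(\<Sum>p\<in>I. (snd p)\<^sup>2 * max (cmod (z - fst p)) (snd p) powr - q) \<le> 4 * riesz_const q * r powr (2 - q)"
      if "0 \<le> q" "q < 2" for q z
      using sum_ball_riesz_le[OF that r(1) I(1,2) rr I(4)] .
    have "cmod (F z) \<le> \<eta>" if z: "z \<in> U" for z
    proof -
      have "cmod (F z) \<le> (\<Sum>p\<in>I. cmod (v p * k p z))" unfolding F_def by (rule norm_sum)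
      also have "\<dots> \<le> (\<Sum>p\<in>I. M / r * ((snd p)\<^sup>2 * max (cmod (z - fst p)) (snd p) powr - (1 - \<alpha>)))"
      proof (rule sum_mono)
        fix p assume p: "p \<in> I"
        have "cmod (k p z) \<le> M * max (cmod (z - fst p)) (snd p) powr - (1 - \<alpha>)"
          unfolding k_def
          by (rule diff_quot_le[OF near_holomorphic[OF h(1)[OF p]] hM[OF p] I(2)[OF p] cU[OF p] z])
        then have "cmod (v p) * cmod (k p z) \<le> (snd p)\<^sup>2 / r * (M * max (cmod (z - fst p)) (snd p) powr - (1 - \<alpha>))"
          unfolding v[OF p] using r by (intro mult_left_mono) auto
        then show "cmod (v p * k p z) \<le> M / r * ((snd p)\<^sup>2 * max (cmod (z - fst p)) (snd p) powr - (1 - \<alpha>))"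
          by (simp add: norm_mult mult_ac)
      qed
      also have "\<dots> \<le> M / r * (4 * riesz_const (1 - \<alpha>) * r powr (2 - (1 - \<alpha>)))"
        unfolding sum_distrib_left[symmetric] using M r alpha_pos alpha_less
        by (intro mult_left_mono riesz) auto
      also have "\<dots> = Q * r powr \<alpha>"
        using r by (simp add: Q_def powr_add)
      finally show ?thesis using rQ by simp
    qed
    moreover have "holder_on \<alpha> K U F"
    proof (rule holder_onI)
      fix z w assume zw: "z \<in> U" "w \<in> U"
      define \<delta> where "\<delta> = cmod (z - w) powr \<alpha>"
      have inv: "1 / max a b = max a b powr - 1" if "0 < b" for a b :: real
        using that by (simp add: powr_minus_divide)
      have "F z - F w = (\<Sum>p\<in>I. v p * (k p z - k p w))"
        by (simp add: F_def sum_subtractf right_diff_distrib)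
      then have "cmod (F z - F w) \<le> (\<Sum>p\<in>I. cmod (v p * (k p z - k p w)))" by (simp add: norm_sum)
      also have "\<dots> \<le> (\<Sum>p\<in>I. 18 * M * \<delta> / r * ((snd p)\<^sup>2 * max (cmod (z - fst p)) (snd p) powr - 1
          + (snd p)\<^sup>2 * max (cmod (w - fst p)) (snd p) powr - 1))"
      proof (rule sum_mono)
        fix p assume p: "p \<in> I"
        have "cmod (k p z - k p w) \<le> 18 * M * \<delta> * (1 / max (cmod (z - fst p)) (snd p) + 1 / max (cmod (w - fst p)) (snd p))"
          unfolding k_def \<delta>_def
          by (rule diff_quot_holder[OF near_holomorphic[OF h(1)[OF p]] hM[OF p] I(2)[OF p] cU[OF p] zw])
        also have "\<dots> = 18 * M * \<delta> * (max (cmod (z - fst p)) (snd p) powr - 1 + max (cmod (w - fst p)) (snd p) powr - 1)"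
          by (simp only: inv[OF I(2)[OF p]])
        finally have "cmod (v p) * cmod (k p z - k p w)
            \<le> (snd p)\<^sup>2 / r * (18 * M * \<delta> * (max (cmod (z - fst p)) (snd p) powr - 1 + max (cmod (w - fst p)) (snd p) powr - 1))"
          unfolding v[OF p] using r by (intro mult_left_mono) auto
        also have "\<dots> = 18 * M * \<delta> / r * ((snd p)\<^sup>2 * max (cmod (z - fst p)) (snd p) powr - 1
            + (snd p)\<^sup>2 * max (cmod (w - fst p)) (snd p) powr - 1)"
          by (simp add: algebra_simps)
        finally show "cmod (v p * (k p z - k p w))
            \<le> 18 * M * \<delta> / r * ((snd p)\<^sup>2 * max (cmod (z - fst p)) (snd p) powr - 1
            + (snd p)\<^sup>2 * max (cmod (w - fst p)) (snd p) powr - 1)" by (simp only: norm_mult)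
      qed
      also have "\<dots> \<le> 18 * M * \<delta> / r * (4 * riesz_const 1 * r powr (2 - 1) + 4 * riesz_const 1 * r powr (2 - 1))"
        unfolding sum_distrib_left[symmetric] sum.distrib using M r
        by (intro mult_left_mono add_mono riesz) (auto simp: \<delta>_def)
      also have "\<dots> = K * \<delta>" using r by (simp add: K_def)
      finally show "cmod (F z - F w) \<le> K * cmod (z - w) powr \<alpha>" by (simp add: \<delta>_def)
    qed
    moreover have "c' \<le> Re (D t F)"
    proof -
      have "D t F = (\<Sum>p\<in>I. v p * \<tau> p)"
        unfolding F_def \<tau>_def using k by (subst D_sum) (auto intro!: near_cmult sum.cong D_cmult)
      also have "\<dots> = (\<Sum>p\<in>I. of_real ((snd p)\<^sup>2 / r * cmod (\<tau> p)))"
      proof (rule sum.cong)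
        fix p assume p: "p \<in> I"
        have "cnj (\<tau> p) * \<tau> p = of_real (cmod (\<tau> p)) * of_real (cmod (\<tau> p))"
          using complex_norm_square[of "\<tau> p"] by (simp add: power2_eq_square mult.commute)
        then have "cnj (\<tau> p) / of_real (cmod (\<tau> p)) * \<tau> p = of_real (cmod (\<tau> p))"
          using \<tau>0[OF p] by (simp add: divide_simps)
        then show "v p * \<tau> p = of_real ((snd p)\<^sup>2 / r * cmod (\<tau> p))"
          by (simp only: v_def mult.assoc of_real_mult)
      qed simp
      finally have "Re (D t F) = (\<Sum>p\<in>I. (snd p)\<^sup>2 / r * cmod (\<tau> p))"
        by (simp add: Re_sum)
      also have "\<dots> \<ge> (\<Sum>p\<in>I. \<epsilon> / (pi * r\<^sup>2) * (pi * (snd p)\<^sup>2))"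
      proof (rule sum_mono)
        fix p assume p: "p \<in> I"
        have "\<epsilon> / (pi * r\<^sup>2) * (pi * (snd p)\<^sup>2) = (snd p)\<^sup>2 / r * (\<epsilon> / r)"
          by (simp add: power2_eq_square)
        also have "\<dots> \<le> (snd p)\<^sup>2 / r * cmod (\<tau> p)"
          using \<tau>[OF p] r by (intro mult_left_mono) (auto simp: field_simps)
        finally show "\<epsilon> / (pi * r\<^sup>2) * (pi * (snd p)\<^sup>2) \<le> (snd p)\<^sup>2 / r * cmod (\<tau> p)" .
      qed
      finally have "\<epsilon> / (pi * r\<^sup>2) * (\<Sum>p\<in>I. pi * (snd p)\<^sup>2) \<le> Re (D t F)"
        by (simp only: sum_distrib_left)
      moreover have "\<epsilon> / (pi * r\<^sup>2) * (c / 4 * r\<^sup>2) \<le> \<epsilon> / (pi * r\<^sup>2) * (\<Sum>p\<in>I. pi * (snd p)\<^sup>2)"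
        using m\<Omega> I(5) \<epsilon> by (intro mult_left_mono) auto
      moreover have "\<epsilon> / (pi * r\<^sup>2) * (c / 4 * r\<^sup>2) = c'" using r by (simp add: c'_def)
      ultimately show ?thesis by linarith
    qed
    ultimately show ?thesis using F by blast
  qed
  then show False
    using no_uniformly_small_humps[of K c'] M R \<epsilon> c by (simp add: K_def c'_def)
qed

section \<open>The good set and its density at \<open>x\<close>\<close>

definition good_set :: "real \<Rightarrow> complex set" where
  "good_set \<epsilon> = U - bad_set \<epsilon>"

text \<open>Scaling by some \<open>N\<close> above the norm and letting \<open>N\<close> decrease to
  it also covers functions of norm 0.\<close>

lemma taylor_rest_good:
  assumes \<epsilon>: "0 < \<epsilon>" and y: "y \<in> good_set \<epsilon>" and g: "g \<in> near"
  shows "cmod (taylor_rest g y) \<le> \<epsilon> * cmod (y - x) ^ t * lnorm g"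
proof -
  have nn: "0 \<le> lnorm g" using near_big[OF g] by (rule lip_norm_nonneg)
  define A where "A = \<epsilon> * cmod (y - x) ^ t"
  have scaled: "cmod (taylor_rest g y) \<le> A * N" if N: "lnorm g < N" for N
  proof -
    define c where "c = complex_of_real (1 / N)"
    have Npos: "0 < N" using nn N by simp
    have cg: "(\<lambda>z. c * g z) \<in> near" using g by (rule near_cmult)
    have "lnorm (\<lambda>z. c * g z) \<le> cmod c * lnorm g"
      by (rule lip_norm_cmult_le[OF near_big[OF g]])
    also have "\<dots> \<le> 1" using N Npos by (simp add: c_def norm_divide divide_le_eq)
    finally have "cmod (taylor_rest (\<lambda>z. c * g z) y) \<le> A"
      using y cg unfolding good_set_def bad_set_def A_def by fastforce
    then have "cmod (taylor_rest g y) / N \<le> A"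
      unfolding taylor_rest_cmult[OF g] using Npos by (simp add: norm_mult norm_divide c_def)
    then show ?thesis using Npos by (simp add: divide_le_eq)
  qed
  have "cmod (taylor_rest g y) \<le> A * lnorm g"
  proof (rule tendsto_lowerbound[where F = "at_right (lnorm g)"])
    show "((\<lambda>N. A * N) \<longlongrightarrow> A * lnorm g) (at_right (lnorm g))"
      by (intro tendsto_intros)
    show "eventually (\<lambda>N. cmod (taylor_rest g y) \<le> A * N) (at_right (lnorm g))"
      unfolding eventually_at_right_field using scaled gt_ex by blast
  qed simp
  then show ?thesis by (simp add: A_def)
qed

lemma full_area_density_good_set:
  assumes \<epsilon>: "0 < \<epsilon>"
  shows "full_area_density (good_set \<epsilon>) x"
  unfolding full_area_density_def
proof
  have E: "good_set \<epsilon> \<in> sets borel" using open_U open_bad_set by (simp add: good_set_def)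
  then show "good_set \<epsilon> \<in> sets lebesgue" by simp
  show "((\<lambda>r. measure lebesgue (ball x r \<inter> good_set \<epsilon>) / measure lebesgue (ball x r)) \<longlongrightarrow> 1) (at_right 0)"
  proof (rule tendstoI)
    fix e :: real assume e: "0 < e"
    \<comment> \<open>Each of the two exceptional sets takes less than the fraction e / 2 of the
      area pi * r^2.\<close>
    define c where "c = e * pi / 2"
    have c: "0 < c" using e by (simp add: c_def)
    obtain r1 where r1: "0 < r1" "\<And>r. 0 < r \<Longrightarrow> r < r1 \<Longrightarrow> measure lborel (ball x r - U) < c * r\<^sup>2"
      using complement_density[OF c] by blast
    obtain r2 where r2: "0 < r2" "\<And>r. 0 < r \<Longrightarrow> r < r2 \<Longrightarrow> measure lborel (ball x r \<inter> bad_set \<epsilon>) < c * r\<^sup>2"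
      using bad_set_density[OF \<epsilon> c] by blast
    have "dist (measure lebesgue (ball x r \<inter> good_set \<epsilon>) / measure lebesgue (ball x r)) 1 < e"
      if r: "0 < r" "r < min r1 r2" for r
    proof -
      define m where "m = measure lborel (ball x r \<inter> good_set \<epsilon>)"
      have ball: "measure lborel (ball x r) = pi * r\<^sup>2" using r by (simp add: content_ball unit_ball_vol_2)
      have fin: "S \<in> fmeasurable lborel" if "S \<in> sets borel" "S \<subseteq> ball x r" for S
        using that emeasure_bounded_finite[OF bounded_subset[OF bounded_ball that(2)]]
        by (intro fmeasurableI) auto
      have "m \<le> pi * r\<^sup>2"
        unfolding m_def ball[symmetric] using E by (intro measure_mono_fmeasurable fin) auto
      moreover have "pi * r\<^sup>2 - m < e * (pi * r\<^sup>2)"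
      proof -
        have sets: "ball x r \<inter> good_set \<epsilon> \<in> sets borel" "ball x r - U \<in> sets borel" "ball x r \<inter> bad_set \<epsilon> \<in> sets borel"
          using E open_U open_bad_set by auto
        have "measure lborel (ball x r)
            \<le> measure lborel ((ball x r \<inter> good_set \<epsilon>) \<union> ((ball x r - U) \<union> (ball x r \<inter> bad_set \<epsilon>)))"
          using sets by (intro measure_mono_fmeasurable fin) (auto simp: good_set_def)
        also have "\<dots> \<le> m + measure lborel ((ball x r - U) \<union> (ball x r \<inter> bad_set \<epsilon>))"
          unfolding m_def using sets by (intro measure_Un_le) auto
        also have "\<dots> \<le> m + (measure lborel (ball x r - U) + measure lborel (ball x r \<inter> bad_set \<epsilon>))"
          using sets by (intro add_left_mono measure_Un_le) auto
        finally show ?thesis using r1(2)[of r] r2(2)[of r] r ball by (simp add: c_def)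
      qed
      moreover have "0 < pi * r\<^sup>2" using r by simp
      ultimately have "\<bar>m / (pi * r\<^sup>2) - 1\<bar> < e"
        by (simp add: abs_less_iff divide_simps) (auto simp: algebra_simps)
      then show ?thesis using E by (simp add: dist_real_def ball m_def)
    qed
    then show "eventually (\<lambda>r. dist (measure lebesgue (ball x r \<inter> good_set \<epsilon>) / measure lebesgue (ball x r)) 1 < e) (at_right 0)"
      unfolding eventually_at_right_field using r1(1) r2(1) by (intro exI[of _ "min r1 r2"]) auto
  qed
qed

section \<open>Passage to the limit in \<open>analytic_lip_space\<close>\<close>

lemma near_sequence:
  assumes f: "f \<in> analytic_lip_space \<alpha> U"
  obtains g where "\<And>k. g k \<in> near" "(\<lambda>k::nat. lnorm (\<lambda>z. g k z - f z)) \<longlonglongrightarrow> 0"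
proof -
  have "\<exists>g. g \<in> near \<and> lnorm (\<lambda>z. g z - f z) \<le> 1 / real (Suc k)" for k
    using near_dense[OF x_frontier f, of "1 / real (Suc k)"] by auto
  then obtain g where g: "\<And>k. g k \<in> near" "\<And>k. lnorm (\<lambda>z. g k z - f z) \<le> 1 / real (Suc k)"
    by metis
  have f_big: "f \<in> Lip" using f by (simp add: analytic_lip_space_def little_lip_imp_big)
  have diff_big: "(\<lambda>z. g k z - f z) \<in> Lip" for k
    by (rule big_lip_diff[OF near_big[OF g(1)] f_big])
  have "(\<lambda>k. lnorm (\<lambda>z. g k z - f z)) \<longlonglongrightarrow> 0"
  proof (rule tendsto_sandwich[OF _ _ tendsto_const LIMSEQ_Suc[OF lim_const_over_n[of 1]]])
    show "eventually (\<lambda>k. 0 \<le> lnorm (\<lambda>z. g k z - f z)) sequentially"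
      by (intro always_eventually allI lip_norm_nonneg diff_big)
    show "eventually (\<lambda>k. lnorm (\<lambda>z. g k z - f z) \<le> 1 / real (Suc k)) sequentially"
      using g(2) by simp
  qed
  then show thesis using that g(1) by blast
qed

text \<open>Boundedness of the derivation makes the values a Cauchy sequence, and comparing two
  approximating sequences shows that the limit is unique, which justifies \<open>THE\<close>. In
  order 0 uniform approximation on \<open>U\<close> identifies the limit with the boundary value of
  \<open>f\<close>.\<close>

lemma bpd_value_tendsto:
  assumes f: "f \<in> analytic_lip_space \<alpha> U" and g: "\<And>k. g k \<in> near"
    and lim: "(\<lambda>k::nat. lnorm (\<lambda>z. g k z - f z)) \<longlonglongrightarrow> 0" and j: "j \<le> t"
  shows "(\<lambda>k. D j (g k)) \<longlonglongrightarrow> bpd_value \<alpha> U x j f"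
proof -
  have f_big: "f \<in> Lip" using f by (simp add: analytic_lip_space_def little_lip_imp_big)
  have diff_big: "(\<lambda>z. g z - f z) \<in> Lip" "(\<lambda>z. f z - g z) \<in> Lip" if "g \<in> near" for g
    by (intro big_lip_diff near_big[OF that] f_big)+
  obtain C where C: "0 \<le> C" "\<And>j f. j \<le> t \<Longrightarrow> f \<in> near \<Longrightarrow> cmod (D j f) \<le> C * lnorm f"
    by (rule derivation_bounds) blast
  have close: "cmod (D j g - D j g') \<le> C * (lnorm (\<lambda>z. g z - f z) + lnorm (\<lambda>z. g' z - f z))"
    if gg: "g \<in> near" "g' \<in> near" for g g'
  proof -
    have "cmod (D j g - D j g') = cmod (D j (\<lambda>z. g z - g' z))" using gg by (simp add: D_diff)
    also have "\<dots> \<le> C * lnorm (\<lambda>z. g z - g' z)" using j gg by (intro C(2) near_diff)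
    also have "lnorm (\<lambda>z. g z - g' z) \<le> lnorm (\<lambda>z. g z - f z) + lnorm (\<lambda>z. f z - g' z)"
      using lip_norm_triangle[OF diff_big(1)[OF gg(1)] diff_big(2)[OF gg(2)]] by simp
    also have "lnorm (\<lambda>z. f z - g' z) \<le> lnorm (\<lambda>z. g' z - f z)"
      using lip_norm_cmult_le[OF diff_big(1)[OF gg(2)], of "-1"] by simp
    finally show ?thesis using C(1) by (simp add: mult_left_mono)
  qed
  have "Cauchy (\<lambda>k. D j (g k))"
  proof (rule CauchyI)
    fix e :: real assume e: "0 < e"
    define q where "q = e / (C + 1)"
    have q: "0 < q" "C * q < e" using C(1) e by (auto simp: q_def pos_divide_less_eq algebra_simps)
    have "eventually (\<lambda>k. lnorm (\<lambda>z. g k z - f z) < q / 2) sequentially"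
      using lim q(1) by (intro order_tendstoD) auto
    then obtain N where N: "\<And>k. k \<ge> N \<Longrightarrow> lnorm (\<lambda>z. g k z - f z) < q / 2"
      by (auto simp: eventually_sequentially)
    have "norm (D j (g m) - D j (g n)) < e" if "N \<le> m" "N \<le> n" for m n
    proof -
      have "norm (D j (g m) - D j (g n)) \<le> C * (lnorm (\<lambda>z. g m z - f z) + lnorm (\<lambda>z. g n z - f z))"
        by (rule close[OF g g])
      also have "\<dots> \<le> C * (q / 2 + q / 2)"
        using N[OF that(1)] N[OF that(2)] C(1) by (intro mult_left_mono) auto
      also have "\<dots> < e" using q(2) by simp
      finally show ?thesis .
    qed
    then show "\<exists>M. \<forall>m\<ge>M. \<forall>n\<ge>M. norm (D j (g m) - D j (g n)) < e" by blast
  qed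
  then obtain L where L: "(\<lambda>k. D j (g k)) \<longlonglongrightarrow> L"
    using Cauchy_convergent_iff convergent_def by blast
  have "bpd_value \<alpha> U x j f = L"
  proof (cases "j = 0")
    case True
    have "(f \<longlongrightarrow> L) (at x within U)"
    proof (rule tendstoI)
      fix e :: real assume e: "0 < e"
      have "eventually (\<lambda>k. lnorm (\<lambda>z. g k z - f z) < e / 3) sequentially"
        using lim e by (intro order_tendstoD) auto
      moreover have "eventually (\<lambda>k. dist (D j (g k)) L < e / 3) sequentially"
        using L e by (intro tendstoD) auto
      ultimately have "eventually (\<lambda>k. lnorm (\<lambda>z. g k z - f z) < e / 3 \<and> dist (D j (g k)) L < e / 3) sequentially"
        by (rule eventually_conj)
      then obtain k where k: "lnorm (\<lambda>z. g k z - f z) < e / 3" "dist (g k x) L < e / 3"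
        using True by (auto simp: eventually_sequentially)
      have "isCont (g k) x"
        using near_analytic_at[OF g[of k]] by (simp add: analytic_at_imp_isCont)
      then have "(g k \<longlongrightarrow> g k x) (at x within U)"
        by (simp add: isCont_def tendsto_within_subset[where S = UNIV])
      then have "eventually (\<lambda>z. dist (g k z) (g k x) < e / 3) (at x within U)"
        using e by (intro tendstoD) auto
      moreover have "eventually (\<lambda>z. z \<in> U) (at x within U)"
        by (auto simp: eventually_at intro: exI[of _ 1])
      ultimately show "eventually (\<lambda>z. dist (f z) L < e) (at x within U)"
      proof eventually_elim
        case (elim z)
        have "dist (f z) (g k z) < e / 3"
          using norm_le_lip_norm[OF diff_big(1)[OF g] elim(2), of k] k(1) by (simp add: dist_norm norm_minus_commute)
        then show ?case
          using elim(1) k(2) dist_triangle[of "f z" L "g k z"] dist_triangle[of "g k z" L "g k x"] by linarith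
      qed
    qed
    \<comment> \<open>Without this the \<open>Lim\<close> would not be determined; \<open>x\<close>
      is a limit point of \<open>U\<close> because it lies in the closure but not in
      \<open>U\<close>.\<close>
    moreover have "at x within U \<noteq> bot"
      using x_frontier x_notin_U
      by (simp add: at_within_eq_bot_iff frontier_def)
    ultimately have "Lim (at x within U) f = L" by (intro tendsto_Lim) auto
    then show ?thesis using True by (simp add: bpd_value_def)
  next
    case False
    have "(THE L. \<exists>g. (\<forall>k. g k \<in> near) \<and> (\<lambda>k::nat. lnorm (\<lambda>z. g k z - f z)) \<longlonglongrightarrow> 0 \<and>
        (\<lambda>k. D j (g k)) \<longlonglongrightarrow> L) = L"
    proof (rule the_equality)
      show "\<exists>g. (\<forall>k. g k \<in> near) \<and> (\<lambda>k::nat. lnorm (\<lambda>z. g k z - f z)) \<longlonglongrightarrow> 0 \<and> (\<lambda>k. D j (g k)) \<longlonglongrightarrow> L"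
        using g lim L by blast
      fix L' assume "\<exists>g. (\<forall>k. g k \<in> near) \<and> (\<lambda>k::nat. lnorm (\<lambda>z. g k z - f z)) \<longlonglongrightarrow> 0 \<and> (\<lambda>k. D j (g k)) \<longlonglongrightarrow> L'"
      then obtain g' where g': "\<And>k. g' k \<in> near" "(\<lambda>k::nat. lnorm (\<lambda>z. g' k z - f z)) \<longlonglongrightarrow> 0"
        "(\<lambda>k. D j (g' k)) \<longlonglongrightarrow> L'" by blast
      have "(\<lambda>k. C * (lnorm (\<lambda>z. g' k z - f z) + lnorm (\<lambda>z. g k z - f z))) \<longlonglongrightarrow> C * (0 + 0)"
        by (intro tendsto_intros g'(2) lim)
      then have null: "(\<lambda>k. C * (lnorm (\<lambda>z. g' k z - f z) + lnorm (\<lambda>z. g k z - f z))) \<longlonglongrightarrow> 0"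
        by simp
      have "(\<lambda>k. D j (g' k) - D j (g k)) \<longlonglongrightarrow> 0"
        by (rule Lim_null_comparison[OF always_eventually null]) (rule allI, rule close[OF g'(1) g])
      moreover have "(\<lambda>k. D j (g' k) - D j (g k)) \<longlonglongrightarrow> L' - L" by (intro tendsto_diff g'(3) L)
      ultimately have "L' - L = 0" by (metis LIMSEQ_unique)
      then show "L' = L" by simp
    qed
    then show ?thesis using False by (simp add: bpd_value_def)
  qed
  then show ?thesis using L by simp
qed

text \<open>Both sides are continuous under norm approximation for a fixed \<open>y\<close>, and
  \<open>good_set\<close> does not depend on the approximating function.\<close>

lemma taylor_remainder_good:
  assumes \<epsilon>: "0 < \<epsilon>" and y: "y \<in> good_set \<epsilon>" and f: "f \<in> analytic_lip_space \<alpha> U"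
  shows "cmod (taylor_remainder \<alpha> U x t f y) \<le> \<epsilon> * cmod (y - x) ^ t * lnorm f"
proof -
  obtain g where g: "\<And>k. g k \<in> near" and lim: "(\<lambda>k::nat. lnorm (\<lambda>z. g k z - f z)) \<longlonglongrightarrow> 0"
    by (rule near_sequence[OF f]) blast
  have f_big: "f \<in> Lip" using f by (simp add: analytic_lip_space_def little_lip_imp_big)
  have diff_big: "(\<lambda>z. g k z - f z) \<in> Lip" for k
    by (rule big_lip_diff[OF near_big[OF g] f_big])
  have yU: "y \<in> U" using y by (simp add: good_set_def)
  have "(\<lambda>k. g k y - f y) \<longlonglongrightarrow> 0"
    by (rule Lim_null_comparison[OF _ lim]) (intro always_eventually allI norm_le_lip_norm diff_big yU)
  then have "(\<lambda>k. g k y) \<longlonglongrightarrow> f y" by (simp add: LIM_zero_iff)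
  then have "(\<lambda>k. taylor_rest (g k) y) \<longlonglongrightarrow> taylor_remainder \<alpha> U x t f y"
    unfolding taylor_rest_def taylor_remainder_def
    by (intro tendsto_intros bpd_value_tendsto[OF f g lim]) auto
  then have lhs: "(\<lambda>k. cmod (taylor_rest (g k) y)) \<longlonglongrightarrow> cmod (taylor_remainder \<alpha> U x t f y)"
    by (rule tendsto_norm)
  define A where "A = \<epsilon> * cmod (y - x) ^ t"
  have A: "0 \<le> A" using \<epsilon> by (simp add: A_def)
  have "(\<lambda>k. A * (lnorm f + lnorm (\<lambda>z. g k z - f z))) \<longlonglongrightarrow> A * (lnorm f + 0)"
    by (intro tendsto_intros lim)
  moreover have "cmod (taylor_rest (g k) y) \<le> A * (lnorm f + lnorm (\<lambda>z. g k z - f z))" for k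
  proof -
    have "cmod (taylor_rest (g k) y) \<le> A * lnorm (g k)"
      unfolding A_def by (rule taylor_rest_good[OF \<epsilon> y g])
    also have "\<dots> \<le> A * (lnorm f + lnorm (\<lambda>z. g k z - f z))"
      using lip_norm_triangle[OF f_big diff_big[of k]] A by (intro mult_left_mono) auto
    finally show ?thesis .
  qed
  ultimately have "cmod (taylor_remainder \<alpha> U x t f y) \<le> A * (lnorm f + 0)"
    by (intro LIMSEQ_le[OF lhs]) auto
  then show ?thesis by (simp add: A_def)
qed

end

theorem theorem8:
  fixes \<alpha> :: real and t :: nat and U :: "complex set" and x :: complex
  assumes "0 < \<alpha>" and "\<alpha> < 1"
    and "t \<ge> 1"
    and "open U" and "bounded U"
    and "x \<in> frontier U"
    and "admits_bounded_point_derivation \<alpha> U t x"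
  shows "\<forall>\<epsilon>>0. \<exists>E. E \<subseteq> U \<and> full_area_density E x \<and>
           (\<forall>y\<in>E. \<forall>f\<in>analytic_lip_space \<alpha> U.
              cmod (taylor_remainder \<alpha> U x t f y) \<le> \<epsilon> * cmod (y - x) ^ t * lip_norm \<alpha> U f)"
proof -
  have "U \<noteq> {}" using assms(6) by auto
  then interpret bounded_derivation \<alpha> U x t
    using assms by unfold_locales
  show ?thesis
  proof (intro allI impI)
    fix \<epsilon> :: real assume \<epsilon>: "0 < \<epsilon>"
    show "\<exists>E. E \<subseteq> U \<and> full_area_density E x \<and>
           (\<forall>y\<in>E. \<forall>f\<in>analytic_lip_space \<alpha> U.
              cmod (taylor_remainder \<alpha> U x t f y) \<le> \<epsilon> * cmod (y - x) ^ t * lip_norm \<alpha> U f)"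
      using full_area_density_good_set[OF \<epsilon>] taylor_remainder_good[OF \<epsilon>]
      by (intro exI[of _ "good_set \<epsilon>"]) (auto simp: good_set_def)
  qed
qed

end
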